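(* Let $g=\begin{pmatrix} a&0\\0&a^{-1}\end{pmatrix}\in SL(2,F)$ where $a\in 1+\mathfrak p$ and $a\neq a^{-1}$, and set $r:=\mathrm{val}(a-a^{-1})$. Let $\pi$ be a simple supercuspidal representation of $SL(2,F)$. Then $$\theta_\pi(g)=c_q\left(\sum_{w\in W^a:\ \ell(w)<r}q^{\ell(w)}\right),$$ where $c_q:=\frac{q-1}{2}$ if $p\neq 2$ and $c_q:=q-1$ if $p=2$.
   Context: $F$ is a nonarchimedean local field of characteristic zero with ring of integers $\mathfrak o$, maximal ideal $\mathfrak p$, residual characteristic $p$ (arbitrary), residue field of order $q$, fixed uniformizer $\varpi$, and normalized valuation $\mathrm{val}$. Let $T$ be the diagonal torus of $SL(2)$, $N$ the normalizer of $T(F)$ in $SL(2,F)$, $Z=\{\pm1\}$ the center, and $W^a=N/T(\mathfrak o)$ the affine Weyl group (an infinite dihedral group), with length function $\ell$ relative to the two simple affine reflections of the standard alcove, i.e. the one whose Iwahori subgroup is the group of matrices in $SL(2,\mathfrak o)$ with lower-left entry in $\mathfrak p$. Let $I_+$ be the group of matrices $(d_{ij})\in SL(2,F)$ with $d_{11},d_{22}\in 1+\mathfrak p$, $d_{12}\in\mathfrak o$, $d_{21}\in\mathfrak p$, and $I_{++}\subset I_+$ the subgroup with $d_{12}\in\mathfrak p$, $d_{21}\in\mathfrak p^2$. Put $H=Z(F)I_+$. A character $\chi:H\to\mathbb C^*$ is affine generic if it is trivial on $I_{++}$, nontrivial on $\{\begin{pmatrix}1&z\\ 0&1\end{pmatrix}:z\in\mathfrak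 o\}$ and nontrivial on $\{\begin{pmatrix}1&0\\ z&1\end{pmatrix}:z\in\mathfrak p\}$. A simple supercuspidal representation of $SL(2,F)$ is a representation $\mathrm{cInd}_H^{SL(2,F)}\chi$ (compact induction) with $\chi$ affine generic; it is irreducible and supercuspidal. $\theta_\pi$ denotes the Harish-Chandra character of $\pi$: the locally constant function on the regular semisimple set representing the distribution character of $\pi$. *)

theory Defs
  imports
    "HOL-Analysis.Analysis"
    "HOL-Algebra.Coset"
    "HOL-Library.Function_Algebras"
    "HOL-Computational_Algebra.Polynomial"
begin

section \<open>Nonarchimedean local fields of characteristic zero\<close>

text \<open>
  \<open>prime_pow val n\<close> is the fractional ideal \<open>\<pp>\<^sup>n\<close>; so \<open>prime_pow val 0\<close> is the ring of
  integers and \<open>prime_pow val 1\<close> its maximal ideal. The value \<open>val 0\<close> is never used.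
\<close>

definition prime_pow :: "('a::zero \<Rightarrow> int) \<Rightarrow> int \<Rightarrow> 'a set" where
  "prime_pow val n = {x. x = 0 \<or> n \<le> val x}"

definition residue_field :: "('a::ab_group_add \<Rightarrow> int) \<Rightarrow> 'a set set" where
  "residue_field val = prime_pow val 0 //
     {(x, y). x \<in> prime_pow val 0 \<and> y \<in> prime_pow val 0 \<and> x - y \<in> prime_pow val 1}"

definition residue_order :: "('a::ab_group_add \<Rightarrow> int) \<Rightarrow> nat" where
  "residue_order val = card (residue_field val)"

definition residue_char :: "('a::ring_1 \<Rightarrow> int) \<Rightarrow> nat" where
  "residue_char val = (LEAST n. 0 < n \<and> of_nat n \<in> prime_pow val 1)"

text \<open>
  Characteristic zero is part of the type class; \<open>unif\<close> is the fixed uniformizer, whose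
  existence makes the valuation normalized. The topology of the type is required to be the
  valuation topology.
\<close>

locale nonarch_local_field =
  fixes val :: "'a::{field_char_0, topological_space} \<Rightarrow> int" and unif :: 'a
  assumes val_mult: "x \<noteq> 0 \<Longrightarrow> y \<noteq> 0 \<Longrightarrow> val (x * y) = val x + val y"
    and val_add: "x \<noteq> 0 \<Longrightarrow> y \<noteq> 0 \<Longrightarrow> x + y \<noteq> 0 \<Longrightarrow> min (val x) (val y) \<le> val (x + y)"
    and unif: "unif \<noteq> 0" "val unif = 1"
    and open_iff: "open U \<longleftrightarrow> (\<forall>x\<in>U. \<exists>n. \<forall>y. y - x \<in> prime_pow val n \<longrightarrow> y \<in> U)"
    and complete: "(\<forall>n. \<exists>k. \<forall>i\<ge>k. \<forall>j\<ge>k. X i - X j \<in> prime_pow val n) \<Longrightarrow>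
                     \<exists>l. \<forall>n. \<exists>k. \<forall>i\<ge>k. X (i::nat) - l \<in> prime_pow val n"
    and finite_residue_field: "finite (residue_field val)"


section \<open>The group SL(2) and its affine Weyl group\<close>

definition mat2 :: "'a::zero \<Rightarrow> 'a \<Rightarrow> 'a \<Rightarrow> 'a \<Rightarrow> 'a^2^2" where
  "mat2 a b c d = vector [vector [a, b], vector [c, d]]"

definition SL2 :: "('a::field^2^2) monoid" where
  "SL2 = \<lparr>carrier = {A. det A = 1}, mult = (**), one = mat 1\<rparr>"

definition torus :: "('a::field^2^2) set" where
  "torus = {mat2 a 0 0 (inverse a) | a. a \<noteq> 0}"

definition torus_int :: "('a::field \<Rightarrow> int) \<Rightarrow> ('a^2^2) set" where
  "torus_int val = {mat2 a 0 0 (inverse a) | a. a \<noteq> 0 \<and> val a = 0}"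

definition normalizer :: "('g, 'm) monoid_scheme \<Rightarrow> 'g set \<Rightarrow> 'g set" where
  "normalizer G S = {n \<in> carrier G. n <#\<^bsub>G\<^esub> S #>\<^bsub>G\<^esub> inv\<^bsub>G\<^esub> n = S}"

definition affine_weyl :: "('a::field \<Rightarrow> int) \<Rightarrow> ('a^2^2) set monoid" where
  "affine_weyl val = SL2\<lparr>carrier := normalizer SL2 torus\<rparr> Mod torus_int val"

text \<open>
  The two simple affine reflections: together with the standard Iwahori subgroup they
  generate the two maximal parahoric subgroups containing it, namely \<open>SL(2,\<oo>)\<close> and the
  group of matrices with upper-right entry in \<open>\<pp>\<^sup>-\<^sup>1\<close> and lower-left entry in \<open>\<pp>\<close>.
\<close>

definition simple_reflections :: "('a::field \<Rightarrow> int) \<Rightarrow> 'a \<Rightarrow> ('a^2^2) set set" where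
  "simple_reflections val unif =
     {torus_int val #>\<^bsub>SL2\<^esub> mat2 0 1 (- 1) 0,
      torus_int val #>\<^bsub>SL2\<^esub> mat2 0 (inverse unif) (- unif) 0}"

definition word_length :: "('g, 'm) monoid_scheme \<Rightarrow> 'g set \<Rightarrow> 'g \<Rightarrow> nat" where
  "word_length G S w =
     (LEAST n. \<exists>ws. length ws = n \<and> set ws \<subseteq> S \<and> foldr (mult G) ws \<one>\<^bsub>G\<^esub> = w)"

definition weyl_length :: "('a::field \<Rightarrow> int) \<Rightarrow> 'a \<Rightarrow> ('a^2^2) set \<Rightarrow> nat" where
  "weyl_length val unif = word_length (affine_weyl val) (simple_reflections val unif)"


section \<open>Simple supercuspidal representations\<close>

definition I_plus :: "('a::field \<Rightarrow> int) \<Rightarrow> ('a^2^2) set" where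
  "I_plus val = {d \<in> carrier SL2.
     d$1$1 - 1 \<in> prime_pow val 1 \<and> d$2$2 - 1 \<in> prime_pow val 1 \<and>
     d$1$2 \<in> prime_pow val 0 \<and> d$2$1 \<in> prime_pow val 1}"

definition I_plus_plus :: "('a::field \<Rightarrow> int) \<Rightarrow> ('a^2^2) set" where
  "I_plus_plus val = {d \<in> I_plus val. d$1$2 \<in> prime_pow val 1 \<and> d$2$1 \<in> prime_pow val 2}"

definition H_sub :: "('a::field \<Rightarrow> int) \<Rightarrow> ('a^2^2) set" where
  "H_sub val = {mat 1, - mat 1} <#>\<^bsub>SL2\<^esub> I_plus val"

definition mult_complex :: "complex monoid" where
  "mult_complex = \<lparr>carrier = - {0}, mult = (*), one = 1\<rparr>"

definition affine_generic :: "('a::field \<Rightarrow> int) \<Rightarrow> ('a^2^2 \<Rightarrow> complex) \<Rightarrow> bool" where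
  "affine_generic val psi \<longleftrightarrow>
     psi \<in> hom (SL2\<lparr>carrier := H_sub val\<rparr>) mult_complex \<and>
     (\<forall>d\<in>I_plus_plus val. psi d = 1) \<and>
     (\<exists>z\<in>prime_pow val 0. psi (mat2 1 z 0 1) \<noteq> 1) \<and>
     (\<exists>z\<in>prime_pow val 1. psi (mat2 1 0 z 1) \<noteq> 1)"

text \<open>
  A representation on a space of complex-valued functions (with pointwise operations):
  a subspace of \<open>'x \<Rightarrow> complex\<close> together with the action.
\<close>

record ('g, 'x) fun_rep =
  rep_space :: "('x \<Rightarrow> complex) set"
  rep_act :: "'g \<Rightarrow> ('x \<Rightarrow> complex) \<Rightarrow> ('x \<Rightarrow> complex)"

interpretation fun_vs: vector_space "\<lambda>(c::complex) (f::'x \<Rightarrow> complex) x. c * f x"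
  by unfold_locales (auto simp: fun_eq_iff algebra_simps)

text \<open>
  Compact induction from a subgroup \<open>H\<close> of \<open>SL(2,F)\<close>: smooth functions on \<open>SL(2,F)\<close>
  (extended by 0 to all matrices) that transform under left translation by \<open>H\<close> according to
  \<open>psi\<close> and have compact support modulo \<open>H\<close>; the group acts by right translation.
\<close>

definition cInd ::
  "('a::{field, topological_space}^2^2) set \<Rightarrow> ('a^2^2 \<Rightarrow> complex) \<Rightarrow> ('a^2^2, 'a^2^2) fun_rep" where
  "cInd H psi = \<lparr>rep_space = {f.
       (\<forall>x. x \<notin> carrier SL2 \<longrightarrow> f x = 0) \<and>
       (\<forall>h\<in>H. \<forall>x\<in>carrier SL2. f (h ** x) = psi h * f x) \<and>
       (\<exists>K. subgroup K SL2 \<and> openin (top_of_set (carrier SL2)) K \<and>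
            (\<forall>k\<in>K. \<forall>x\<in>carrier SL2. f (x ** k) = f x)) \<and>
       (\<exists>C. compact C \<and> C \<subseteq> carrier SL2 \<and> {x. f x \<noteq> 0} \<subseteq> H <#>\<^bsub>SL2\<^esub> C)},
     rep_act = (\<lambda>g f x. f (x ** g))\<rparr>"

definition simple_supercuspidal ::
  "('a::{field, topological_space} \<Rightarrow> int) \<Rightarrow> ('a^2^2, 'a^2^2) fun_rep \<Rightarrow> bool" where
  "simple_supercuspidal val \<pi> \<longleftrightarrow> (\<exists>psi. affine_generic val psi \<and> \<pi> = cInd (H_sub val) psi)"


section \<open>The Harish-Chandra character\<close>

text \<open>
  Haar measures on \<open>SL(2,F)\<close>. Regularity need not be required: \<open>SL(2,F)\<close> is locally
  compact and second countable.
\<close>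

definition haar_SL2 :: "('a::{field, topological_space}^2^2) measure \<Rightarrow> bool" where
  "haar_SL2 \<mu> \<longleftrightarrow>
     sets \<mu> = sets (restrict_space borel (carrier SL2)) \<and>
     (\<forall>g\<in>carrier SL2. \<forall>A\<in>sets \<mu>. emeasure \<mu> ((\<lambda>x. g ** x) ` A) = emeasure \<mu> A) \<and>
     (\<forall>C. compact C \<and> C \<subseteq> carrier SL2 \<longrightarrow> emeasure \<mu> C < \<infinity>) \<and>
     (\<forall>U. openin (top_of_set (carrier SL2)) U \<and> U \<noteq> {} \<longrightarrow> emeasure \<mu> U > 0)"

definition locally_constant_on :: "'b::topological_space set \<Rightarrow> ('b \<Rightarrow> 'c) \<Rightarrow> bool" where
  "locally_constant_on S f \<longleftrightarrow>
     (\<forall>x\<in>S. \<exists>U. openin (top_of_set S) U \<and> x \<in> U \<and> f constant_on U)"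

text \<open>The space \<open>C\<^sub>c\<^sup>\<infinity>(SL(2,F))\<close>, again with functions extended by 0 to all matrices.\<close>

definition test_functions :: "('a::{field, topological_space}^2^2 \<Rightarrow> complex) set" where
  "test_functions = {f. locally_constant_on (carrier SL2) f \<and>
     (\<exists>C. compact C \<and> C \<subseteq> carrier SL2 \<and> (\<forall>x. x \<notin> C \<longrightarrow> f x = 0))}"

text \<open>
  The operator \<open>\<pi>(f) = \<integral> f(g) \<pi>(g) dg\<close>. For a smooth representation \<open>\<pi>\<close> and \<open>v\<close> in its
  space, \<open>g \<mapsto> f(g) \<pi>(g) v\<close> is locally constant with compact support, so the integral is a
  finite linear combination of vectors and may be evaluated pointwise.
\<close>

definition rep_op :: "'g measure \<Rightarrow> ('g, 'x) fun_rep \<Rightarrow> ('g \<Rightarrow> complex) \<Rightarrow>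
    ('x \<Rightarrow> complex) \<Rightarrow> ('x \<Rightarrow> complex)" where
  "rep_op \<mu> \<pi> f v = (\<lambda>x. LINT g|\<mu>. f g * rep_act \<pi> g v x)"

text \<open>
  The trace of a finite-rank operator \<open>A\<close> on a space \<open>V\<close> of functions, i.e. the trace of its
  restriction to its finite-dimensional image, computed in any basis \<open>B\<close> of the image.
\<close>

definition finite_rank_trace ::
  "('x \<Rightarrow> complex) set \<Rightarrow> (('x \<Rightarrow> complex) \<Rightarrow> ('x \<Rightarrow> complex)) \<Rightarrow> complex" where
  "finite_rank_trace V A =
     (let B = (SOME B. fun_vs.independent B \<and> fun_vs.span B = A ` V)
      in \<Sum>b\<in>B. fun_vs.representation B (A b) b)"

definition distribution_character :: "'g measure \<Rightarrow> ('g, 'x) fun_rep \<Rightarrow> ('g \<Rightarrow> complex) \<Rightarrow> complex" where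
  "distribution_character \<mu> \<pi> f = finite_rank_trace (rep_space \<pi>) (rep_op \<mu> \<pi> f)"

definition char_polynomial :: "'a::field^'n^'n \<Rightarrow> 'a poly" where
  "char_polynomial A = det (mat [:0, 1:] - (\<chi> i j. [:A$i$j:]))"

text \<open>
  An element is regular semisimple iff its eigenvalues in an algebraic closure are distinct,
  i.e. iff its characteristic polynomial is separable.
\<close>

definition regular_semisimple :: "('a::field^2^2) set" where
  "regular_semisimple =
     {x \<in> carrier SL2. coprime (char_polynomial x) (pderiv (char_polynomial x))}"

text \<open>
  \<open>is_HC_character \<mu> \<pi> \<theta>\<close>: \<open>\<theta>\<close> is locally constant on the regular semisimple set (values
  elsewhere are irrelevant) and represents the distribution character of \<open>\<pi>\<close>. These
  conditions determine \<open>\<theta>\<close> on the regular semisimple set, independently of the Haar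
  measure \<open>\<mu>\<close>, since the distribution character scales in the same way as \<open>\<mu>\<close>.
\<close>

definition is_HC_character :: "('a::{field, topological_space}^2^2) measure \<Rightarrow>
    ('a^2^2, 'x) fun_rep \<Rightarrow> ('a^2^2 \<Rightarrow> complex) \<Rightarrow> bool" where
  "is_HC_character \<mu> \<pi> \<theta> \<longleftrightarrow>
     locally_constant_on regular_semisimple \<theta> \<and>
     (\<forall>f\<in>test_functions.
        set_integrable \<mu> regular_semisimple (\<lambda>x. f x * \<theta> x) \<and>
        distribution_character \<mu> \<pi> f = (LINT x:regular_semisimple|\<mu>. f x * \<theta> x))"

definition c_const :: "('a::ring_1 \<Rightarrow> int) \<Rightarrow> real" where
  "c_const val = (if residue_char val \<noteq> 2 then (real (residue_order val) - 1) / 2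
                  else real (residue_order val) - 1)"

end

theory Submission
  imports Defs
begin

text \<open>
  Write \<open>H = Z I\<^sub>+\<close>, let \<open>psi\<close> be the affine generic character, and let \<open>chi\<close> be \<open>psi\<close> extended by
  zero outside \<open>H\<close>. Let \<open>K\<^sub>n\<close> be the principal congruence subgroup of level \<open>n\<close>. The diagonal
  element \<open>g\<close> normalizes \<open>K\<^sub>n\<close>, and for large \<open>n\<close> the character is constant on \<open>g K\<^sub>n\<close>. Applied to
  the indicator function of \<open>g K\<^sub>n\<close>, both sides of the defining identity of the character acquire the
  factor \<open>vol (g K\<^sub>n)\<close>, and cancelling it leaves: \<open>\<theta>(g)\<close> is the trace of \<open>\<pi>(g)\<close> on the space of
  \<open>K\<^sub>n\<close>-fixed vectors (\<open>opL_fixed\<close>, \<open>opL_image\<close>).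

  For \<open>n = 2 M + 2\<close> that space consists of the equivariant functions supported on the set
  \<open>\<Omega>\<^sub>M\<close> of matrices in \<open>SL(2,F)\<close> with entries in \<open>\<pp>\<^sup>-\<^sup>M\<close>. If \<open>x\<close> lies in \<open>\<Omega>\<^sub>M\<close>, then \<open>x K\<^sub>n x\<^sup>-\<^sup>1\<close> is
  contained in \<open>I\<^sub>+\<^sub>+\<close>, where \<open>psi\<close> is trivial (\<open>fixed_space_invariant\<close>). If \<open>x\<close> lies outside, a row
  operation from \<open>H\<close> makes one row of \<open>x\<close> so small that \<open>x\<^sup>-\<^sup>1 u x\<close> lies in \<open>K\<^sub>n\<close> for an element \<open>u\<close> of
  a simple affine root subgroup with \<open>psi u \<noteq> 1\<close>, which forces the value at \<open>x\<close> to be zero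
  (\<open>invariant_supported\<close>); this is cuspidality. Hence \<open>\<theta>(g)\<close> is the finite sum of
  \<open>chi (x g x\<^sup>-\<^sup>1)\<close> over \<open>H \ \<Omega>\<^sub>M\<close> (\<open>trace_formula\<close>).

  The Iwasawa decomposition provides the representatives \<open>(\<tau>, \<tau> z; 0, \<tau>\<^sup>-\<^sup>1)\<close> and
  \<open>(0, \<tau>; - \<tau>\<^sup>-\<^sup>1, - \<tau>\<^sup>-\<^sup>1 z)\<close>, where \<open>\<tau>\<close> is a unit times the \<open>m\<close>-th power of the uniformizer
  and \<open>z\<close> runs through a finite quotient of fractional ideals (\<open>card_index\<close>). The conjugate
  \<open>x g x\<^sup>-\<^sup>1\<close> is triangular with an off-diagonal entry linear in \<open>z\<close>, so the sum over \<open>z\<close> is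
  the sum of an additive character over a group: it vanishes unless the character is trivial on that group,
  and then it counts the elements \<open>z\<close> (\<open>character_sum\<close>). What survives is \<open>q\<^sup>p\<close> for \<open>m = M - p\<close>,
  \<open>0 \<le> p < r\<close>, from the first family and \<open>q\<^sup>p\<close> for \<open>m = p - 1 - M\<close>, \<open>0 < p < r\<close>, from
  the second. The affine Weyl group has one element of length 0 and two of every
  positive length (\<open>weyl_length_at\<close>), so these are the terms of the sum over \<open>\<ell>(w) < r\<close>. The sum
  over the unit part of \<open>\<tau>\<close> contributes the number of nonzero residue classes modulo sign, which is \<open>c\<^sub>q\<close>.
\<close>

section \<open>Valuations, transversals and character sums\<close>

context nonarch_local_field begin

abbreviation P where "P \<equiv> prime_pow val"

lemma val_one [simp]: "val 1 = 0"
  using val_mult[of 1 1] by simp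

lemma val_minus [simp]: "val (- x) = val x"
proof (cases "x = 0")
  case False
  have "val (-1) + val (-1) = val ((-1) * (-1))" by (rule val_mult[symmetric]) auto
  then have "val (-1) = 0" by simp
  then show ?thesis using val_mult[of "-1" x] False by simp
qed simp

lemma val_inverse: "x \<noteq> 0 \<Longrightarrow> val (inverse x) = - val x"
  using val_mult[of x "inverse x"] by simp

lemma val_divide: "x \<noteq> 0 \<Longrightarrow> y \<noteq> 0 \<Longrightarrow> val (x / y) = val x - val y"
  by (simp add: divide_inverse val_mult val_inverse)

lemma P_iff: "x \<noteq> 0 \<Longrightarrow> x \<in> P n \<longleftrightarrow> n \<le> val x"
  by (simp add: prime_pow_def)

lemma P_0 [simp]: "0 \<in> P n" by (simp add: prime_pow_def)

lemma P_add: "x \<in> P n \<Longrightarrow> y \<in> P n \<Longrightarrow> x + y \<in> P n"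
  using val_add[of x y] by (cases "x = 0"; cases "y = 0"; cases "x + y = 0") (auto simp: prime_pow_def)

lemma P_minus_iff [simp]: "- x \<in> P n \<longleftrightarrow> x \<in> P n"
  by (auto simp: prime_pow_def)

lemma P_diff: "x \<in> P n \<Longrightarrow> y \<in> P n \<Longrightarrow> x - y \<in> P n"
  using P_add[of x n "- y"] by simp

lemma P_diff_commute: "x - y \<in> P n \<longleftrightarrow> y - x \<in> P n"
  using P_minus_iff[of "x - y" n] by simp

lemma P_diff_trans: "x - y \<in> P n \<Longrightarrow> y - z \<in> P n \<Longrightarrow> x - z \<in> P n"
  using P_add[of "x - y" n "y - z"] by simp

lemma P_mult: "x \<in> P m \<Longrightarrow> y \<in> P n \<Longrightarrow> k \<le> m + n \<Longrightarrow> x * y \<in> P k"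
  by (cases "x = 0"; cases "y = 0") (auto simp: prime_pow_def val_mult)

lemma P_mono: "x \<in> P n \<Longrightarrow> m \<le> n \<Longrightarrow> x \<in> P m"
  by (auto simp: prime_pow_def)

lemma one_in_P0 [simp]: "1 \<in> P 0" by (simp add: prime_pow_def)

lemma P_scale_iff: "c \<noteq> 0 \<Longrightarrow> c * x \<in> P n \<longleftrightarrow> x \<in> P (n - val c)"
  by (cases "x = 0") (auto simp: prime_pow_def val_mult)

lemma P_diff_absorb: "y \<in> P n \<Longrightarrow> x - y \<in> P n \<longleftrightarrow> x \<in> P n"
  using P_add[of "x - y" n y] P_diff by fastforce

lemma P_add_absorb: "y \<in> P n \<Longrightarrow> x + y \<in> P n \<longleftrightarrow> x \<in> P n"
  using P_diff_absorb[of "-y" n x] by simp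

lemma one_not_in_P1: "1 \<notin> P 1" by (simp add: prime_pow_def)

lemma one_unit: assumes "x - 1 \<in> P 1" shows "x \<noteq> 0" "val x = 0"
proof -
  show nz: "x \<noteq> 0" using assms one_not_in_P1 by auto
  have "x \<in> P 0" using P_add[OF P_mono[OF assms] one_in_P0] by simp
  moreover have "x \<notin> P 1" using P_diff[of x 1 "x - 1"] assms one_not_in_P1 by auto
  ultimately show "val x = 0" using nz by (auto simp: prime_pow_def)
qed

definition unif_pow :: "int \<Rightarrow> 'a" where
  "unif_pow m = (if 0 \<le> m then unif ^ nat m else inverse (unif ^ nat (- m)))"

lemma unif_pow_nz [simp]: "unif_pow m \<noteq> 0" by (simp add: unif_pow_def unif)

lemma val_unif_pow [simp]: "val (unif_pow m) = m"
proof -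
  have *: "val (unif ^ k) = int k" for k
    by (induction k) (auto simp: val_mult unif)
  show ?thesis by (simp add: unif_pow_def val_inverse unif *)
qed

definition q where "q \<equiv> residue_order val"

text \<open>
  Quotients \<open>\<pp>\<^sup>A/\<pp>\<^sup>B\<close> enter only through systems of representatives, so that sums over them are
  sums over finite sets of field elements.
\<close>

definition transversal :: "int \<Rightarrow> int \<Rightarrow> 'a set \<Rightarrow> bool" where
  "transversal A B S \<longleftrightarrow> finite S \<and> S \<subseteq> P A \<and> (\<forall>x\<in>P A. \<exists>!s. s \<in> S \<and> x - s \<in> P B)"

lemma transversal_ex1: "transversal A B S \<Longrightarrow> x \<in> P A \<Longrightarrow> \<exists>!s. s \<in> S \<and> x - s \<in> P B"
  by (simp add: transversal_def)

lemma transversalE: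
  assumes "transversal A B S" "x \<in> P A"
  obtains s where "s \<in> S" "x - s \<in> P B" "\<forall>t\<in>S. x - t \<in> P B \<longrightarrow> t = s"
  using transversal_ex1[OF assms] by blast

lemma transversal_residue: "\<exists>S. transversal 0 1 S \<and> card S = q"
proof -
  define R where "R = {(x, y). x \<in> P 0 \<and> y \<in> P 0 \<and> x - y \<in> P 1}"
  have Rd: "(x, y) \<in> R \<longleftrightarrow> x \<in> P 0 \<and> y \<in> P 0 \<and> x - y \<in> P 1" for x y
    by (simp add: R_def)
  have R: "equiv (P 0) R"
    unfolding R_def
    by (intro equivI refl_onI symI transI) (auto simp: P_diff_commute intro: P_diff_trans)
  have fin: "finite (P 0 // R)" and qR: "q = card (P 0 // R)"
    using finite_residue_field by (simp_all add: residue_field_def residue_order_def q_def R_def)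
  define c where "c = (\<lambda>C. SOME x::'a. x \<in> C)"
  have c: "c C \<in> C" if "C \<in> P 0 // R" for C
    using in_quotient_imp_non_empty[OF R that] by (simp add: c_def some_in_eq)
  have cP: "c C \<in> P 0" if "C \<in> P 0 // R" for C
    using c[OF that] in_quotient_imp_subset[OF R that] by auto
  have inj: "inj_on c (P 0 // R)"
  proof (rule inj_onI)
    fix C D assume h: "C \<in> P 0 // R" "D \<in> P 0 // R" "c C = c D"
    then show "C = D" using c[OF h(1)] c[OF h(2)] quotient_disj[OF R h(1,2)] by auto
  qed
  have "transversal 0 1 (c ` (P 0 // R))"
    unfolding transversal_def
  proof (intro conjI ballI)
    fix x assume x: "x \<in> P 0"
    let ?C = "R `` {x}"
    have C: "?C \<in> P 0 // R" using x by (rule quotientI)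
    have "(x, c ?C) \<in> R" using c[OF C] by auto
    then have 1: "x - c ?C \<in> P 1" by (simp only: Rd)
    show "\<exists>!s. s \<in> c ` (P 0 // R) \<and> x - s \<in> P 1"
    proof (intro ex1I[of _ "c ?C"] conjI)
      fix s assume "s \<in> c ` (P 0 // R) \<and> x - s \<in> P 1"
      then obtain D where D: "D \<in> P 0 // R" "s = c D" "x - c D \<in> P 1" by auto
      then have "(x, c D) \<in> R" using x cP by (simp only: Rd)
      then have "c D \<in> ?C" by simp
      then have "D = ?C" using D C c[OF D(1)] R quotient_disj by fastforce
      then show "s = c ?C" using D by simp
    qed (use 1 C in auto)
  qed (use fin cP in auto)
  moreover have "card (c ` (P 0 // R)) = q" using inj qR by (simp add: card_image)
  ultimately show ?thesis by blast
qed

lemma transversal_scale: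
  assumes S: "transversal A B S" and c: "c \<noteq> 0"
  shows "transversal (A + val c) (B + val c) ((*) c ` S)" "card ((*) c ` S) = card S"
proof -
  have inj: "inj ((*) c)" using c by (auto intro: injI)
  then show "card ((*) c ` S) = card S" by (meson card_image inj_on_subset subset_UNIV)
  show "transversal (A + val c) (B + val c) ((*) c ` S)"
    unfolding transversal_def
  proof (intro conjI ballI)
    fix x assume x: "x \<in> P (A + val c)"
    have iff: "x - c * s \<in> P (B + val c) \<longleftrightarrow> x / c - s \<in> P B" for s
      using P_scale_iff[OF c, of "x / c - s" "B + val c"] c by (simp add: algebra_simps)
    have "x / c \<in> P A" using P_scale_iff[OF c, of "x / c" "A + val c"] x c by simp
    then obtain s where s: "s \<in> S" "x / c - s \<in> P B" "\<forall>t\<in>S. x / c - t \<in> P B \<longrightarrow> t = s"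
      by (rule transversalE[OF S])
    show "\<exists>!s. s \<in> (*) c ` S \<and> x - s \<in> P (B + val c)"
    proof (intro ex1I[of _ "c * s"] conjI)
      show "c * s \<in> (*) c ` S" using s by blast
      show "x - c * s \<in> P (B + val c)" using s iff by blast
    next
      fix y assume "y \<in> (*) c ` S \<and> x - y \<in> P (B + val c)"
      then obtain t where "t \<in> S" "y = c * t" "x - c * t \<in> P (B + val c)" by blast
      then show "y = c * s" using s(3) iff[of t] by simp
    qed
  qed (use S c in \<open>auto simp: transversal_def P_scale_iff\<close>)
qed

lemma transversal_trans:
  assumes S: "transversal A B S" and S': "transversal B C S'" and le: "A \<le> B" "B \<le> C"
  shows "\<exists>S''. transversal A C S'' \<and> card S'' = card S * card S'"
proof (intro exI conjI)
  let ?f = "\<lambda>(s, s'). s + s'"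
  have mem: "s \<in> P A" if "s \<in> S" for s using that S by (auto simp: transversal_def)
  have mem': "s \<in> P B" if "s \<in> S'" for s using that S' by (auto simp: transversal_def)
  have uniq: "s = t \<and> s' = t'"
    if h: "s \<in> S" "t \<in> S" "s' \<in> S'" "t' \<in> S'" "x - (s + s') \<in> P C" "x - (t + t') \<in> P C" for s t s' t' x :: 'a
  proof -
    have "(s + s') - (t + t') \<in> P C" using P_diff[OF h(6) h(5)] by (simp add: algebra_simps)
    moreover then have "(s + s') - (t + t') \<in> P B" using le P_mono by blast
    then have "s - t + (s' - t') \<in> P B" by (simp add: algebra_simps)
    then have "s - t \<in> P B" using P_add_absorb[OF P_diff[OF mem'[OF h(3)] mem'[OF h(4)]]] by simp
    moreover have "s - s \<in> P B" by simp
    moreover have "\<exists>!u. u \<in> S \<and> s - u \<in> P B" by (rule transversal_ex1[OF S mem[OF h(1)]])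
    ultimately have st: "s = t" using h by blast
    have "s' - t' \<in> P C" using \<open>(s + s') - (t + t') \<in> P C\<close> st by simp
    moreover have "s' - s' \<in> P C" by simp
    moreover have "\<exists>!u. u \<in> S' \<and> s' - u \<in> P C" by (rule transversal_ex1[OF S' mem'[OF h(3)]])
    ultimately show ?thesis using h st by blast
  qed
  have inj: "inj_on ?f (S \<times> S')"
  proof (rule inj_onI, clarify)
    fix s s' t t' assume h: "s \<in> S" "t \<in> S" "s' \<in> S'" "t' \<in> S'" "s + s' = t + t'"
    have "(s + s') - (s + s') \<in> P C" "(s + s') - (t + t') \<in> P C" using h(5) by auto
    from uniq[OF h(1-4) this] show "s = t \<and> s' = t'" .
  qed
  show "card (?f ` (S \<times> S')) = card S * card S'"
    using inj by (simp add: card_image card_cartesian_product)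
  show "transversal A C (?f ` (S \<times> S'))"
    unfolding transversal_def
  proof (intro conjI ballI)
    show "?f ` (S \<times> S') \<subseteq> P A" using mem mem' le by (auto intro: P_add P_mono)
    fix x assume "x \<in> P A"
    then obtain s where s: "s \<in> S" "x - s \<in> P B" using transversal_ex1[OF S] by blast
    from s(2) obtain s' where s': "s' \<in> S'" "x - s - s' \<in> P C" using transversal_ex1[OF S'] by blast
    show "\<exists>!s. s \<in> ?f ` (S \<times> S') \<and> x - s \<in> P C"
    proof (intro ex1I[of _ "s + s'"] conjI)
      fix y assume "y \<in> ?f ` (S \<times> S') \<and> x - y \<in> P C"
      then obtain t t' where "t \<in> S" "t' \<in> S'" "y = t + t'" "x - (t + t') \<in> P C" by auto
      then show "y = s + s'" using uniq[of s t s' t' x] s s' by (simp add: algebra_simps)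
    next
      show "s + s' \<in> ?f ` (S \<times> S')" using s s' by force
    qed (use s' in \<open>simp add: algebra_simps\<close>)
  qed (use S S' in \<open>auto simp: transversal_def\<close>)
qed

lemma transversal_exists_nat: "\<exists>S. transversal A (A + int k) S \<and> card S = q ^ k"
proof (induction k)
  case 0
  have "transversal A A {0}" by (auto simp: transversal_def)
  then show ?case by (intro exI[of _ "{0}"]) simp
next
  case (Suc k)
  obtain S0 where S0: "transversal 0 1 S0" "card S0 = q" using transversal_residue by blast
  let ?c = "unif_pow (A + int k)"
  have 1: "transversal (A + int k) (A + int k + 1) ((*) ?c ` S0)"
    using transversal_scale(1)[OF S0(1), of ?c] by (simp add: ac_simps)
  have 2: "card ((*) ?c ` S0) = q"
    using transversal_scale(2)[OF S0(1), of ?c] S0(2) by simp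
  obtain S where S: "transversal A (A + int k) S" "card S = q ^ k" using Suc by blast
  obtain S'' where T: "transversal A (A + int k + 1) S''" "card S'' = card S * card ((*) ?c ` S0)"
    using transversal_trans[OF S(1) 1] by auto
  have e: "A + int (Suc k) = A + int k + 1" by simp
  have "card S'' = q ^ Suc k" using T(2) 2 S(2) by (simp add: mult.commute)
  with T(1) show ?case unfolding e by blast
qed

lemma transversal_exists: "A \<le> B \<Longrightarrow> \<exists>S. transversal A B S \<and> card S = q ^ nat (B - A)"
  using transversal_exists_nat[of A "nat (B - A)"] by simp

text \<open>
  Translation by \<open>w\<close> permutes \<open>\<pp>\<^sup>A/\<pp>\<^sup>B\<close>; on representatives this is the bijection
  taking \<open>z\<close> to the representative of \<open>z + w\<close>.
\<close>

lemma transversal_sum_shift: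
  fixes F :: "'a \<Rightarrow> complex"
  assumes S: "transversal A B S" and w: "w \<in> P A"
    and F: "\<And>x y. x \<in> P A \<Longrightarrow> y \<in> P A \<Longrightarrow> x - y \<in> P B \<Longrightarrow> F x = F y"
  shows "(\<Sum>z\<in>S. F (z + w)) = (\<Sum>z\<in>S. F z)"
proof -
  define rp where "rp = (\<lambda>x. THE s. s \<in> S \<and> x - s \<in> P B)"
  have mem: "s \<in> P A" if "s \<in> S" for s using that S by (auto simp: transversal_def)
  have ex: "\<exists>!s. s \<in> S \<and> x - s \<in> P B" if "x \<in> P A" for x
    by (rule transversal_ex1[OF S that])
  have rp: "rp x \<in> S" "x - rp x \<in> P B" if "x \<in> P A" for x
    using theI'[OF ex[OF that]] unfolding rp_def by blast+
  have rpI: "rp x = s" if "x \<in> P A" "s \<in> S" "x - s \<in> P B" for x s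
    using ex[OF that(1)] rp[OF that(1)] that(2,3) by blast
  have zw: "z + w \<in> P A" "z - w \<in> P A" if "z \<in> S" for z
    using P_add[OF mem[OF that] w] P_diff[OF mem[OF that] w] by auto
  show ?thesis
  proof (rule sum.reindex_bij_witness[where i = "\<lambda>z. rp (z - w)" and j = "\<lambda>z. rp (z + w)"])
    fix z assume z: "z \<in> S"
    show "rp (z + w) \<in> S" "rp (z - w) \<in> S" using rp zw z by auto
    let ?u = "rp (z + w)" and ?v = "rp (z - w)"
    have u: "?u \<in> S" "z + w - ?u \<in> P B" and v: "?v \<in> S" "z - w - ?v \<in> P B"
      using rp zw[OF z] by auto
    have "?u - (z + w) \<in> P B" using u(2) P_diff_commute by blast
    then have u': "?u - w - z \<in> P B" by (simp add: algebra_simps)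
    show "rp (?u - w) = z" by (rule rpI[OF P_diff[OF mem[OF u(1)] w] z u'])
    have "?v - (z - w) \<in> P B" using v(2) P_diff_commute by blast
    then have v': "?v + w - z \<in> P B" by (simp add: algebra_simps)
    show "rp (?v + w) = z" by (rule rpI[OF P_add[OF mem[OF v(1)] w] z v'])
    show "F ?u = F (z + w)"
      by (rule F[OF zw(1)[OF z] mem[OF u(1)] u(2), symmetric])
  qed
qed

lemma P_val [simp]: "x \<in> P (val x)"
  by (simp add: prime_pow_def)

lemma P_div: "x \<in> P (val y + k) \<Longrightarrow> y \<noteq> 0 \<Longrightarrow> x / y \<in> P k"
  by (cases "x = 0") (auto simp: prime_pow_def val_divide)

text \<open>
  Orthogonality for the additive character \<open>z \<mapsto> \<phi> (\<kappa> z)\<close>. Extension by zero is harmless: choose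
  \<open>x\<close> with \<open>\<phi> x \<noteq> 1\<close>; translating by \<open>x / \<kappa>\<close> multiplies the summand by \<open>\<phi> x\<close>, including where it is zero,
  so the sum vanishes as soon as \<open>x / \<kappa>\<close> lies in \<open>\<pp>\<^sup>A\<close>. Otherwise every argument lies in the kernel.
\<close>

lemma character_sum:
  fixes \<phi> :: "'a \<Rightarrow> complex"
  assumes S: "transversal A B S" and \<kappa>: "\<kappa> \<noteq> 0" and B: "e + 1 \<le> B + val \<kappa>"
    and add: "\<And>x y. x \<in> P e \<Longrightarrow> y \<in> P e \<Longrightarrow> \<phi> (x + y) = \<phi> x * \<phi> y"
    and triv: "\<And>x. x \<in> P (e + 1) \<Longrightarrow> \<phi> x = 1"
    and nontriv: "\<exists>x\<in>P e. \<phi> x \<noteq> 1"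
  shows "(\<Sum>z\<in>S. if \<kappa> * z \<in> P e then \<phi> (\<kappa> * z) else 0) =
    (if e + 1 \<le> A + val \<kappa> then of_nat (card S) else 0)"
proof (cases "e + 1 \<le> A + val \<kappa>")
  case True
  have "(if \<kappa> * z \<in> P e then \<phi> (\<kappa> * z) else 0) = 1" if "z \<in> S" for z
  proof -
    have "z \<in> P A" using S that by (auto simp: transversal_def)
    moreover have "e + 1 \<le> val \<kappa> + A" using True by linarith
    ultimately have "\<kappa> * z \<in> P (e + 1)" by (rule P_mult[OF P_val])
    then show ?thesis using triv P_mono[of _ "e + 1" e] by simp
  qed
  then show ?thesis using True by simp
next
  case False
  define F where "F = (\<lambda>z. if \<kappa> * z \<in> P e then \<phi> (\<kappa> * z) else 0)"
  obtain x where x: "x \<in> P e" "\<phi> x \<noteq> 1" using nontriv by blast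
  let ?w = "x / \<kappa>"
  have lw: "\<kappa> * ?w = x" using \<kappa> by simp
  have w: "?w \<in> P A"
    using P_mono[OF P_div[of x \<kappa> "e - val \<kappa>"], of A] x \<kappa> False by simp
  have per: "F y = F z" if "y \<in> P A" "z \<in> P A" "y - z \<in> P B" for y z
  proof -
    have "e + 1 \<le> val \<kappa> + B" using B by linarith
    with that(3) have d: "\<kappa> * (y - z) \<in> P (e + 1)" by (rule P_mult[OF P_val])
    have yz: "\<kappa> * y = \<kappa> * z + \<kappa> * (y - z)" by (simp add: algebra_simps)
    have iff: "\<kappa> * y \<in> P e \<longleftrightarrow> \<kappa> * z \<in> P e"
      unfolding yz using P_add_absorb P_mono[OF d] by simp
    have "\<phi> (\<kappa> * y) = \<phi> (\<kappa> * z)" if "\<kappa> * z \<in> P e"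
      unfolding yz using add[OF that P_mono[OF d]] triv[OF d] by simp
    then show ?thesis using iff by (simp add: F_def)
  qed
  have shift: "F (z + ?w) = \<phi> x * F z" for z
  proof -
    have e: "\<kappa> * (z + ?w) = \<kappa> * z + x" using lw by (simp add: distrib_left)
    have "\<kappa> * z + x \<in> P e \<longleftrightarrow> \<kappa> * z \<in> P e" by (rule P_add_absorb[OF x(1)])
    then show ?thesis unfolding F_def e using add[OF _ x(1), of "\<kappa> * z"] by (simp add: mult.commute)
  qed
  have "(\<Sum>z\<in>S. F z) = (\<Sum>z\<in>S. F (z + ?w))"
    by (rule transversal_sum_shift[OF S w per, symmetric])
  also have "\<dots> = \<phi> x * (\<Sum>z\<in>S. F z)"
    by (simp only: shift sum_distrib_left)
  finally have "(\<Sum>z\<in>S. F z) = 0" using x(2) by simp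
  then show ?thesis using False by (simp add: F_def)
qed

end

section \<open>Matrices of size two and the affine Weyl group\<close>

lemma mat2_nth [simp]:
  "mat2 a b c d $ 1 $ 1 = a" "mat2 a b c d $ 1 $ 2 = b"
  "mat2 a b c d $ 2 $ 1 = c" "mat2 a b c d $ 2 $ 2 = d"
  by (simp_all add: mat2_def)

lemma mat2_collapse: "mat2 (x $ 1 $ 1) (x $ 1 $ 2) (x $ 2 $ 1) (x $ 2 $ 2) = x"
  by (simp add: vec_eq_iff forall_2)

lemma mat2_cases [case_names mat2, cases type]:
  fixes x :: "'a::zero^2^2"
  obtains a b c d where "x = mat2 a b c d"
  using mat2_collapse[of x] by metis

lemma mat2_eq_iff [simp]:
  "mat2 a b c d = mat2 a' b' c' d' \<longleftrightarrow> a = a' \<and> b = b' \<and> c = c' \<and> d = d'"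
  by (auto simp: vec_eq_iff forall_2)

lemma mat2_mult [simp]:
  "mat2 a b c d ** mat2 a' b' c' d' =
     mat2 (a * a' + b * c') (a * b' + b * d') (c * a' + d * c') (c * b' + d * d')"
  by (simp add: vec_eq_iff forall_2 matrix_matrix_mult_def sum_2)

lemma mat_one_eq_mat2: "mat 1 = mat2 1 0 0 1"
  by (simp add: vec_eq_iff forall_2 mat_def)

lemma uminus_mat2 [simp]: "- mat2 a b c d = (mat2 (- a) (- b) (- c) (- d) :: 'a::group_add^2^2)"
  by (simp add: vec_eq_iff forall_2)

lemma det_mat2: "det (mat2 a b c d :: 'a::comm_ring_1^2^2) = a * d - b * c"
  by (simp add: det_2)

lemma mat2_in_SL2 [simp]: "mat2 a b c d \<in> carrier SL2 \<longleftrightarrow> a * d - b * c = 1"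
  by (simp add: SL2_def det_mat2)

lemma SL2_mult [simp]: "x \<otimes>\<^bsub>SL2\<^esub> y = x ** y" and SL2_one: "\<one>\<^bsub>SL2\<^esub> = mat 1"
  by (simp_all add: SL2_def)

lemma SL2_iff: "x \<in> carrier SL2 \<longleftrightarrow> det x = 1"
  by (simp add: SL2_def)

text \<open>
  The adjugate serves as the inverse on \<open>SL(2)\<close>. It is an involution defined on all matrices and
  preserves the integrality of entries.
\<close>

definition adj2 :: "'a::field^2^2 \<Rightarrow> 'a^2^2" where
  "adj2 x = mat2 (x $ 2 $ 2) (- x $ 1 $ 2) (- x $ 2 $ 1) (x $ 1 $ 1)"

lemma adj2_mat2 [simp]: "adj2 (mat2 a b c d) = mat2 d (- b) (- c) a"
  by (simp add: adj2_def)

lemma adj2_adj2 [simp]: "adj2 (adj2 x) = x"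
  by (cases x) simp

lemma SL2_closed:
  "x \<in> carrier SL2 \<Longrightarrow> y \<in> carrier SL2 \<Longrightarrow> x ** y \<in> carrier SL2"
  by (simp add: SL2_iff det_mul)

lemma adj2_SL2 [simp]: "adj2 x \<in> carrier SL2 \<longleftrightarrow> x \<in> carrier SL2"
  by (cases x) (simp add: mult.commute)

lemma adj2_mult:
  assumes "x \<in> carrier SL2" shows "adj2 x ** x = mat 1" "x ** adj2 x = mat 1"
  using assms by (cases x; simp add: mat_one_eq_mat2 algebra_simps)+

lemma adj2_mult_assoc [simp]:
  assumes "x \<in> carrier SL2"
  shows "adj2 x ** (x ** y) = y" "x ** (adj2 x ** y) = y"
        "(y ** x) ** adj2 x = y" "(y ** adj2 x) ** x = y"
  using adj2_mult[OF assms] by (simp_all add: matrix_mul_assoc) (simp_all add: matrix_mul_assoc[symmetric])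

lemma SL2_mult_iff:
  assumes "y \<in> carrier SL2"
  shows "x ** y \<in> carrier SL2 \<longleftrightarrow> x \<in> carrier SL2" "y ** x \<in> carrier SL2 \<longleftrightarrow> x \<in> carrier SL2"
  using assms by (simp_all add: SL2_iff det_mul)

lemma group_SL2: "group SL2"
proof (rule groupI)
  fix x :: "'a^2^2" assume "x \<in> carrier SL2"
  then show "\<exists>y\<in>carrier SL2. y \<otimes>\<^bsub>SL2\<^esub> x = \<one>\<^bsub>SL2\<^esub>"
    by (intro bexI[of _ "adj2 x"]) (auto simp: adj2_mult SL2_one)
qed (simp_all add: SL2_iff det_mul matrix_mul_assoc SL2_one)

lemma inv_SL2: "x \<in> carrier SL2 \<Longrightarrow> inv\<^bsub>SL2\<^esub> x = adj2 x"
  by (rule group.inv_equality[OF group_SL2]) (auto simp: adj2_mult SL2_one)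

context nonarch_local_field begin

definition diag_coset :: "int \<Rightarrow> ('a^2^2) set" where
  "diag_coset m = {mat2 x 0 0 (inverse x) | x. x \<noteq> 0 \<and> val x = m}"
definition antidiag_coset :: "int \<Rightarrow> ('a^2^2) set" where
  "antidiag_coset m = {mat2 0 x (- inverse x) 0 | x. x \<noteq> 0 \<and> val x = m}"

lemma torus_int_eq: "torus_int val = diag_coset 0" by (simp add: torus_int_def diag_coset_def)

text \<open>
  That one diagonal element with distinct eigenvalues stays diagonal already forces a matrix to be monomial. The eigenvalues
  2 and 1/2 are distinct because \<open>3 \<noteq> 0\<close> in characteristic zero.
\<close>

lemma torus_conj:
  assumes "n ** mat2 2 0 0 (inverse 2) ** adj2 n \<in> torus" "n \<in> carrier SL2"
  shows "(\<exists>x. x \<noteq> 0 \<and> n = mat2 x 0 0 (inverse x)) \<or> (\<exists>x. x \<noteq> 0 \<and> n = mat2 0 x (- inverse x) (0::'a))"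
proof (cases n)
  case (mat2 a b c d)
  have det: "a * d - b * c = 1" using assms(2) mat2 by simp
  have e: "2 - inverse 2 \<noteq> (0::'a)"
  proof
    assume "2 - inverse 2 = (0::'a)"
    then have "(4::'a) = 1" by (simp add: field_simps)
    then show False by simp
  qed
  from assms(1) obtain s where
    "mat2 (a * 2) (b * inverse 2) (c * 2) (d * inverse 2) ** mat2 d (- b) (- c) a = mat2 s 0 0 (inverse s)"
    unfolding torus_def mat2 by auto
  then have "a * b * (2 - inverse 2) = 0" "c * d * (2 - inverse 2) = 0"
    by (auto simp: algebra_simps)
  then have ab: "a * b = 0" "c * d = 0" using e by auto
  show ?thesis
  proof (cases "a = 0")
    case True
    then have "b \<noteq> 0" "c \<noteq> 0" "d = 0" using det ab by auto
    moreover have "c = - inverse b" using det True \<open>b \<noteq> 0\<close>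
      by (simp add: field_simps eq_neg_iff_add_eq_0 neg_eq_iff_add_eq_0)
    ultimately show ?thesis using True mat2 by blast
  next
    case False
    then have "b = 0" "d \<noteq> 0" "c = 0" using det ab by auto
    moreover have "d = inverse a" using det \<open>b = 0\<close> False by (simp add: field_simps)
    ultimately show ?thesis using False mat2 by blast
  qed
qed

lemma torus_conj_eq:
  assumes "n \<in> carrier SL2"
    "(\<exists>x. x \<noteq> 0 \<and> n = mat2 x 0 0 (inverse x)) \<or> (\<exists>x. x \<noteq> 0 \<and> n = mat2 0 x (- inverse x) (0::'a))"
  shows "(n <#\<^bsub>SL2\<^esub> torus) #>\<^bsub>SL2\<^esub> inv\<^bsub>SL2\<^esub> n = torus"
proof -
  have "(n <#\<^bsub>SL2\<^esub> torus) #>\<^bsub>SL2\<^esub> inv\<^bsub>SL2\<^esub> n = (\<lambda>t. n ** t ** adj2 n) ` torus"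
    unfolding l_coset_def r_coset_def inv_SL2[OF assms(1)] by auto
  also have "\<dots> = torus"
  proof (cases "\<exists>x. x \<noteq> 0 \<and> n = mat2 x 0 0 (inverse x)")
    case True
    then have "n ** t ** adj2 n = t" if "t \<in> torus" for t
      using that by (auto simp: torus_def)
    then show ?thesis by simp
  next
    case False
    then obtain x where x: "x \<noteq> 0" "n = mat2 0 x (- inverse x) 0" using assms by blast
    have *: "n ** mat2 s 0 0 (inverse s) ** adj2 n = mat2 (inverse s) 0 0 s" for s
      using x by simp
    show ?thesis
    proof (intro equalityI subsetI)
      fix t assume "t \<in> (\<lambda>t. n ** t ** adj2 n) ` torus"
      then obtain s where s: "s \<noteq> 0" "t = mat2 (inverse s) 0 0 s" unfolding torus_def using * by auto
      then show "t \<in> torus" unfolding torus_def by (intro CollectI exI[of _ "inverse s"]) simp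
    next
      fix t :: "'a^2^2" assume "t \<in> torus"
      then obtain s where s: "s \<noteq> 0" "t = mat2 s 0 0 (inverse s)" by (auto simp: torus_def)
      then have "t = n ** mat2 (inverse s) 0 0 (inverse (inverse s)) ** adj2 n"
        using *[of "inverse s"] by simp
      moreover have "mat2 (inverse s) 0 0 (inverse (inverse s)) \<in> torus"
        unfolding torus_def using s by (intro CollectI exI[of _ "inverse s"]) simp
      ultimately show "t \<in> (\<lambda>t. n ** t ** adj2 n) ` torus" by blast
    qed
  qed
  finally show ?thesis .
qed

lemma normalizer_torus:
  "normalizer SL2 torus =
     {mat2 x 0 0 (inverse x) | x. x \<noteq> 0} \<union> {mat2 0 x (- inverse x) (0::'a) | x. x \<noteq> 0}"
  (is "?N = ?A \<union> ?B")
proof (intro equalityI subsetI)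
  fix n :: "'a^2^2" assume n: "n \<in> ?N"
  then have c: "n \<in> carrier SL2" by (simp add: normalizer_def)
  have t: "mat2 2 0 0 (inverse 2) \<in> (torus :: ('a^2^2) set)" by (auto simp: torus_def)
  have "n ** mat2 2 0 0 (inverse 2) ** adj2 n \<in> (n <#\<^bsub>SL2\<^esub> torus) #>\<^bsub>SL2\<^esub> inv\<^bsub>SL2\<^esub> n"
    unfolding l_coset_def r_coset_def inv_SL2[OF c] using t by auto
  then have "n ** mat2 2 0 0 (inverse 2) ** adj2 n \<in> torus" using n by (simp add: normalizer_def)
  from torus_conj[OF this c] show "n \<in> ?A \<union> ?B" by auto
next
  fix n :: "'a^2^2" assume n: "n \<in> ?A \<union> ?B"
  then have "n \<in> carrier SL2" by auto
  moreover have "(\<exists>x. x \<noteq> 0 \<and> n = mat2 x 0 0 (inverse x)) \<or> (\<exists>x. x \<noteq> 0 \<and> n = mat2 0 x (- inverse x) 0)"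
    using n by auto
  ultimately show "n \<in> ?N" unfolding normalizer_def using torus_conj_eq[of n] by simp
qed

lemma diag_coset_nonempty: "diag_coset m \<noteq> {}" and antidiag_coset_nonempty: "antidiag_coset m \<noteq> {}"
  unfolding diag_coset_def antidiag_coset_def using unif_pow_nz val_unif_pow by blast+

lemma set_mult_SL2: "X <#>\<^bsub>SL2\<lparr>carrier := C\<rparr>\<^esub> Y = {x ** y | x y. x \<in> X \<and> y \<in> Y}"
    "X <#>\<^bsub>SL2\<^esub> Y = {x ** y | x y. x \<in> X \<and> y \<in> Y}"
  unfolding set_mult_def by (auto simp: SL2_def)

lemma r_coset_SL2: "X #>\<^bsub>SL2\<lparr>carrier := C\<rparr>\<^esub> y = {x ** y | x. x \<in> X}" "X #>\<^bsub>SL2\<^esub> y = {x ** y | x. x \<in> X}"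
  unfolding r_coset_def by (auto simp: SL2_def)

lemma torus_coset_diag: assumes "x \<noteq> 0" shows "{t ** mat2 x 0 0 (inverse x) | t. t \<in> diag_coset 0} = diag_coset (val x)"
proof (intro equalityI subsetI)
  fix n assume "n \<in> diag_coset (val x)"
  then obtain y where y: "y \<noteq> 0" "val y = val x" "n = mat2 y 0 0 (inverse y)" by (auto simp: diag_coset_def)
  then have "n = mat2 (y / x) 0 0 (inverse (y / x)) ** mat2 x 0 0 (inverse x)"
    using assms by (simp add: field_simps)
  moreover have "mat2 (y / x) 0 0 (inverse (y / x)) \<in> diag_coset 0" unfolding diag_coset_def
    using y assms by (auto simp: val_divide intro!: exI[of _ "y / x"])
  ultimately show "n \<in> {t ** mat2 x 0 0 (inverse x) | t. t \<in> diag_coset 0}" by blast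
next
  fix n assume "n \<in> {t ** mat2 x 0 0 (inverse x) | t. t \<in> diag_coset 0}"
  then obtain y where "y \<noteq> 0" "val y = 0" "n = mat2 (y * x) 0 0 (inverse (y * x))" by (auto simp: diag_coset_def)
  then show "n \<in> diag_coset (val x)" unfolding diag_coset_def using assms by (auto simp: val_mult intro!: exI[of _ "y * x"])
qed

lemma torus_coset_antidiag: assumes "x \<noteq> 0" shows "{t ** mat2 0 x (- inverse x) 0 | t. t \<in> diag_coset 0} = antidiag_coset (val x)"
proof (intro equalityI subsetI)
  fix n assume "n \<in> antidiag_coset (val x)"
  then obtain y where y: "y \<noteq> 0" "val y = val x" "n = mat2 0 y (- inverse y) 0" by (auto simp: antidiag_coset_def)
  then have "n = mat2 (y / x) 0 0 (inverse (y / x)) ** mat2 0 x (- inverse x) 0"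
    using assms by (simp add: field_simps)
  moreover have "mat2 (y / x) 0 0 (inverse (y / x)) \<in> diag_coset 0" unfolding diag_coset_def
    using y assms by (auto simp: val_divide intro!: exI[of _ "y / x"])
  ultimately show "n \<in> {t ** mat2 0 x (- inverse x) 0 | t. t \<in> diag_coset 0}" by blast
next
  fix n assume "n \<in> {t ** mat2 0 x (- inverse x) 0 | t. t \<in> diag_coset 0}"
  then obtain y where "y \<noteq> 0" "val y = 0" "n = mat2 0 (y * x) (- inverse (y * x)) 0" by (auto simp: diag_coset_def)
  then show "n \<in> antidiag_coset (val x)" unfolding antidiag_coset_def using assms by (auto simp: val_mult intro!: exI[of _ "y * x"])
qed

text \<open>
  The affine Weyl group acts simply transitively on the alcoves of a line, and \<open>weyl_at p\<close> is the element taking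
  the standard alcove to the alcove in position \<open>p\<close>. The orientation is chosen such that the lattice of
  translations occupies the even positions.
\<close>

definition weyl_at :: "int \<Rightarrow> ('a^2^2) set" where
  "weyl_at p = (if even p then diag_coset (p div 2) else antidiag_coset (p div 2))"

lemma carrier_affine_weyl: "carrier (affine_weyl val) = range weyl_at"
proof -
  have 1: "diag_coset m \<in> range weyl_at" "antidiag_coset m \<in> range weyl_at" for m
    using rangeI[of weyl_at "2 * m"] rangeI[of weyl_at "2 * m + 1"] by (simp_all add: weyl_at_def)
  have 2: "\<exists>x. x \<noteq> 0 \<and> val x = m" for m using unif_pow_nz val_unif_pow by blast
  have "carrier (affine_weyl val) = (\<Union>n\<in>normalizer SL2 torus. {{t ** n | t. t \<in> diag_coset 0}})"
    unfolding affine_weyl_def FactGroup_def RCOSETS_def r_coset_SL2 torus_int_eq by simp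
  also have "\<dots> = range diag_coset \<union> range antidiag_coset" (is "?L = ?R")
  proof (intro equalityI subsetI)
    fix X assume "X \<in> ?L"
    then obtain n where n: "n \<in> normalizer SL2 torus" "X = {t ** n | t. t \<in> diag_coset 0}" by blast
    from n(1)[unfolded normalizer_torus] show "X \<in> ?R"
    proof
      assume "n \<in> {mat2 x 0 0 (inverse x) | x. x \<noteq> 0}"
      then obtain x where "x \<noteq> 0" "n = mat2 x 0 0 (inverse x)" by blast
      then have "X = diag_coset (val x)" using n(2) torus_coset_diag[of x] by simp
      then show ?thesis by simp
    next
      assume "n \<in> {mat2 0 x (- inverse x) 0 | x. x \<noteq> 0}"
      then obtain x where "x \<noteq> 0" "n = mat2 0 x (- inverse x) 0" by blast
      then have "X = antidiag_coset (val x)" using n(2) torus_coset_antidiag[of x] by simp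
      then show ?thesis by simp
    qed
  next
    fix X assume "X \<in> ?R"
    then show "X \<in> ?L"
    proof
      assume "X \<in> range diag_coset"
      then obtain m where m: "X = diag_coset m" by blast
      obtain x where "x \<noteq> 0" "val x = m" using 2[of m] by blast
      with m have x: "x \<noteq> 0" "X = diag_coset (val x)" by simp_all
      then have "X = {t ** mat2 x 0 0 (inverse x) | t. t \<in> diag_coset 0}" using torus_coset_diag[of x] by simp
      moreover have "mat2 x 0 0 (inverse x) \<in> normalizer SL2 torus" unfolding normalizer_torus using x(1) by blast
      ultimately show "X \<in> ?L" by blast
    next
      assume "X \<in> range antidiag_coset"
      then obtain m where m: "X = antidiag_coset m" by blast
      obtain x where "x \<noteq> 0" "val x = m" using 2[of m] by blast
      with m have x: "x \<noteq> 0" "X = antidiag_coset (val x)" by simp_all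
      then have "X = {t ** mat2 0 x (- inverse x) 0 | t. t \<in> diag_coset 0}" using torus_coset_antidiag[of x] by simp
      moreover have "mat2 0 x (- inverse x) 0 \<in> normalizer SL2 torus" unfolding normalizer_torus using x(1) by blast
      ultimately show "X \<in> ?L" by blast
    qed
  qed
  also have "\<dots> = range weyl_at"
  proof (intro equalityI subsetI)
    fix X assume "X \<in> range weyl_at"
    then obtain p where "X = weyl_at p" by blast
    then show "X \<in> ?R" by (cases "even p") (simp_all add: weyl_at_def)
  qed (use 1 in auto)
  finally show ?thesis .
qed

lemma inj_weyl_at: "inj weyl_at"
proof (rule injI)
  fix p p' :: int assume h: "weyl_at p = weyl_at p'"
  have "weyl_at p \<noteq> {}" by (simp add: weyl_at_def diag_coset_nonempty antidiag_coset_nonempty)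
  then obtain n where n: "n \<in> weyl_at p" by blast
  then have "n \<in> weyl_at p'" using h by simp
  then have "(even p \<longleftrightarrow> even p') \<and> p div 2 = p' div 2" using n
    by (auto simp: weyl_at_def diag_coset_def antidiag_coset_def split: if_splits)
  then show "p = p'" by presburger
qed

lemma antidiag_mult_diag: "{x ** y | x y. x \<in> antidiag_coset m \<and> y \<in> diag_coset n} = antidiag_coset (m - n)"
proof (intro equalityI subsetI)
  fix X assume "X \<in> {x ** y | x y. x \<in> antidiag_coset m \<and> y \<in> diag_coset n}"
  then obtain x y where "x \<noteq> 0" "y \<noteq> 0" "val x = m" "val y = n"
    "X = mat2 0 (x / y) (- inverse (x / y)) 0"
    by (auto simp: antidiag_coset_def diag_coset_def field_simps)
  then show "X \<in> antidiag_coset (m - n)" unfolding antidiag_coset_def by (auto simp: val_divide intro!: exI[of _ "x / y"])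
next
  fix X assume "X \<in> antidiag_coset (m - n)"
  then obtain z where z: "z \<noteq> 0" "val z = m - n" "X = mat2 0 z (- inverse z) 0" by (auto simp: antidiag_coset_def)
  let ?y = "unif_pow n"
  have "X = mat2 0 (z * ?y) (- inverse (z * ?y)) 0 ** mat2 ?y 0 0 (inverse ?y)" using z by simp
  moreover have "mat2 0 (z * ?y) (- inverse (z * ?y)) 0 \<in> antidiag_coset m" unfolding antidiag_coset_def
    using z by (intro CollectI exI[of _ "z * ?y"]) (simp add: val_mult)
  moreover have "mat2 ?y 0 0 (inverse ?y) \<in> diag_coset n" unfolding diag_coset_def
    by (intro CollectI exI[of _ "?y"]) simp
  ultimately show "X \<in> {x ** y | x y. x \<in> antidiag_coset m \<and> y \<in> diag_coset n}" by blast
qed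

lemma antidiag_mult_antidiag: "{x ** y | x y. x \<in> antidiag_coset m \<and> y \<in> antidiag_coset n} = diag_coset (m - n)"
proof (intro equalityI subsetI)
  fix X assume "X \<in> {x ** y | x y. x \<in> antidiag_coset m \<and> y \<in> antidiag_coset n}"
  then obtain x y where "x \<noteq> 0" "y \<noteq> 0" "val x = m" "val y = n"
    "X = mat2 (- x / y) 0 0 (inverse (- x / y))"
    by (auto simp: antidiag_coset_def field_simps)
  then show "X \<in> diag_coset (m - n)" unfolding diag_coset_def
    by (auto simp: val_divide simp del: minus_divide_left intro!: exI[of _ "- x / y"])
next
  fix X assume "X \<in> diag_coset (m - n)"
  then obtain z where z: "z \<noteq> 0" "val z = m - n" "X = mat2 z 0 0 (inverse z)" by (auto simp: diag_coset_def)
  let ?y = "unif_pow n"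
  have "X = mat2 0 (- z * ?y) (- inverse (- z * ?y)) 0 ** mat2 0 ?y (- inverse ?y) 0" using z by simp
  moreover have "mat2 0 (- z * ?y) (- inverse (- z * ?y)) 0 \<in> antidiag_coset m" unfolding antidiag_coset_def
    using z by (intro CollectI exI[of _ "- z * ?y"]) (simp add: val_mult)
  moreover have "mat2 0 ?y (- inverse ?y) 0 \<in> antidiag_coset n" unfolding antidiag_coset_def
    by (intro CollectI exI[of _ "?y"]) simp
  ultimately show "X \<in> {x ** y | x y. x \<in> antidiag_coset m \<and> y \<in> antidiag_coset n}" by blast
qed

lemma simple_reflections_eq: "simple_reflections val unif = {antidiag_coset 0, antidiag_coset (- 1)}"
proof -
  have "{t ** mat2 0 1 (- 1) 0 | t. t \<in> diag_coset 0} = antidiag_coset 0" using torus_coset_antidiag[of 1] by simp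
  moreover have "{t ** mat2 0 (inverse unif) (- unif) 0 | t. t \<in> diag_coset 0} = antidiag_coset (- 1)"
    using torus_coset_antidiag[of "inverse unif"] unif by (simp add: val_inverse)
  ultimately show ?thesis by (simp add: simple_reflections_def r_coset_SL2 torus_int_eq)
qed

text \<open>
  Left multiplication by the simple reflections becomes reflection of the line in the points \<open>1/2\<close> and \<open>-1/2\<close>,
  the walls of the alcove in position 0.
\<close>

lemma reflection_mult:
  "antidiag_coset 0 \<otimes>\<^bsub>affine_weyl val\<^esub> weyl_at p = weyl_at (1 - p)"
  "antidiag_coset (- 1) \<otimes>\<^bsub>affine_weyl val\<^esub> weyl_at p = weyl_at (- 1 - p)"
proof -
  have m: "X \<otimes>\<^bsub>affine_weyl val\<^esub> Y = {x ** y | x y. x \<in> X \<and> y \<in> Y}" for X Y :: "('a^2^2) set"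
    unfolding affine_weyl_def FactGroup_def by (simp add: set_mult_SL2)
  show "antidiag_coset 0 \<otimes>\<^bsub>affine_weyl val\<^esub> weyl_at p = weyl_at (1 - p)"
  proof (cases "even p")
    case True
    then have "(1 - p) div 2 = 0 - p div 2" by presburger
    then show ?thesis using True by (simp add: m weyl_at_def antidiag_mult_diag)
  next
    case False
    then have "(1 - p) div 2 = 0 - p div 2" by presburger
    then show ?thesis using False by (simp add: m weyl_at_def antidiag_mult_antidiag)
  qed
  show "antidiag_coset (- 1) \<otimes>\<^bsub>affine_weyl val\<^esub> weyl_at p = weyl_at (- 1 - p)"
  proof (cases "even p")
    case True
    then have "(- 1 - p) div 2 = - 1 - p div 2" by presburger
    then show ?thesis using True by (simp add: m weyl_at_def antidiag_mult_diag)
  next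
    case False
    then have "(- 1 - p) div 2 = - 1 - p div 2" by presburger
    then show ?thesis using False by (simp add: m weyl_at_def antidiag_mult_antidiag)
  qed
qed

lemma weyl_one: "\<one>\<^bsub>affine_weyl val\<^esub> = weyl_at 0"
  by (simp add: affine_weyl_def FactGroup_def weyl_at_def torus_int_eq)

text \<open>
  Each simple reflection changes \<open>\<bar>p\<bar>\<close> by exactly one, because the fixed points \<open>\<plusminus>1/2\<close> are adjacent to 0;
  this bounds the length from below. For the converse, the reflection in the wall on the same side as \<open>p\<close>
  brings \<open>p\<close> one step closer to 0.
\<close>

lemma weyl_length_at: "weyl_length val unif (weyl_at p) = nat \<bar>p\<bar>"
proof -
  let ?W = "affine_weyl val"
  have lower: "\<exists>p'. foldr (mult ?W) ws \<one>\<^bsub>?W\<^esub> = weyl_at p' \<and> \<bar>p'\<bar> \<le> int (length ws)"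
    if "set ws \<subseteq> {antidiag_coset 0, antidiag_coset (- 1)}" for ws
    using that
  proof (induction ws)
    case Nil
    then show ?case by (auto simp: weyl_one)
  next
    case (Cons w ws)
    then obtain p' where p': "foldr (mult ?W) ws \<one>\<^bsub>?W\<^esub> = weyl_at p'" "\<bar>p'\<bar> \<le> int (length ws)" by auto
    from Cons have "w = antidiag_coset 0 \<or> w = antidiag_coset (- 1)" by auto
    then show ?case
    proof
      assume "w = antidiag_coset 0"
      then show ?thesis using p' by (intro exI[of _ "1 - p'"]) (simp add: reflection_mult)
    next
      assume "w = antidiag_coset (- 1)"
      then show ?thesis using p' by (intro exI[of _ "- 1 - p'"]) (simp add: reflection_mult)
    qed
  qed
  have upper: "\<exists>ws. length ws = k \<and> set ws \<subseteq> {antidiag_coset 0, antidiag_coset (- 1)} \<and> foldr (mult ?W) ws \<one>\<^bsub>?W\<^esub> = weyl_at p"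
    if "\<bar>p\<bar> = int k" for k p
    using that
  proof (induction k arbitrary: p)
    case 0
    then show ?case by (intro exI[of _ "[]"]) (simp add: weyl_one)
  next
    case (Suc k)
    define s p' where "s = (if p > 0 then antidiag_coset 0 else antidiag_coset (- 1))" and "p' = (if p > 0 then 1 - p else - 1 - p)"
    have "\<bar>p'\<bar> = int k" using Suc.prems by (auto simp: p'_def)
    then obtain ws where ws: "length ws = k" "set ws \<subseteq> {antidiag_coset 0, antidiag_coset (- 1)}" "foldr (mult ?W) ws \<one>\<^bsub>?W\<^esub> = weyl_at p'"
      using Suc.IH by blast
    have "s \<otimes>\<^bsub>?W\<^esub> weyl_at p' = weyl_at p" by (simp add: s_def p'_def reflection_mult)
    then show ?case using ws by (intro exI[of _ "s # ws"]) (auto simp: s_def)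
  qed
  show ?thesis
    unfolding weyl_length_def word_length_def simple_reflections_eq
  proof (rule Least_equality)
    show "\<exists>ws. length ws = nat \<bar>p\<bar> \<and> set ws \<subseteq> {antidiag_coset 0, antidiag_coset (- 1)} \<and> foldr (mult ?W) ws \<one>\<^bsub>?W\<^esub> = weyl_at p"
      by (rule upper) simp
    fix k assume "\<exists>ws. length ws = k \<and> set ws \<subseteq> {antidiag_coset 0, antidiag_coset (- 1)} \<and> foldr (mult ?W) ws \<one>\<^bsub>?W\<^esub> = weyl_at p"
    then obtain ws where ws: "length ws = k" "set ws \<subseteq> {antidiag_coset 0, antidiag_coset (- 1)}" "foldr (mult ?W) ws \<one>\<^bsub>?W\<^esub> = weyl_at p" by auto
    from lower[OF ws(2)] obtain p' where p': "weyl_at p = weyl_at p'" "\<bar>p'\<bar> \<le> int k" using ws by auto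
    from p'(1) have "p = p'" by (rule injD[OF inj_weyl_at])
    with p'(2) show "nat \<bar>p\<bar> \<le> k" by simp
  qed
qed

text \<open>
  The right-hand side of the character formula as a sum over positions.
\<close>

lemma sum_weyl_length:
  "(\<Sum>w\<in>{w \<in> carrier (affine_weyl val). int (weyl_length val unif w) < r}.
      real (residue_order val) ^ weyl_length val unif w) = (\<Sum>p\<in>{- r<..<r}. real q ^ nat \<bar>p\<bar>)"
proof -
  have "{w \<in> carrier (affine_weyl val). int (weyl_length val unif w) < r} = weyl_at ` {- r<..<r}"
    by (auto simp: carrier_affine_weyl weyl_length_at intro!: imageI)
  then show ?thesis
    using inj_weyl_at by (simp add: sum.reindex inj_on_subset weyl_length_at q_def)
qed

end

section \<open>Topology and Haar measure\<close>

context nonarch_local_field begin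

definition near :: "int \<Rightarrow> 'a^2^2 \<Rightarrow> 'a^2^2 \<Rightarrow> bool" where
  "near n x y \<longleftrightarrow> (\<forall>i j. y $ i $ j - x $ i $ j \<in> P n)"

definition box :: "int \<Rightarrow> ('a^2^2) set" where
  "box n = {x. \<forall>i j. x $ i $ j \<in> P n}"

lemma near_mat2 [simp]:
  "near n (mat2 a b c d) (mat2 a' b' c' d') \<longleftrightarrow> a' - a \<in> P n \<and> b' - b \<in> P n \<and> c' - c \<in> P n \<and> d' - d \<in> P n"
  by (auto simp: near_def forall_2)

lemma box_mat2 [simp]:
  "mat2 a b c d \<in> box n \<longleftrightarrow> a \<in> P n \<and> b \<in> P n \<and> c \<in> P n \<and> d \<in> P n"
  by (auto simp: box_def forall_2)

lemma near_iff_box: "near n x y \<longleftrightarrow> y - x \<in> box n"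
  by (simp add: near_def box_def)

lemma near_refl [simp]: "near n x x" by (simp add: near_def)

lemma near_sym: "near n x y \<longleftrightarrow> near n y x"
  unfolding near_def using P_diff_commute by blast

lemma near_trans: "near n x y \<Longrightarrow> near n y z \<Longrightarrow> near n x z"
  unfolding near_def using P_diff_trans by blast

lemma near_mono: "near n x y \<Longrightarrow> m \<le> n \<Longrightarrow> near m x y"
  unfolding near_def using P_mono by blast

lemma box_mult:
  assumes "x \<in> box m" "y \<in> box n" "k \<le> m + n"
  shows "x ** y \<in> box k"
  using assms by (cases x; cases y) (auto intro!: P_add intro: P_mult)

lemma minus_mat2 [simp]: "mat2 a b c d - mat2 a' b' c' d' = (mat2 (a - a') (b - b') (c - c') (d - d') :: 'a^2^2)"
  by (simp add: vec_eq_iff forall_2)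

lemma mat_diff_distrib:
  fixes x y z :: "'a^2^2"
  shows "x ** (z - y) = x ** z - x ** y" "(z - y) ** x = z ** x - y ** x"
  by (cases x; cases y; cases z; simp add: algebra_simps)+

lemma near_mult_left: "x \<in> box m \<Longrightarrow> near n y z \<Longrightarrow> k \<le> m + n \<Longrightarrow> near k (x ** y) (x ** z)"
  using box_mult[of x m "z - y" n k] by (simp add: near_iff_box mat_diff_distrib)

lemma near_mult_right: "x \<in> box m \<Longrightarrow> near n y z \<Longrightarrow> k \<le> m + n \<Longrightarrow> near k (y ** x) (z ** x)"
  using box_mult[of "z - y" n x m k] by (simp add: near_iff_box mat_diff_distrib add.commute)

lemma P_exhaust: "\<exists>n\<le>0. x \<in> P n"
  by (rule exI[of _ "min 0 (val x)"]) (simp add: prime_pow_def)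

lemma box_exhaust: "\<exists>n\<le>0. x \<in> box n"
proof (cases x)
  case (mat2 a b c d)
  obtain k1 k2 k3 k4 where k: "k1 \<le> 0" "a \<in> P k1" "k2 \<le> 0" "b \<in> P k2" "k3 \<le> 0" "c \<in> P k3" "k4 \<le> 0" "d \<in> P k4"
    using P_exhaust by metis
  let ?n = "min (min k1 k2) (min k3 k4)"
  have "x \<in> box ?n" using k P_mono[of _ _ ?n] mat2 by auto
  then show ?thesis using k(1) by (intro exI[of _ ?n]) auto
qed

lemma box_mono: "x \<in> box n \<Longrightarrow> m \<le> n \<Longrightarrow> x \<in> box m"
  unfolding box_def using P_mono by blast

lemma adj2_box [simp]: "adj2 x \<in> box n \<longleftrightarrow> x \<in> box n"
  by (cases x) auto

lemma mat1_box: "mat 1 \<in> box 0"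
  by (simp add: mat_one_eq_mat2)

lemma near_box: "near n x y \<Longrightarrow> x \<in> box n \<Longrightarrow> y \<in> box n"
  unfolding near_def box_def mem_Collect_eq
proof (intro allI)
  fix i j assume "\<forall>i j. y $ i $ j - x $ i $ j \<in> P n" "\<forall>i j. x $ i $ j \<in> P n"
  then show "y $ i $ j \<in> P n" using P_add[of "y $ i $ j - x $ i $ j" n "x $ i $ j"] by simp
qed

lemma open_near_aux: "open (U :: 'a set) \<Longrightarrow> x \<in> U \<Longrightarrow> \<exists>n. \<forall>y. y - x \<in> P n \<longrightarrow> y \<in> U"
  using open_iff by blast

lemma open_coset: "open {y. y - x \<in> P n}"
  unfolding open_iff
proof (intro ballI exI allI impI)
  fix z y assume "z \<in> {y. y - x \<in> P n}" "y - z \<in> P n"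
  then show "y \<in> {y. y - x \<in> P n}" using P_diff_trans by blast
qed

text \<open>
  The product topology on matrices is the one defined by \<open>near\<close>. Through this characterization continuity and
  closedness become congruences between matrix entries.
\<close>

lemma open_mat_iff: "open (U :: ('a^2^2) set) \<longleftrightarrow> (\<forall>x\<in>U. \<exists>n. \<forall>y. near n x y \<longrightarrow> y \<in> U)"
proof (intro iffI ballI)
  fix x assume U: "open U" "x \<in> U"
  then obtain A where A: "\<And>i. open (A i)" "\<And>i. x $ i \<in> A i" "\<And>y. (\<forall>i. y $ i \<in> A i) \<longrightarrow> y \<in> U"
    unfolding open_vec_def[of U] by metis
  have "\<exists>n. \<forall>v. (\<forall>j. v $ j - x $ i $ j \<in> P n) \<longrightarrow> v \<in> A i" for i
  proof -
    obtain B where B: "\<And>j. open (B j)" "\<And>j. x $ i $ j \<in> B j" "\<And>v. (\<forall>j. v $ j \<in> B j) \<longrightarrow> v \<in> A i"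
      using A(1,2)[of i] unfolding open_vec_def[of "A i"] by metis
    obtain m where m: "\<And>j y. y - x $ i $ j \<in> P (m j) \<Longrightarrow> y \<in> B j"
      using open_near_aux[OF B(1,2)] by metis
    have "v \<in> A i" if "\<forall>j. v $ j - x $ i $ j \<in> P (max (m 1) (m 2))" for v
    proof (rule B(3)[rule_format])
      fix j :: 2
      have "m j \<le> max (m 1) (m 2)" using exhaust_2[of j] by auto
      then show "v $ j \<in> B j" using that m P_mono by blast
    qed
    then show ?thesis by blast
  qed
  then obtain m where m: "\<And>i v. (\<forall>j. v $ j - x $ i $ j \<in> P (m i)) \<Longrightarrow> v \<in> A i" by metis
  have "y \<in> U" if "near (max (m 1) (m 2)) x y" for y
  proof (rule A(3)[rule_format])
    fix i :: 2
    have "m i \<le> max (m 1) (m 2)" using exhaust_2[of i] by auto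
    then show "y $ i \<in> A i" using that m P_mono unfolding near_def by blast
  qed
  then show "\<exists>n. \<forall>y. near n x y \<longrightarrow> y \<in> U" by blast
next
  assume U: "\<forall>x\<in>U. \<exists>n. \<forall>y. near n x y \<longrightarrow> y \<in> U"
  show "open U" unfolding open_vec_def[of U]
  proof
    fix x assume "x \<in> U"
    then obtain n where n: "\<And>y. near n x y \<Longrightarrow> y \<in> U" using U by blast
    let ?A = "\<lambda>i. {v. \<forall>j. v $ j - x $ i $ j \<in> P n}"
    have "open (?A i)" for i
      unfolding open_vec_def
    proof
      fix v assume v: "v \<in> ?A i"
      have "w \<in> ?A i" if "\<forall>j. w $ j \<in> {y. y - x $ i $ j \<in> P n}" for w using that by blast
      then show "\<exists>B. (\<forall>j. open (B j) \<and> v $ j \<in> B j) \<and> (\<forall>w. (\<forall>j. w $ j \<in> B j) \<longrightarrow> w \<in> ?A i)"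
        using v open_coset by (intro exI[of _ "\<lambda>j. {y. y - x $ i $ j \<in> P n}"]) auto
    qed
    then show "\<exists>A. (\<forall>i. open (A i) \<and> x $ i \<in> A i) \<and> (\<forall>y. (\<forall>i. y $ i \<in> A i) \<longrightarrow> y \<in> U)"
    proof (intro exI[of _ ?A] conjI allI impI)
      fix y assume "\<forall>i. y $ i \<in> ?A i"
      then show "y \<in> U" by (intro n) (simp add: near_def)
    qed simp_all
  qed
qed

lemma open_near: "open {y. near n x y}"
  unfolding open_mat_iff using near_trans by blast

text \<open>
  Koenig's argument: a fractional ideal without finite subcover has such a coset of the next smaller ideal,
  since there are only finitely many cosets; iterating gives a Cauchy sequence, and an open set that contains its
  limit covers one of the cosets.
\<close>

lemma compact_P: "compact (P N)"
proof (rule compactI, rule ccontr)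
  fix C assume C: "\<forall>c\<in>C. open c" "P N \<subseteq> \<Union>C" and "\<nexists>C'. C' \<subseteq> C \<and> finite C' \<and> P N \<subseteq> \<Union>C'"
  define bad where "bad x n \<longleftrightarrow> \<not> (\<exists>D\<subseteq>C. finite D \<and> {y. y - x \<in> P n} \<subseteq> \<Union>D)" for x n
  have bad0: "bad 0 N" unfolding bad_def using \<open>\<nexists>C'. C' \<subseteq> C \<and> finite C' \<and> P N \<subseteq> \<Union>C'\<close> by auto
  have step: "\<exists>x'. bad x' (n + 1) \<and> x' - x \<in> P n" if "bad x n" for x n

  proof (rule ccontr)
    assume no: "\<nexists>x'. bad x' (n + 1) \<and> x' - x \<in> P n"
    obtain S where S: "transversal n (n + 1) S" using transversal_exists[of n "n + 1"] by auto
    have "\<exists>D\<subseteq>C. finite D \<and> {y. y - (x + s) \<in> P (n + 1)} \<subseteq> \<Union>D" if "s \<in> S" for s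
    proof -
      have "s \<in> P n" using S that by (auto simp: transversal_def)
      then have "\<not> bad (x + s) (n + 1)" using no by auto
      then show ?thesis unfolding bad_def by blast
    qed
    then obtain D where D: "\<And>s. s \<in> S \<Longrightarrow> D s \<subseteq> C \<and> finite (D s) \<and> {y. y - (x + s) \<in> P (n + 1)} \<subseteq> \<Union>(D s)"
      by metis
    have "{y. y - x \<in> P n} \<subseteq> \<Union>(\<Union>s\<in>S. D s)"
    proof
      fix y assume "y \<in> {y. y - x \<in> P n}"
      then obtain s where s: "s \<in> S" "y - x - s \<in> P (n + 1)"
        using transversal_ex1[OF S, of "y - x"] by blast
      then have "y \<in> {y. y - (x + s) \<in> P (n + 1)}" by (simp add: algebra_simps)
      then show "y \<in> \<Union>(\<Union>s\<in>S. D s)" using D[OF s(1)] s(1) by blast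
    qed
    moreover have "finite (\<Union>s\<in>S. D s)" using S D by (auto simp: transversal_def)
    moreover have "(\<Union>s\<in>S. D s) \<subseteq> C" using D by blast
    ultimately show False using that unfolding bad_def by blast
  qed
  have "\<exists>X. \<forall>k. (bad (X k) (N + int k) \<and> X k \<in> P N) \<and> X (Suc k) - X k \<in> P (N + int k)"
  proof (rule dependent_nat_choice)
    show "\<exists>x. bad x (N + int 0) \<and> x \<in> P N" using bad0 by (intro exI[of _ 0]) simp
    fix x k assume x: "bad x (N + int k) \<and> x \<in> P N"
    then obtain y where y: "bad y (N + int k + 1)" "y - x \<in> P (N + int k)" using step by blast
    have "y - x \<in> P N" by (rule P_mono[OF y(2)]) simp
    then have "y \<in> P N" using P_add[of "y - x" N x] x by simp
    moreover have "bad y (N + int (Suc k))" using y(1) by (simp add: ac_simps)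
    ultimately show "\<exists>y. (bad y (N + int (Suc k)) \<and> y \<in> P N) \<and> y - x \<in> P (N + int k)" using y(2) by blast
  qed
  then obtain X where X: "\<And>k. bad (X k) (N + int k)" "\<And>k. X (Suc k) - X k \<in> P (N + int k)" "\<And>k. X k \<in> P N" by blast
  have X': "X (k + j) - X k \<in> P (N + int k)" for k j
  proof (induction j)
    case (Suc j)
    have "X (Suc (k + j)) - X (k + j) \<in> P (N + int k)" by (rule P_mono[OF X(2)]) simp
    from P_diff_trans[OF this Suc] show ?case by simp
  qed simp
  have tail: "X i - X k \<in> P (N + int k)" if "k \<le> i" for i k
    using X'[of k "i - k"] that by simp
  have "\<exists>l. \<forall>n. \<exists>k. \<forall>i\<ge>k. X i - l \<in> P n"
  proof (rule complete, intro allI)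
    fix n
    have "X i - X j \<in> P n" if "nat (n - N) \<le> i" "nat (n - N) \<le> j" for i j
    proof -
      have "X i - X j \<in> P (N + int (nat (n - N)))"
        using P_diff[OF tail[OF that(1)] tail[OF that(2)]] by simp
      then show ?thesis by (rule P_mono) simp
    qed
    then show "\<exists>k. \<forall>i\<ge>k. \<forall>j\<ge>k. X i - X j \<in> P n" by blast
  qed
  then obtain l where l: "\<And>n. \<exists>k. \<forall>i\<ge>k. X i - l \<in> P n" by blast
  have lX: "l - X k \<in> P (N + int k)" for k
  proof -
    obtain k' where "\<forall>i\<ge>k'. X i - l \<in> P (N + int k)" using l by blast
    then have "X (max k k') - l \<in> P (N + int k)" by simp
    moreover have "X (max k k') - X k \<in> P (N + int k)" by (rule tail) simp
    ultimately show ?thesis using P_diff[of "X (max k k') - X k" _ "X (max k k') - l"] by simp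
  qed
  have "l - X 0 \<in> P N" using lX[of 0] by simp
  then have "l \<in> P N" using P_add[OF _ X(3)[of 0], of "l - X 0"] by simp
  then obtain c where c: "c \<in> C" "l \<in> c" using C(2) by blast
  then obtain n where n: "\<And>y. y - l \<in> P n \<Longrightarrow> y \<in> c" using C(1) open_near_aux by blast
  let ?k = "nat (n - N)"
  have "{y. y - X ?k \<in> P (N + int ?k)} \<subseteq> c"
  proof
    fix y assume "y \<in> {y. y - X ?k \<in> P (N + int ?k)}"
    then have "(y - X ?k) - (l - X ?k) \<in> P (N + int ?k)" by (intro P_diff[OF _ lX]) blast
    moreover have "(y - X ?k) - (l - X ?k) = y - l" by simp
    ultimately have "y - l \<in> P (N + int ?k)" by (simp only:)
    then have "y - l \<in> P n" by (rule P_mono) simp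
    then show "y \<in> c" by (rule n)
  qed
  then have "{y. y - X ?k \<in> P (N + int ?k)} \<subseteq> \<Union>{c}" "{c} \<subseteq> C" "finite {c}" using c by auto
  then show False using X(1)[of ?k] unfolding bad_def by blast
qed

lemma compact_box: "compact (box n)"
proof -
  let ?f = "\<lambda>p :: 'a \<times> 'a \<times> 'a \<times> 'a. mat2 (fst p) (fst (snd p)) (fst (snd (snd p))) (snd (snd (snd p)))"
  let ?g = "\<lambda>i j (p :: 'a \<times> 'a \<times> 'a \<times> 'a). if i = (1::2) then (if j = (1::2) then fst p else fst (snd p))
     else (if j = 1 then fst (snd (snd p)) else snd (snd (snd p)))"
  have f: "?f = (\<lambda>p. \<chi> i j. ?g i j p)"
    by (rule ext) (simp add: vec_eq_iff forall_2)
  have "continuous_on (P n \<times> P n \<times> P n \<times> P n) (?g i j)" for i j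
    by (cases "i = 1"; cases "j = 1") (auto intro!: continuous_intros)
  then have "continuous_on (P n \<times> P n \<times> P n \<times> P n) ?f"
    unfolding f by (intro continuous_on_vec_lambda)
  then have "compact (?f ` (P n \<times> P n \<times> P n \<times> P n))"
    by (rule compact_continuous_image) (intro compact_Times compact_P)
  also have "?f ` (P n \<times> P n \<times> P n \<times> P n) = box n"
  proof (intro equalityI subsetI)
    fix x assume "x \<in> box n"
    then show "x \<in> ?f ` (P n \<times> P n \<times> P n \<times> P n)"
      by (intro image_eqI[of _ _ "(x $ 1 $ 1, x $ 1 $ 2, x $ 2 $ 1, x $ 2 $ 2)"]) (auto simp: mat2_collapse box_def)
  qed auto
  finally show ?thesis .
qed

lemma closed_SL2: "closed (carrier SL2 :: ('a^2^2) set)"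
  unfolding closed_def open_mat_iff
proof
  fix x :: "'a^2^2" assume x: "x \<in> - carrier SL2"
  obtain N where N: "N \<le> 0" "x \<in> box N" using box_exhaust by blast
  let ?e = "1 - det x"
  have e: "?e \<noteq> 0" using x by (simp add: SL2_iff)
  let ?n = "max N (val ?e + 1 - N)"
  have "y \<notin> carrier SL2" if n: "near ?n x y" for y
  proof
    assume "y \<in> carrier SL2"
    obtain a b c d a' b' c' d' where xy: "x = mat2 a b c d" "y = mat2 a' b' c' d'"
      using mat2_cases by metis
    have yN: "y \<in> box N" using near_box[OF near_mono[OF n]] N by simp
    have *: "u' * v' - u * v \<in> P (val ?e + 1)" if "u' - u \<in> P ?n" "v' - v \<in> P ?n" "u' \<in> P N" "v \<in> P N" for u u' v v'
    proof -
      have "u' * (v' - v) \<in> P (val ?e + 1)" "(u' - u) * v \<in> P (val ?e + 1)"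
        using that by (auto intro: P_mult)
      from P_add[OF this] show ?thesis by (simp add: algebra_simps)
    qed
    have "a' * d' - a * d \<in> P (val ?e + 1)" "b' * c' - b * c \<in> P (val ?e + 1)"
      using * n yN N unfolding xy by auto
    from P_diff[OF this] have "det y - det x \<in> P (val ?e + 1)"
      by (simp add: xy det_mat2 algebra_simps)
    then have "?e \<in> P (val ?e + 1)" using \<open>y \<in> carrier SL2\<close> by (simp add: SL2_iff)
    then show False using e by (simp add: P_iff)
  qed
  then show "\<exists>n. \<forall>y. near n x y \<longrightarrow> y \<in> - carrier SL2" by blast
qed

lemma closed_near: "closed {y. near n x y}"
proof -
  have "open (- {y. near n x y})"
    unfolding open_mat_iff
  proof (intro ballI exI allI impI)
    fix z y assume "z \<in> - {y. near n x y}" "near n z y"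
    then show "y \<in> - {y. near n x y}" using near_trans near_sym by blast
  qed
  then show ?thesis by (simp add: closed_def)
qed

definition nbhd :: "int \<Rightarrow> 'a^2^2 \<Rightarrow> ('a^2^2) set" where
  "nbhd n x = {y \<in> carrier SL2. near n x y}"

lemma compact_SL2_box: "compact (carrier SL2 \<inter> box n)"
  using compact_Int_closed[OF compact_box closed_SL2] by (simp add: Int_commute)

lemma compact_nbhd: "compact (nbhd n x)"
proof -
  obtain N where N: "N \<le> 0" "x \<in> box N" using box_exhaust by blast
  have "nbhd n x = carrier SL2 \<inter> box (min n N) \<inter> {y. near n x y}"
    unfolding nbhd_def using near_box[OF near_mono] box_mono N by auto
  then show ?thesis using compact_Int_closed[OF compact_SL2_box closed_near] by simp
qed

lemma openin_nbhd: "openin (top_of_set (carrier SL2)) (nbhd n x)"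
proof -
  have "nbhd n x = carrier SL2 \<inter> {y. near n x y}" by (auto simp: nbhd_def)
  then show ?thesis using open_near openin_open_Int by metis
qed

lemma openin_SL2_iff:
  "openin (top_of_set (carrier SL2)) U \<longleftrightarrow> U \<subseteq> carrier SL2 \<and> (\<forall>x\<in>U. \<exists>n. nbhd n x \<subseteq> U)"
proof (intro iffI conjI ballI)
  assume U: "openin (top_of_set (carrier SL2)) U"
  then obtain T where T: "open T" "U = carrier SL2 \<inter> T" by (auto simp: openin_open)
  then show "U \<subseteq> carrier SL2" by blast
  fix x assume "x \<in> U"
  then obtain n where "\<forall>y. near n x y \<longrightarrow> y \<in> T" using T open_mat_iff by blast
  then show "\<exists>n. nbhd n x \<subseteq> U" using T by (auto simp: nbhd_def)
next
  assume h: "U \<subseteq> carrier SL2 \<and> (\<forall>x\<in>U. \<exists>n. nbhd n x \<subseteq> U)"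
  then obtain m where m: "\<And>x. x \<in> U \<Longrightarrow> nbhd (m x) x \<subseteq> U" by metis
  have "U = (\<Union>x\<in>U. nbhd (m x) x)" using m h by (auto simp: nbhd_def)
  moreover have "openin (top_of_set (carrier SL2)) (\<Union>x\<in>U. nbhd (m x) x)"
    using openin_nbhd by blast
  ultimately show "openin (top_of_set (carrier SL2)) U" by simp
qed

lemma openin_sets:
  assumes "haar_SL2 \<mu>" "openin (top_of_set (carrier SL2)) U"
  shows "U \<in> sets \<mu>"
proof -
  obtain T where T: "open T" "U = carrier SL2 \<inter> T" using assms(2) by (auto simp: openin_open)
  then show ?thesis using assms(1) by (auto simp: haar_SL2_def sets_restrict_space)
qed

lemma space_haar: "haar_SL2 \<mu> \<Longrightarrow> space \<mu> = carrier SL2"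
  unfolding haar_SL2_def by (metis sets_eq_imp_space_eq space_restrict_space space_borel Int_UNIV_right)

lemma left_mult_measurable:
  fixes k :: "'a^2^2"
  assumes \<mu>: "haar_SL2 \<mu>" and k: "k \<in> carrier SL2"
  shows "(\<lambda>x. k ** x) \<in> measurable \<mu> \<mu>"
proof -
  obtain N where N: "k \<in> box N" using box_exhaust by blast
  have "(\<lambda>x :: 'a^2^2. k ** x) \<in> borel_measurable borel"
  proof (rule borel_measurableI)
    fix S :: "('a^2^2) set" assume S: "open S"
    have "open ((\<lambda>x :: 'a^2^2. k ** x) -` S)"
      unfolding open_mat_iff
    proof
      fix x :: "'a^2^2" assume "x \<in> (\<lambda>x :: 'a^2^2. k ** x) -` S"
      then obtain n where n: "\<And>y. near n (k ** x) y \<Longrightarrow> y \<in> S" using S open_mat_iff by blast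
      have "k ** y \<in> S" if "near (n - N) x y" for y
        by (rule n[OF near_mult_left[OF N that]]) simp
      then show "\<exists>n. \<forall>y. near n x y \<longrightarrow> y \<in> (\<lambda>x :: 'a^2^2. k ** x) -` S" by blast
    qed
    then show "(\<lambda>x :: 'a^2^2. k ** x) -` S \<inter> space borel \<in> sets borel" by simp
  qed
  then have "(\<lambda>x :: 'a^2^2. k ** x) \<in> measurable (restrict_space borel (carrier SL2)) (restrict_space borel (carrier SL2))"
    using SL2_closed[OF k]
    by (intro measurable_restrict_space2 measurable_restrict_space1) (auto simp: space_restrict_space)
  moreover have s: "sets \<mu> = sets (restrict_space borel (carrier SL2))"
    using \<mu> by (simp add: haar_SL2_def)
  ultimately show ?thesis using measurable_cong_sets[OF s s] by simp
qed

text \<open>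
  Invariance of the measure of sets, rephrased so that it can be applied to integrals.
\<close>

lemma distr_left_mult:
  fixes k :: "'a^2^2"
  assumes \<mu>: "haar_SL2 \<mu>" and k: "k \<in> carrier SL2"
  shows "distr \<mu> \<mu> (\<lambda>x. k ** x) = \<mu>"
proof (rule measure_eqI)
  fix A assume A: "A \<in> sets (distr \<mu> \<mu> (\<lambda>x. k ** x))"
  then have A': "A \<in> sets \<mu>" by simp
  have sub: "A \<subseteq> carrier SL2" using sets.sets_into_space[OF A'] space_haar[OF \<mu>] by simp
  have "(\<lambda>x. k ** x) -` A \<inter> space \<mu> = (\<lambda>x. adj2 k ** x) ` A"
  proof (intro equalityI subsetI)
    fix x assume "x \<in> (\<lambda>x. k ** x) -` A \<inter> space \<mu>"
    then show "x \<in> (\<lambda>x. adj2 k ** x) ` A" using k by (auto intro!: image_eqI[of _ _ "k ** x"])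
  next
    fix x assume "x \<in> (\<lambda>x. adj2 k ** x) ` A"
    then show "x \<in> (\<lambda>x. k ** x) -` A \<inter> space \<mu>" using k sub by (auto simp: space_haar[OF \<mu>] SL2_closed)
  qed
  then show "emeasure (distr \<mu> \<mu> (\<lambda>x. k ** x)) A = emeasure \<mu> A"
    using \<mu> k A' by (simp add: emeasure_distr left_mult_measurable haar_SL2_def)
qed simp

lemma integral_left_mult:
  fixes F :: "'a^2^2 \<Rightarrow> complex" and k :: "'a^2^2"
  assumes \<mu>: "haar_SL2 \<mu>" and k: "k \<in> carrier SL2" and F: "F \<in> borel_measurable \<mu>"
  shows "(\<integral>x. F (k ** x) \<partial>\<mu>) = (\<integral>x. F x \<partial>\<mu>)"
  using integral_distr[OF left_mult_measurable[OF \<mu> k] F] distr_left_mult[OF \<mu> k] by simp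

end

section \<open>Traces of operators of finite rank\<close>

text \<open>
  The left-hand sides of these rules are built from products under a binder, so as rewrite rules they match any
  pointwise product of complex functions.
\<close>

declare fun_vs.scale_scale [simp del] fun_vs.scale_minus_left [simp del] fun_vs.scale_minus_right [simp del]
  fun_vs.scale_zero_left [simp del] fun_vs.scale_zero_right [simp del] fun_vs.scale_cancel_left [simp del]
  fun_vs.scale_cancel_right [simp del] fun_vs.scale_eq_0_iff [simp del]

lemma sum_fun_apply: "(\<Sum>i\<in>I. (g i :: 'x \<Rightarrow> complex)) x = (\<Sum>i\<in>I. g i x)"
proof (induction I rule: infinite_finite_induct)
  case (insert i I)
  then show ?case by (simp only: sum.insert[OF insert(1,2)] plus_fun_apply)
qed (simp_all only: sum.infinite sum.empty not_False_eq_True zero_fun_apply)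

text \<open>
  A system of vectors \<open>e i\<close> and points \<open>pt i\<close> that reproduces every function of \<open>W\<close> from its values computes
  the trace without reference to a basis. Expanding \<open>A b\<close> in the vectors \<open>e i\<close> and exchanging the sums recombines
  the coordinates of \<open>e i\<close> in the basis to \<open>e i\<close> itself. The vectors \<open>e i\<close> may be linearly dependent.
\<close>

lemma finite_rank_trace_frame:
  fixes W V :: "('x \<Rightarrow> complex) set" and pt :: "'i \<Rightarrow> 'x" and e :: "'i \<Rightarrow> 'x \<Rightarrow> complex"
  assumes W: "fun_vs.subspace W" and AV: "A ` V = W" and WV: "W \<subseteq> V"
    and A: "\<And>v. v \<in> W \<Longrightarrow> A v = (\<lambda>x. c * v (\<phi> x))"
    and I: "finite I" and e: "\<And>i. i \<in> I \<Longrightarrow> e i \<in> W"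
    and frame: "\<And>v x. v \<in> W \<Longrightarrow> v x = (\<Sum>i\<in>I. v (pt i) * e i x)"
  shows "finite_rank_trace V A = (\<Sum>i\<in>I. c * e i (\<phi> (pt i)))"
proof -
  define B where "B = (SOME B. fun_vs.independent B \<and> fun_vs.span B = A ` V)"
  obtain B0 where B0: "B0 \<subseteq> W" "fun_vs.independent B0" "W \<subseteq> fun_vs.span B0"
    by (rule fun_vs.basis_exists[of W])
  have "fun_vs.span B0 = A ` V"
    unfolding AV by (rule fun_vs.span_subspace[OF B0(1,3) W])
  with B0(2) have "fun_vs.independent B0 \<and> fun_vs.span B0 = A ` V" by (rule conjI)
  then have "fun_vs.independent B \<and> fun_vs.span B = A ` V"
    unfolding B_def by (rule someI)
  then have B: "fun_vs.independent B" "fun_vs.span B = W"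
    unfolding AV by (rule conjunct1, rule conjunct2)
  have expand: "v = (\<Sum>i\<in>I. (\<lambda>x. v (pt i) * e i x))" if "v \<in> W" for v
    by (rule ext) (simp add: sum_fun_apply frame[OF that, symmetric])
  have "W \<subseteq> fun_vs.span (e ` I)"
  proof
    fix v assume "v \<in> W"
    have "(\<Sum>i\<in>I. (\<lambda>x. v (pt i) * e i x)) \<in> fun_vs.span (e ` I)"
      by (intro fun_vs.span_sum fun_vs.span_scale fun_vs.span_base imageI)
    then show "v \<in> fun_vs.span (e ` I)" using expand[OF \<open>v \<in> W\<close>] by simp
  qed
  then have finB: "finite B"
    using fun_vs.independent_span_bound[OF finite_imageI[OF I] B(1)] B(2) fun_vs.span_superset[of B]
    by (metis subset_trans)
  have BW: "b \<in> W" if "b \<in> B" for b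
    using fun_vs.span_base[OF that] unfolding B(2) .
  have rep: "fun_vs.representation B (A b) b = (\<Sum>i\<in>I. c * (fun_vs.representation B (e i) b * b (\<phi> (pt i))))"
    if b: "b \<in> B" for b
  proof -
    have "A b \<in> W" using AV WV BW[OF b] by blast
    have eB: "e i \<in> fun_vs.span B" if "i \<in> I" for i using e[OF that] B by simp
    have "fun_vs.representation B (A b) b
        = fun_vs.representation B (\<Sum>i\<in>I. (\<lambda>x. A b (pt i) * e i x)) b"
      using expand[OF \<open>A b \<in> W\<close>] by simp
    also have "\<dots> = (\<Sum>i\<in>I. fun_vs.representation B (\<lambda>x. A b (pt i) * e i x) b)"
      using fun_vs.representation_sum[OF B(1), of I "\<lambda>i x. A b (pt i) * e i x"] eB
      by (simp add: fun_vs.span_scale)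
    also have "\<dots> = (\<Sum>i\<in>I. A b (pt i) * fun_vs.representation B (e i) b)"
      by (intro sum.cong refl) (simp add: fun_vs.representation_scale[OF B(1) eB])
    finally show ?thesis using A[OF BW[OF b]] by (simp add: ac_simps)
  qed
  \<comment> \<open>Reading the expansion of \<open>e i\<close> in the basis at a point.\<close>
  have pt: "(\<Sum>b\<in>B. fun_vs.representation B (e i) b * b x) = e i x" if "i \<in> I" for i x
  proof -
    have "(\<Sum>b\<in>B. (\<lambda>x. fun_vs.representation B (e i) b * b x)) = e i"
      using fun_vs.sum_representation_eq[OF B(1) _ finB order_refl, of "e i"] e[OF that] B by simp
    then have "(\<Sum>b\<in>B. (\<lambda>x. fun_vs.representation B (e i) b * b x)) x = e i x" by simp
    then show ?thesis by (simp add: sum_fun_apply)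
  qed
  have "finite_rank_trace V A = (\<Sum>b\<in>B. fun_vs.representation B (A b) b)"
    by (simp add: finite_rank_trace_def B_def[symmetric] Let_def)
  also have "\<dots> = (\<Sum>b\<in>B. \<Sum>i\<in>I. c * (fun_vs.representation B (e i) b * b (\<phi> (pt i))))"
    by (intro sum.cong refl rep)
  also have "\<dots> = (\<Sum>i\<in>I. c * (\<Sum>b\<in>B. fun_vs.representation B (e i) b * b (\<phi> (pt i))))"
    by (subst sum.swap) (simp add: sum_distrib_left)
  also have "\<dots> = (\<Sum>i\<in>I. c * e i (\<phi> (pt i)))"
    by (intro sum.cong refl) (simp add: pt)
  finally show ?thesis .
qed

section \<open>The inducing subgroup and row reduction\<close>

abbreviation upper_unip :: "'a::field \<Rightarrow> 'a^2^2" where "upper_unip z \<equiv> mat2 1 z 0 1"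
abbreviation lower_unip :: "'a::field \<Rightarrow> 'a^2^2" where "lower_unip z \<equiv> mat2 1 0 z 1"

context nonarch_local_field begin

abbreviation H :: "('a^2^2) set" where "H \<equiv> H_sub val"

text \<open>
  Modulo \<open>\<pp>\<close> the determinant is \<open>a d\<close>; therefore the conditions on the second diagonal entry in the
  definition of \<open>I\<^sub>+\<close> follow from the others.
\<close>

lemma unit_det:
  assumes "a - 1 \<in> P 1" "b \<in> P 0" "c \<in> P 1" "a * d - b * c = 1"
  shows "d - 1 \<in> P 1"
proof -
  have a: "a \<noteq> 0" "val a = 0" using one_unit[OF assms(1)] by auto
  have bc: "b * c \<in> P 1" using P_mult[OF assms(2,3)] by simp
  have ad: "a * d = 1 + b * c" using assms(4) by (simp add: algebra_simps)
  have "a * (d - 1) = b * c - (a - 1)" using ad by (simp add: algebra_simps)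
  then have "a * (d - 1) \<in> P 1" using P_diff[OF bc assms(1)] by simp
  then show ?thesis using P_scale_iff[OF a(1)] a(2) by simp
qed

lemma mat2_in_I_plus:
  "mat2 a b c d \<in> I_plus val \<longleftrightarrow> a * d - b * c = 1 \<and> a - 1 \<in> P 1 \<and> b \<in> P 0 \<and> c \<in> P 1"
  unfolding I_plus_def using unit_det[of a b c d] by auto

lemma mat2_in_I_plus_plus:
  "mat2 a b c d \<in> I_plus_plus val \<longleftrightarrow> a * d - b * c = 1 \<and> a - 1 \<in> P 1 \<and> b \<in> P 1 \<and> c \<in> P 2"
  unfolding I_plus_plus_def using P_mono[of b 1 0] P_mono[of c 2 1] by (auto simp: mat2_in_I_plus)

lemma H_eq: "H = I_plus val \<union> uminus ` I_plus val"
proof -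
  have "(- mat 1) ** x = - x" "mat 1 ** x = x" for x :: "'a^2^2"
    by (cases x; simp add: mat_one_eq_mat2)+
  moreover have "H = (\<lambda>y. mat 1 ** y) ` I_plus val \<union> (\<lambda>y. (- mat 1) ** y) ` I_plus val"
    unfolding H_sub_def set_mult_SL2 by blast
  ultimately show ?thesis by simp
qed

lemma P_neg_one: "- x - 1 \<in> P n \<longleftrightarrow> x + 1 \<in> P n"
  using P_minus_iff[of "x + 1" n] by simp

lemma mat2_in_H:
  "mat2 a b c d \<in> H \<longleftrightarrow> a * d - b * c = 1 \<and> b \<in> P 0 \<and> c \<in> P 1 \<and> (a - 1 \<in> P 1 \<or> a + 1 \<in> P 1)"
proof -
  have 1: "x \<in> uminus ` I_plus val \<longleftrightarrow> - x \<in> I_plus val" for x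
  proof
    assume "x \<in> uminus ` I_plus val"
    then show "- x \<in> I_plus val" by (rule imageE) simp
  qed (rule image_eqI[of _ _ "- x"], simp)
  have "mat2 a b c d \<in> H \<longleftrightarrow> mat2 a b c d \<in> I_plus val \<or> mat2 (- a) (- b) (- c) (- d) \<in> I_plus val"
    unfolding H_eq Un_iff 1 uminus_mat2 ..
  also have "\<dots> \<longleftrightarrow> a * d - b * c = 1 \<and> b \<in> P 0 \<and> c \<in> P 1 \<and> (a - 1 \<in> P 1 \<or> a + 1 \<in> P 1)"
    unfolding mat2_in_I_plus P_neg_one P_minus_iff minus_mult_minus by blast
  finally show ?thesis .
qed

lemma H_SL2: "h \<in> H \<Longrightarrow> h \<in> carrier SL2"
  by (cases h) (simp add: mat2_in_H)

lemma I_plus_H: "h \<in> I_plus val \<Longrightarrow> h \<in> H"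
  by (simp add: H_eq)

lemma H_box: assumes "h \<in> H" shows "h \<in> box 0"
proof (cases h)
  case (mat2 a b c d)
  have h: "a * d - b * c = 1" "b \<in> P 0" "c \<in> P 1" "a - 1 \<in> P 1 \<or> a + 1 \<in> P 1"
    using assms mat2 by (simp_all add: mat2_in_H)
  have aux: "x \<in> P 0" if "x - 1 \<in> P 1" for x
    using P_add[OF P_mono[OF that, of 0] one_in_P0] by simp
  have "a \<in> P 0 \<and> d \<in> P 0"
  proof (cases "a - 1 \<in> P 1")
    case True
    then show ?thesis using aux unit_det[OF True h(2,3,1)] by blast
  next
    case False
    then have a: "- a - 1 \<in> P 1" using h(4) P_neg_one by blast
    have "- d - 1 \<in> P 1" using unit_det[OF a, of "- b" "- c" "- d"] h by simp
    then show ?thesis using aux[of "- a"] aux[of "- d"] a by simp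
  qed
  then show ?thesis using h mat2 P_mono[of c 1 0] by simp
qed

lemma unit_mult: assumes "x - 1 \<in> P 1" "y - 1 \<in> P 1" shows "x * y - 1 \<in> P 1"
proof -
  have "x \<in> P 0" using one_unit[OF assms(1)] by (simp add: prime_pow_def)
  then have "x * (y - 1) \<in> P 1" using P_mult[OF _ assms(2)] by simp
  from P_add[OF this assms(1)] show ?thesis by (simp add: algebra_simps)
qed

lemma I_plus_mult:
  assumes "x \<in> I_plus val" "y \<in> I_plus val" shows "x ** y \<in> I_plus val"
proof (cases x; cases y)
  fix a b c d a' b' c' d' assume xy: "x = mat2 a b c d" "y = mat2 a' b' c' d'"
  have x: "x \<in> carrier SL2" "y \<in> carrier SL2" "x \<in> box 0" "y \<in> box 0"
    using assms I_plus_H H_SL2 H_box by blast+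
  have h: "a - 1 \<in> P 1" "b \<in> P 0" "c \<in> P 1" "a' - 1 \<in> P 1" "b' \<in> P 0" "c' \<in> P 1"
    using assms unfolding xy mat2_in_I_plus by auto
  have b: "x ** y \<in> box 0" using box_mult[OF x(3,4)] by simp
  have "b * c' \<in> P 1" using P_mult[OF h(2,6)] by simp
  then have "a * a' + b * c' - 1 \<in> P 1" using P_add[OF unit_mult[OF h(1,4)], of "b * c'"] by (simp add: algebra_simps)
  moreover have "c * a' \<in> P 1" "d * c' \<in> P 1"
    using h x(3,4) unfolding xy by (auto intro: P_mult)
  then have "c * a' + d * c' \<in> P 1" by (rule P_add)
  ultimately show ?thesis
    using SL2_closed[OF x(1,2)] b by (simp add: xy mat2_in_I_plus)
qed

lemma uminus_mat_mult: "(- x) ** y = - (x ** y)" "x ** (- y) = - (x ** y)" for x y :: "'a^2^2"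
  by (cases x; cases y; simp add: algebra_simps)+

lemma H_mult: assumes "x \<in> H" "y \<in> H" shows "x ** y \<in> H"
  using assms I_plus_mult unfolding H_eq by (auto simp: uminus_mat_mult)

lemma H_adj2: assumes "x \<in> H" shows "adj2 x \<in> H"
proof (cases x)
  case (mat2 a b c d)
  have h: "a * d - b * c = 1" "b \<in> P 0" "c \<in> P 1" "a - 1 \<in> P 1 \<or> a + 1 \<in> P 1"
    using assms mat2 by (simp_all add: mat2_in_H)
  have "d - 1 \<in> P 1 \<or> d + 1 \<in> P 1"
  proof (cases "a - 1 \<in> P 1")
    case True
    then show ?thesis using unit_det[OF True h(2,3,1)] by blast
  next
    case False
    then have a: "- a - 1 \<in> P 1" using h(4) P_neg_one by blast
    have "- d - 1 \<in> P 1" using unit_det[OF a, of "- b" "- c" "- d"] h by simp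
    then show ?thesis using P_neg_one by blast
  qed
  then show ?thesis using h by (simp add: mat2 mat2_in_H algebra_simps)
qed

lemma H_mult_iff: "h \<in> H \<Longrightarrow> h ** x \<in> H \<longleftrightarrow> x \<in> H"
  using H_mult[of h x] H_mult[OF H_adj2[of h], of "h ** x"] H_SL2[of h] by auto

lemma mat1_H: "mat 1 \<in> H"
  by (simp add: mat_one_eq_mat2 mat2_in_H)

lemma nbhd1_box: "0 \<le> n \<Longrightarrow> k \<in> nbhd n (mat 1) \<Longrightarrow> k \<in> box 0"
  unfolding nbhd_def using near_box[of 0 "mat 1" k] near_mono mat1_box by blast

lemma nbhd_SL2: "y \<in> nbhd n x \<Longrightarrow> y \<in> carrier SL2"
  by (simp add: nbhd_def)

lemma near_one_trans:
  assumes "x \<in> carrier SL2" "adj2 x \<in> box m" "near n x y" "k \<le> m + n"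
  shows "near k (mat 1) (adj2 x ** y)"
  using near_mult_left[OF assms(2,3,4)] adj2_mult[OF assms(1)] by simp

lemma subgroup_nbhd1: assumes "0 \<le> n" shows "subgroup (nbhd n (mat 1)) SL2"
proof (rule group.subgroupI[OF group_SL2])
  show "nbhd n (mat 1) \<subseteq> carrier SL2" by (auto simp: nbhd_def)
  show "nbhd n (mat 1) \<noteq> {}"
    using mat1_H H_SL2 near_refl unfolding nbhd_def by blast
next
  fix x assume x: "x \<in> nbhd n (mat 1)"
  then have b: "x \<in> box 0" "x \<in> carrier SL2" using assms nbhd1_box nbhd_SL2 by blast+
  have "near n x (mat 1)" using x near_sym by (simp add: nbhd_def)
  from near_one_trans[OF b(2) _ this, of 0 n] b show "inv\<^bsub>SL2\<^esub> x \<in> nbhd n (mat 1)"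
    by (simp add: inv_SL2 nbhd_def)
  fix y assume y: "y \<in> nbhd n (mat 1)"
  have "near n (x ** mat 1) (x ** y)"
    using near_mult_left[OF b(1), of n "mat 1" y n] y by (simp add: nbhd_def)
  then show "x \<otimes>\<^bsub>SL2\<^esub> y \<in> nbhd n (mat 1)"
    using x y near_trans[of n "mat 1" x "x ** y"] by (simp add: nbhd_def SL2_closed)
qed

lemma P_dichotomy: "y \<noteq> 0 \<Longrightarrow> x \<in> P (val y) \<or> (x \<noteq> 0 \<and> y \<in> P (val x + 1))"
  by (auto simp: prime_pow_def)

lemma pivot:
  assumes "x \<noteq> 0 \<or> y \<noteq> 0"
  shows "\<exists>p. (p = x \<or> p = y) \<and> p \<noteq> 0 \<and> x \<in> P (val p) \<and> y \<in> P (val p)"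
proof (cases "x \<noteq> 0 \<and> y \<in> P (val x)")
  case True
  then show ?thesis by (intro exI[of _ x]) simp
next
  case False
  then have "y \<noteq> 0 \<and> x \<in> P (val y)" using assms by (auto simp: prime_pow_def)
  then show ?thesis by (intro exI[of _ y]) simp
qed

text \<open>
  Every \<open>H\<close>-coset contains a matrix whose rows lie in \<open>\<pp>\<^sup>s\<close> and \<open>\<pp>\<^sup>-\<^sup>s\<close>. Choose an entry of least
  valuation, in the second row in case of a tie, and clear the other entry of its column: the multiplier is in \<open>\<oo>\<close>
  if the pivot is in the second row and in \<open>\<pp>\<close> if it is in the first, as needed for the row operation to
  belong to \<open>H\<close>. Since the determinant is 1, the remaining entry of the cleared row is up to sign the inverse of the pivot.
\<close>

lemma row_reduction:
  assumes x: "x \<in> carrier SL2"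
  shows "\<exists>h\<in>H. \<exists>s a b c d. h ** x = mat2 a b c d \<and> a \<in> P s \<and> b \<in> P s \<and> c \<in> P (- s) \<and> d \<in> P (- s)"
proof (cases x)
  case (mat2 a b c d)
  have det: "a * d - b * c = 1" using x mat2 by simp
  have "c \<noteq> 0 \<or> d \<noteq> 0" "a \<noteq> 0 \<or> b \<noteq> 0" using det by auto
  from pivot[OF this(1)] obtain p2 where p2: "p2 = c \<or> p2 = d" "p2 \<noteq> 0" "c \<in> P (val p2)" "d \<in> P (val p2)" by blast
  from pivot[OF \<open>a \<noteq> 0 \<or> b \<noteq> 0\<close>] obtain p1 where p1: "p1 = a \<or> p1 = b" "p1 \<noteq> 0" "a \<in> P (val p1)" "b \<in> P (val p1)" by blast
  have inv: "inverse p \<in> P (- val p)" if "p \<noteq> 0" for p using that by (simp add: prime_pow_def val_inverse)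
  have upH: "upper_unip z \<in> H" if "z \<in> P 0" for z using that by (simp add: mat2_in_H)
  have loH: "lower_unip z \<in> H" if "z \<in> P 1" for z using that by (simp add: mat2_in_H)
  from P_dichotomy[OF p2(2), of p1] show ?thesis
  proof
    assume 1: "p1 \<in> P (val p2)"
    then have "val p2 \<le> val p1" using p1(2) by (simp add: P_iff)
    then have ab: "a \<in> P (val p2)" "b \<in> P (val p2)" using p1 P_mono by blast+
    show ?thesis
    proof (cases "p2 = c")
      case True
      have e: "b - a / c * d = - inverse c" using det True p2(2) by (simp add: field_simps)
      have "upper_unip (- (a / c)) \<in> H" using P_div[of a c 0] ab True p2(2) by (intro upH) simp
      moreover have "upper_unip (- (a / c)) ** x = mat2 0 (- inverse c) c d" using True p2(2) e by (simp add: mat2)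
      moreover have "- inverse c \<in> P (- val c)" using inv True p2(2) by simp
      ultimately show ?thesis using p2 True
        by (intro bexI[of _ "upper_unip (- (a / c))"] exI[of _ "- val c"]) auto
    next
      case False
      then have d: "p2 = d" using p2(1) by blast
      have e: "a - b / d * c = inverse d" using det d p2(2) by (simp add: field_simps)
      have "upper_unip (- (b / d)) \<in> H" using P_div[of b d 0] ab d p2(2) by (intro upH) simp
      moreover have "upper_unip (- (b / d)) ** x = mat2 (inverse d) 0 c d" using d p2(2) e by (simp add: mat2)
      moreover have "inverse d \<in> P (- val d)" using inv d p2(2) by simp
      ultimately show ?thesis using p2 d
        by (intro bexI[of _ "upper_unip (- (b / d))"] exI[of _ "- val d"]) auto
    qed
  next
    assume 2: "p1 \<noteq> 0 \<and> p2 \<in> P (val p1 + 1)"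
    then have "val p1 + 1 \<le> val p2" using p2(2) by (simp add: P_iff)
    then have cd: "c \<in> P (val p1 + 1)" "d \<in> P (val p1 + 1)" using p2 P_mono by blast+
    show ?thesis
    proof (cases "p1 = a")
      case True
      have e: "d - c / a * b = inverse a" using det True p1(2) by (simp add: field_simps)
      have "lower_unip (- (c / a)) \<in> H" using P_div[of c a 1] cd True p1(2) by (intro loH) simp
      moreover have "lower_unip (- (c / a)) ** x = mat2 a b 0 (inverse a)" using True p1(2) e by (simp add: mat2)
      moreover have "inverse a \<in> P (- val a)" using inv True p1(2) by simp
      ultimately show ?thesis using p1 True
        by (intro bexI[of _ "lower_unip (- (c / a))"] exI[of _ "val a"]) auto
    next
      case False
      then have b: "p1 = b" using p1(1) by blast
      have e: "c - d / b * a = - inverse b" using det b p1(2) by (simp add: field_simps)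
      have "lower_unip (- (d / b)) \<in> H" using P_div[of d b 1] cd b p1(2) by (intro loH) simp
      moreover have "lower_unip (- (d / b)) ** x = mat2 a b (- inverse b) 0" using b p1(2) e by (simp add: mat2)
      moreover have "- inverse b \<in> P (- val b)" using inv b p1(2) by simp
      ultimately show ?thesis using p1 b
        by (intro bexI[of _ "lower_unip (- (d / b))"] exI[of _ "val b"]) auto
    qed
  qed
qed

end

section \<open>Fixed vectors of congruence subgroups\<close>

locale affine_generic_char = nonarch_local_field val unif
  for val :: "'a::{field_char_0, topological_space} \<Rightarrow> int" and unif :: 'a +
  fixes psi :: "'a^2^2 \<Rightarrow> complex"
  assumes generic: "affine_generic val psi"
begin

lemma psi_mult: "x \<in> H \<Longrightarrow> y \<in> H \<Longrightarrow> psi (x ** y) = psi x * psi y"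
  using generic by (simp add: affine_generic_def hom_def SL2_def mult_complex_def)

lemma psi_I_plus_plus: "x \<in> I_plus_plus val \<Longrightarrow> psi x = 1"
  using generic by (simp add: affine_generic_def)

lemma psi_nz: assumes "x \<in> H" shows "psi x \<noteq> 0"
proof -
  have "psi \<in> carrier (SL2\<lparr>carrier := H\<rparr>) \<rightarrow> carrier mult_complex"
    using generic by (simp add: affine_generic_def hom_def)
  then show ?thesis using assms by (auto simp: mult_complex_def)
qed

lemma up_H: "z \<in> P 0 \<Longrightarrow> upper_unip z \<in> H" and lo_H: "z \<in> P 1 \<Longrightarrow> lower_unip z \<in> H"
  by (simp_all add: mat2_in_H)

lemma psi_up_add: "y \<in> P 0 \<Longrightarrow> z \<in> P 0 \<Longrightarrow> psi (upper_unip (y + z)) = psi (upper_unip y) * psi (upper_unip z)"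
  using psi_mult[OF up_H[of y] up_H[of z]] by (simp add: add.commute)

lemma psi_lo_add: "y \<in> P 1 \<Longrightarrow> z \<in> P 1 \<Longrightarrow> psi (lower_unip (y + z)) = psi (lower_unip y) * psi (lower_unip z)"
  using psi_mult[OF lo_H[of y] lo_H[of z]] by simp

lemma psi_up_P1: "z \<in> P 1 \<Longrightarrow> psi (upper_unip z) = 1" and psi_lo_P2: "z \<in> P 2 \<Longrightarrow> psi (lower_unip z) = 1"
  by (rule psi_I_plus_plus; simp add: mat2_in_I_plus_plus)+

lemma psi_up_nontrivial: "\<exists>z\<in>P 0. psi (upper_unip z) \<noteq> 1" and psi_lo_nontrivial: "\<exists>z\<in>P 1. psi (lower_unip z) \<noteq> 1"
  using generic by (simp_all add: affine_generic_def)

lemma psi_diag: "a - 1 \<in> P 1 \<Longrightarrow> a * d = 1 \<Longrightarrow> psi (mat2 a 0 0 d) = 1"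
  by (rule psi_I_plus_plus) (simp add: mat2_in_I_plus_plus)

text \<open>
  A triangular matrix in \<open>I\<^sub>+\<close> is the product of a diagonal matrix in \<open>I\<^sub>+\<^sub>+\<close> and a unipotent one.
\<close>

lemma psi_upper:
  assumes "a - 1 \<in> P 1" "a * d = 1" "b \<in> P 0"
  shows "psi (mat2 a b 0 d) = psi (upper_unip (b * d))"
proof -
  have "d - 1 \<in> P 1" using unit_det[of a 0 0 d] assms by simp
  then have d: "d \<in> P 0" using one_unit[of d] by (simp add: prime_pow_def)
  have bd: "b * d \<in> P 0" using P_mult[OF assms(3) d] by simp
  have "mat2 a 0 0 d \<in> H" using assms by (simp add: mat2_in_H)
  have "a * (b * d) = a * d * b" by simp
  then have "a * (b * d) = b" using assms(2) by simp
  then have "mat2 a b 0 d = mat2 a 0 0 d ** upper_unip (b * d)" by simp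
  also have "psi \<dots> = psi (upper_unip (b * d))"
    unfolding psi_mult[OF \<open>mat2 a 0 0 d \<in> H\<close> up_H[OF bd]] using psi_diag assms by simp
  finally show ?thesis .
qed

lemma psi_lower:
  assumes "a - 1 \<in> P 1" "a * d = 1" "c \<in> P 1"
  shows "psi (mat2 a 0 c d) = psi (lower_unip (c * a))"
proof -
  have a: "a \<in> P 0" using one_unit[OF assms(1)] by (simp add: prime_pow_def)
  have bd: "c * a \<in> P 1" using P_mult[OF assms(3) a] by simp
  have "mat2 a 0 0 d \<in> H" using assms by (simp add: mat2_in_H)
  have "d * (c * a) = a * d * c" by simp
  then have "d * (c * a) = c" using assms(2) by simp
  then have "mat2 a 0 c d = mat2 a 0 0 d ** lower_unip (c * a)" by simp
  also have "psi \<dots> = psi (lower_unip (c * a))"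
    unfolding psi_mult[OF \<open>mat2 a 0 0 d \<in> H\<close> lo_H[OF bd]] using psi_diag assms by simp
  finally show ?thesis .
qed

definition equivariant :: "('a^2^2 \<Rightarrow> complex) \<Rightarrow> bool" where
  "equivariant f \<longleftrightarrow> (\<forall>x. x \<notin> carrier SL2 \<longrightarrow> f x = 0) \<and>
     (\<forall>h\<in>H. \<forall>x\<in>carrier SL2. f (h ** x) = psi h * f x)"

lemma equivariantD:
  fixes f :: "'a^2^2 \<Rightarrow> complex"
  shows
  "equivariant f \<Longrightarrow> x \<notin> carrier SL2 \<Longrightarrow> f x = 0"
  "equivariant f \<Longrightarrow> h \<in> H \<Longrightarrow> x \<in> carrier SL2 \<Longrightarrow> f (h ** x) = psi h * f x"
  by (simp_all add: equivariant_def)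

text \<open>
  This is where genericity enters. Outside the box, a representative from \<open>row_reduction\<close> has a row in \<open>\<pp>\<^sup>M\<^sup>+\<^sup>1\<close>.
  Conjugating by it turns an elementary unipotent into a matrix whose distance from the identity is quadratic
  in that row, so the result lies in \<open>K\<^sub>n\<close> with \<open>n = 2 M + 2\<close>; invariance and equivariance then multiply
  the value of \<open>f\<close> by different scalars.
\<close>

lemma invariant_supported:
  fixes f :: "'a^2^2 \<Rightarrow> complex"
  assumes f: "equivariant f"
    and inv: "\<And>k x. k \<in> nbhd (2 * M + 2) (mat 1) \<Longrightarrow> x \<in> carrier SL2 \<Longrightarrow> f (x ** k) = f x"
    and x: "x \<in> carrier SL2" "x \<notin> box (- M)"
  shows "f x = 0"
proof -
  obtain h s a b c d where h: "h \<in> H" and hx: "h ** x = mat2 a b c d"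
    and row: "a \<in> P s" "b \<in> P s" "c \<in> P (- s)" "d \<in> P (- s)"
    using row_reduction[OF x(1)] by blast
  let ?y = "mat2 a b c d"
  have y: "?y \<in> carrier SL2" using SL2_closed[OF H_SL2[OF h] x(1)] hx by simp
  then have det: "a * d - b * c = 1" by simp
  have "?y \<notin> box (- M)"
  proof
    assume "?y \<in> box (- M)"
    then have "adj2 h ** ?y \<in> box (- M)"
      using box_mult[of "adj2 h" 0 ?y "- M"] H_box[OF h] by simp
    then show False using x(2) hx[symmetric] H_SL2[OF h] by simp
  qed
  then have "s < - M \<or> - s < - M" using row P_mono[of _ _ "- M"] by fastforce
  then have "f ?y = 0"
  proof
    assume "s < - M"
    then have cd: "c \<in> P (M + 1)" "d \<in> P (M + 1)" using row P_mono by force+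
    obtain z where z: "z \<in> P 0" "psi (upper_unip z) \<noteq> 1" using psi_up_nontrivial by blast
    \<comment> \<open>The entries of \<open>k - 1\<close> are products of \<open>z\<close> with two entries of the second row.\<close>
    define k where "k = adj2 ?y ** (upper_unip z ** ?y)"
    have "k = mat2 (1 + d * c * z) (d * d * z) (- (c * c * z)) (1 - c * d * z)"
      using det by (simp add: k_def algebra_simps)
    moreover have "u * v * z \<in> P (2 * M + 2)" if "u \<in> P (M + 1)" "v \<in> P (M + 1)" for u v
      by (rule P_mult[OF P_mult[OF that order_refl] z(1)]) simp
    ultimately have "near (2 * M + 2) (mat 1) k" using cd by (simp add: mat_one_eq_mat2)
    moreover have "k \<in> carrier SL2" unfolding k_def
      using y by (intro SL2_closed) (simp_all del: mat2_mult add: mult.commute)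
    ultimately have "k \<in> nbhd (2 * M + 2) (mat 1)" by (simp add: nbhd_def)
    then have "f (?y ** k) = f ?y" using inv y by blast
    moreover have "?y ** k = upper_unip z ** ?y" unfolding k_def by (rule adj2_mult_assoc(2)[OF y])
    ultimately have "psi (upper_unip z) * f ?y = f ?y"
      using equivariantD(2)[OF f up_H[OF z(1)] y] by simp
    then show ?thesis using z(2) by simp
  next
    assume "- s < - M"
    then have ab: "a \<in> P (M + 1)" "b \<in> P (M + 1)" using row P_mono by force+
    obtain z where z: "z \<in> P 1" "psi (lower_unip z) \<noteq> 1" using psi_lo_nontrivial by blast
    \<comment> \<open>Now they are products of \<open>z\<close> with two entries of the first row.\<close>
    define k where "k = adj2 ?y ** (lower_unip z ** ?y)"
    have "k = mat2 (1 - b * a * z) (- (b * b * z)) (a * a * z) (1 + a * b * z)"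
      using det by (simp add: k_def algebra_simps)
    moreover have "u * v * z \<in> P (2 * M + 2)" if "u \<in> P (M + 1)" "v \<in> P (M + 1)" for u v
      by (rule P_mult[OF P_mult[OF that order_refl] z(1)]) simp
    ultimately have "near (2 * M + 2) (mat 1) k" using ab by (simp add: mat_one_eq_mat2)
    moreover have "k \<in> carrier SL2" unfolding k_def
      using y by (intro SL2_closed) (simp_all del: mat2_mult add: mult.commute)
    ultimately have "k \<in> nbhd (2 * M + 2) (mat 1)" by (simp add: nbhd_def)
    then have "f (?y ** k) = f ?y" using inv y by blast
    moreover have "?y ** k = lower_unip z ** ?y" unfolding k_def by (rule adj2_mult_assoc(2)[OF y])
    ultimately have "psi (lower_unip z) * f ?y = f ?y"
      using equivariantD(2)[OF f lo_H[OF z(1)] y] by simp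
    then show ?thesis using z(2) by simp
  qed
  then have "psi h * f x = 0" using equivariantD(2)[OF f h x(1)] hx by simp
  then show ?thesis using psi_nz[OF h] by simp
qed

text \<open>
  The support condition replaces invariance under the congruence subgroup of level \<open>2 M + 2\<close>; the two are equivalent
  for \<open>M \<ge> 0\<close> by \<open>fixed_spaceI\<close> and \<open>fixed_space_invariant\<close>.
\<close>

definition fixed_space :: "int \<Rightarrow> ('a^2^2 \<Rightarrow> complex) set" where
  "fixed_space M = {f. equivariant f \<and> (\<forall>x. x \<notin> box (- M) \<longrightarrow> f x = 0)}"

text \<open>
  For \<open>x\<close> with entries in \<open>\<pp>\<^sup>-\<^sup>M\<close>, conjugation by \<open>x\<close> loses \<open>2 M\<close> in the level and so takes
  \<open>K\<^sub>n\<close> into the congruence subgroup of level 2, on which \<open>psi\<close> is trivial.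
\<close>

lemma fixed_space_invariant:
  fixes f :: "'a^2^2 \<Rightarrow> complex"
  assumes f: "f \<in> fixed_space M" and M: "0 \<le> M"
    and k: "k \<in> nbhd (2 * M + 2) (mat 1)" and x: "x \<in> carrier SL2"
  shows "f (x ** k) = f x"
proof (cases "x \<in> box (- M)")
  case True
  let ?h = "x ** k ** adj2 x"
  have k': "k \<in> carrier SL2" "near (2 * M + 2) (mat 1) k" using k by (simp_all add: nbhd_def)
  have "near (M + 2) (x ** mat 1) (x ** k)" by (rule near_mult_left[OF True k'(2)]) simp
  then have "near 2 (x ** mat 1 ** adj2 x) ?h"
    by (rule near_mult_right[rotated]) (use True in auto)
  then have n: "near 2 (mat 1) ?h" using adj2_mult(2)[OF x] by simp
  have h: "?h \<in> carrier SL2" using x k' by (simp add: SL2_closed)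
  have "?h \<in> I_plus_plus val"
  proof (cases ?h)
    case (mat2 a b c d)
    then show ?thesis using n h P_mono[of _ 2 1] by (auto simp: mat2_in_I_plus_plus mat_one_eq_mat2)
  qed
  then have "psi ?h = 1" "?h \<in> H" using psi_I_plus_plus I_plus_H by (auto simp: I_plus_plus_def)
  moreover have "f (?h ** x) = psi ?h * f x"
    using equivariantD(2)[of f ?h x] f x \<open>?h \<in> H\<close> by (simp add: fixed_space_def)
  moreover have "?h ** x = x ** k" using x by simp
  ultimately show ?thesis by simp
next
  case False
  have k': "k \<in> carrier SL2" "k \<in> box 0" using k M nbhd1_box[of "2 * M + 2" k] by (auto simp: nbhd_def)
  have "x ** k \<notin> box (- M)"
  proof
    assume "x ** k \<in> box (- M)"
    then have "x ** k ** adj2 k \<in> box (- M)" using box_mult[of "x ** k" "- M" "adj2 k" 0] k' by simp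
    then show False using False k' by simp
  qed
  then show ?thesis using f False by (simp add: fixed_space_def)
qed

lemma fixed_spaceI:
  fixes f :: "'a^2^2 \<Rightarrow> complex"
  assumes "equivariant f"
    and "\<And>k x. k \<in> nbhd (2 * M + 2) (mat 1) \<Longrightarrow> x \<in> carrier SL2 \<Longrightarrow> f (x ** k) = f x"
  shows "f \<in> fixed_space M"
  unfolding fixed_space_def using assms invariant_supported[OF assms] equivariantD(1)[OF assms(1)] by blast

lemma subspace_fixed_space: "fun_vs.subspace (fixed_space M)"
proof (rule fun_vs.subspaceI)
  show "0 \<in> fixed_space M" by (simp add: fixed_space_def equivariant_def)
qed (simp_all add: fixed_space_def equivariant_def algebra_simps)

lemma fixed_space_translate:
  fixes w :: "'a^2^2 \<Rightarrow> complex"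
  assumes w: "w \<in> fixed_space M" and g: "g \<in> carrier SL2" "g \<in> box 0"
  shows "(\<lambda>x. w (x ** g)) \<in> fixed_space M"
proof -
  have "equivariant (\<lambda>x. w (x ** g))"
    using w g(1) unfolding fixed_space_def equivariant_def
    by (simp add: SL2_mult_iff matrix_mul_assoc[symmetric])
  moreover have "w (x ** g) = 0" if "x \<notin> box (- M)" for x
  proof -
    have "x ** g \<notin> box (- M)"
    proof
      assume "x ** g \<in> box (- M)"
      then have "x ** g ** adj2 g \<in> box (- M)" using box_mult[of "x ** g" "- M" "adj2 g" 0] g by simp
      then show False using that g by simp
    qed
    then show ?thesis using w by (simp add: fixed_space_def)
  qed
  ultimately show ?thesis by (simp add: fixed_space_def)
qed

lemma fixed_space_scale: fixes w :: "'a^2^2 \<Rightarrow> complex" shows "w \<in> fixed_space M \<Longrightarrow> (\<lambda>x. c * w x) \<in> fixed_space M"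
  by (simp add: fixed_space_def equivariant_def)

abbreviation "ind \<equiv> cInd H psi"

lemma rep_space_equivariant: fixes v :: "'a^2^2 \<Rightarrow> complex" shows "v \<in> rep_space ind \<Longrightarrow> equivariant v"
  by (simp add: cInd_def equivariant_def)

lemma rep_space_smooth:
  fixes v :: "'a^2^2 \<Rightarrow> complex"
  assumes "v \<in> rep_space ind"
  shows "\<exists>m\<ge>0. \<forall>k\<in>nbhd m (mat 1). \<forall>x\<in>carrier SL2. v (x ** k) = v x"
proof -
  obtain K where K: "subgroup K SL2" "openin (top_of_set (carrier SL2)) K"
    "\<forall>k\<in>K. \<forall>x\<in>carrier SL2. v (x ** k) = v x"
    using assms unfolding cInd_def by auto
  have "mat 1 \<in> K" using subgroup.one_closed[OF K(1)] by (simp add: SL2_one)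
  then obtain m where m: "nbhd m (mat 1) \<subseteq> K" using K(2) unfolding openin_SL2_iff by blast
  have "nbhd (max 0 m) (mat 1) \<subseteq> nbhd m (mat 1)"
    unfolding nbhd_def using near_mono[of "max 0 m" _ _ m] by auto
  then show ?thesis using m K(3) by (intro exI[of _ "max 0 m"]) auto
qed

text \<open>
  Compactness of the support modulo \<open>H\<close> comes from compactness of the box.
\<close>

lemma fixed_space_subset: assumes M: "0 \<le> M" shows "fixed_space M \<subseteq> rep_space ind"
proof
  fix w :: "'a^2^2 \<Rightarrow> complex" assume w: "w \<in> fixed_space M"
  have 1: "subgroup (nbhd (2 * M + 2) (mat 1)) SL2" using M by (intro subgroup_nbhd1) simp
  have 2: "{x. w x \<noteq> 0} \<subseteq> H <#>\<^bsub>SL2\<^esub> (carrier SL2 \<inter> box (- M))"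
  proof
    fix x assume "x \<in> {x. w x \<noteq> 0}"
    then have "x \<in> carrier SL2 \<inter> box (- M)" using w unfolding fixed_space_def equivariant_def by blast
    moreover have "x = mat 1 ** x" by simp
    ultimately show "x \<in> H <#>\<^bsub>SL2\<^esub> (carrier SL2 \<inter> box (- M))"
      unfolding set_mult_SL2 using mat1_H by blast
  qed
  have "w \<in> {f.
       (\<forall>x. x \<notin> carrier SL2 \<longrightarrow> f x = 0) \<and>
       (\<forall>h\<in>H. \<forall>x\<in>carrier SL2. f (h ** x) = psi h * f x) \<and>
       (\<exists>K. subgroup K SL2 \<and> openin (top_of_set (carrier SL2)) K \<and>
            (\<forall>k\<in>K. \<forall>x\<in>carrier SL2. f (x ** k) = f x)) \<and>
       (\<exists>C. compact C \<and> C \<subseteq> carrier SL2 \<and> {x. f x \<noteq> 0} \<subseteq> H <#>\<^bsub>SL2\<^esub> C)}"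
  proof (intro CollectI conjI)
    show "\<forall>x. x \<notin> carrier SL2 \<longrightarrow> w x = 0" "\<forall>h\<in>H. \<forall>x\<in>carrier SL2. w (h ** x) = psi h * w x"
      using w by (simp_all add: fixed_space_def equivariant_def)
    show "\<exists>K. subgroup K SL2 \<and> openin (top_of_set (carrier SL2)) K \<and>
            (\<forall>k\<in>K. \<forall>x\<in>carrier SL2. w (x ** k) = w x)"
      using 1 openin_nbhd fixed_space_invariant[OF w M] by (intro exI[of _ "nbhd (2 * M + 2) (mat 1)"]) simp
    show "\<exists>C. compact C \<and> C \<subseteq> carrier SL2 \<and> {x. w x \<noteq> 0} \<subseteq> H <#>\<^bsub>SL2\<^esub> C"
      using 2 compact_SL2_box by (intro exI[of _ "carrier SL2 \<inter> box (- M)"]) simp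
  qed
  then show "w \<in> rep_space ind" by (simp add: cInd_def)
qed

lemma locally_constant_measurable:
  fixes F :: "'a^2^2 \<Rightarrow> complex"
  assumes \<mu>: "haar_SL2 \<mu>" and F: "\<And>y. y \<in> carrier SL2 \<Longrightarrow> \<exists>m. \<forall>z\<in>nbhd m y. F z = F y"
  shows "F \<in> borel_measurable \<mu>"
proof (rule borel_measurableI)
  fix S :: "complex set" assume "open S"
  have "openin (top_of_set (carrier SL2)) (F -` S \<inter> carrier SL2)"
    unfolding openin_SL2_iff
  proof (intro conjI ballI)
    fix y :: "'a^2^2" assume y: "y \<in> F -` S \<inter> carrier SL2"
    then obtain m where "\<forall>z\<in>nbhd m y. F z = F y" using F by blast
    then have "nbhd m y \<subseteq> F -` S \<inter> carrier SL2" using y nbhd_SL2 by auto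
    then show "\<exists>n. nbhd n y \<subseteq> F -` S \<inter> carrier SL2" by blast
  qed simp
  then show "F -` S \<inter> space \<mu> \<in> sets \<mu>" using openin_sets[OF \<mu>] space_haar[OF \<mu>] by simp
qed

section \<open>The trace formula\<close>

definition chi :: "'a^2^2 \<Rightarrow> complex" where
  "chi h = (if h \<in> H then psi h else 0)"

lemma chi_mult: assumes "h \<in> H" shows "chi (h ** x) = psi h * chi x"
  using H_mult_iff[OF assms] psi_mult[OF assms] by (simp add: chi_def)

context
  fixes \<mu> :: "('a^2^2) measure" and g :: "'a^2^2" and M :: int
  assumes \<mu>: "haar_SL2 \<mu>" and g: "g \<in> carrier SL2" "g \<in> box 0" and M: "0 \<le> M"
begin

abbreviation "L \<equiv> nbhd (2 * M + 2) g"
abbreviation "opL \<equiv> rep_op \<mu> ind (indicator L)"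

lemma L_sets: "L \<in> sets \<mu>" using openin_sets[OF \<mu> openin_nbhd] .

lemma L_finite: "emeasure \<mu> L < \<infinity>"
proof -
  have "compact L \<and> L \<subseteq> carrier SL2" using compact_nbhd nbhd_SL2 by blast
  then show ?thesis using \<mu> unfolding haar_SL2_def by blast
qed

lemma L_pos: "measure \<mu> L > 0"
proof -
  have "g \<in> L" using g by (simp add: nbhd_def)
  then have "L \<noteq> {}" by blast
  then have "emeasure \<mu> L > 0" using \<mu> openin_nbhd[of "2 * M + 2" g] unfolding haar_SL2_def by simp
  then show ?thesis using L_finite by (simp add: measure_def enn2real_positive_iff)
qed

lemma opL_eq: fixes v :: "'a^2^2 \<Rightarrow> complex" shows "opL v x = (\<integral>y. indicator L y * v (x ** y) \<partial>\<mu>)"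
  by (simp add: rep_op_def cInd_def)

text \<open>
  Each element of \<open>L = g K\<^sub>n\<close> acts on a fixed vector as \<open>g\<close> does.
\<close>

lemma opL_fixed:
  fixes v :: "'a^2^2 \<Rightarrow> complex"
  assumes v: "v \<in> fixed_space M"
  shows "opL v = (\<lambda>x. measure \<mu> L * v (x ** g))"
proof
  fix x
  have eq: "indicator L y * v (x ** y) = indicat_real L y *\<^sub>R v (x ** g)" if "y \<in> space \<mu>" for y
  proof (cases "y \<in> L")
    case True
    then have y: "y \<in> carrier SL2" "near (2 * M + 2) g y" by (simp_all add: nbhd_def)
    have "v (x ** y) = v (x ** g)"
    proof (cases "x \<in> carrier SL2")
      case True
      let ?k = "adj2 g ** y"
      have "near (2 * M + 2) (mat 1) ?k" using near_one_trans[OF g(1) _ y(2), of 0] g by simp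
      then have "?k \<in> nbhd (2 * M + 2) (mat 1)" using y g by (simp add: nbhd_def SL2_closed)
      then have "v ((x ** g) ** ?k) = v (x ** g)"
        using fixed_space_invariant[OF v M] True g by (simp add: SL2_closed)
      moreover have "(x ** g) ** ?k = x ** y" using g(1) by (simp add: matrix_mul_assoc[symmetric])
      ultimately show ?thesis by simp
    next
      case False
      then show ?thesis using v y g by (simp add: fixed_space_def equivariant_def SL2_mult_iff)
    qed
    then show ?thesis using True by simp
  qed simp
  have "opL v x = (\<integral>y. indicat_real L y *\<^sub>R v (x ** g) \<partial>\<mu>)"
    unfolding opL_eq by (rule Bochner_Integration.integral_cong[OF refl eq])
  also have "\<dots> = measure \<mu> L *\<^sub>R v (x ** g)"
    using L_sets L_finite sets.sets_into_space[OF L_sets]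
    by (subst integral_scaleR_left) (auto simp: Int_absorb2)
  finally show "opL v x = measure \<mu> L * v (x ** g)" by (simp add: scaleR_conv_of_real)
qed

lemma L_translate:
  assumes "k \<in> nbhd (2 * M + 2) (mat 1)" "y \<in> carrier SL2"
  shows "k ** y \<in> L \<longleftrightarrow> y \<in> L"
proof -
  let ?n = "2 * M + 2"
  have n: "0 \<le> ?n" using M by simp
  have k: "k \<in> carrier SL2" "near ?n (mat 1) k" using assms(1) by (simp_all add: nbhd_def)
  have Lb: "y \<in> box 0" if "near ?n g y" for y
    using near_box[OF near_mono[OF that n] g(2)] .
  have 1: "near ?n y (k ** y)" if "y \<in> box 0" for y
    using near_mult_right[OF that k(2), of ?n] by simp
  have kb: "k \<in> box 0" using nbhd1_box[OF n assms(1)] .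
  show ?thesis
  proof
    assume "y \<in> L"
    then show "k ** y \<in> L" using near_trans[OF _ 1[OF Lb]] k assms(2) by (simp add: nbhd_def SL2_closed)
  next
    assume h: "k ** y \<in> L"
    then have "k ** y \<in> box 0" using Lb by (simp add: nbhd_def)
    then have "adj2 k ** (k ** y) \<in> box 0" using box_mult[of "adj2 k" 0 "k ** y" 0 0] kb by simp
    then have "y \<in> box 0" using k by simp
    then have "near ?n (k ** y) y" using 1 near_sym by blast
    then show "y \<in> L" using h assms(2) near_trans[of ?n g "k ** y" y] by (simp add: nbhd_def)
  qed
qed

text \<open>
  Since \<open>g\<close> normalizes \<open>K\<^sub>n\<close>, the set \<open>L\<close> is stable under left translation by \<open>K\<^sub>n\<close>
  (\<open>L_translate\<close>), and left invariance of the measure moves this to invariance of the image.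
\<close>

lemma opL_range:
  fixes v :: "'a^2^2 \<Rightarrow> complex"
  assumes v: "v \<in> rep_space ind"
  shows "opL v \<in> fixed_space M"
proof (rule fixed_spaceI)
  note ve = rep_space_equivariant[OF v]
  show "equivariant (opL v)"
    unfolding equivariant_def
  proof (intro conjI allI impI ballI)
    fix x :: "'a^2^2" assume x: "x \<notin> carrier SL2"
    have "opL v x = (\<integral>y. 0 \<partial>\<mu>)"
      unfolding opL_eq
    proof (rule Bochner_Integration.integral_cong[OF refl])
      fix y :: "'a^2^2" assume "y \<in> space \<mu>"
      then have "x ** y \<notin> carrier SL2" using x by (simp add: space_haar[OF \<mu>] SL2_mult_iff)
      then show "indicator L y * v (x ** y) = 0" using equivariantD(1)[OF ve] by simp
    qed
    then show "opL v x = 0" by simp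
  next
    fix h x :: "'a^2^2" assume h: "h \<in> H" and x: "x \<in> carrier SL2"
    have "opL v (h ** x) = (\<integral>y. psi h * (indicator L y * v (x ** y)) \<partial>\<mu>)"
      unfolding opL_eq
    proof (rule Bochner_Integration.integral_cong[OF refl])
      fix y :: "'a^2^2" assume "y \<in> space \<mu>"
      then have "x ** y \<in> carrier SL2" using x by (simp add: space_haar[OF \<mu>] SL2_closed)
      then have "v (h ** (x ** y)) = psi h * v (x ** y)" using equivariantD(2)[OF ve h] by simp
      then show "indicator L y * v (h ** x ** y) = psi h * (indicator L y * v (x ** y))"
        by (simp add: matrix_mul_assoc[symmetric] mult.left_commute)
    qed
    then show "opL v (h ** x) = psi h * opL v x" by (simp add: opL_eq)
  qed
  fix k x :: "'a^2^2" assume k: "k \<in> nbhd (2 * M + 2) (mat 1)" and x: "x \<in> carrier SL2"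
  have kS: "k \<in> carrier SL2" using k nbhd_SL2 by blast
  define F :: "'a^2^2 \<Rightarrow> complex" where "F = (\<lambda>y. indicator L y * v (x ** y))"
  have F: "F \<in> borel_measurable \<mu>"
  proof (rule locally_constant_measurable[OF \<mu>])
    fix y :: "'a^2^2" assume y: "y \<in> carrier SL2"
    obtain m where m: "m \<ge> 0" "\<forall>k\<in>nbhd m (mat 1). \<forall>x\<in>carrier SL2. v (x ** k) = v x"
      using rep_space_smooth[OF v] by blast
    obtain N where N: "N \<le> 0" "y \<in> box N" using box_exhaust by blast
    let ?m = "max (m - N) (2 * M + 2)"
    have "F z = F y" if z: "z \<in> nbhd ?m y" for z
    proof -
      have zS: "z \<in> carrier SL2" "near ?m y z" using z by (simp_all add: nbhd_def)
      then have "near (2 * M + 2) y z" by (auto intro: near_mono)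
      then have L: "z \<in> L \<longleftrightarrow> y \<in> L"
        using near_trans near_sym y zS unfolding nbhd_def by blast
      let ?k = "adj2 y ** z"
      have "near (m - N) y z" using zS by (auto intro: near_mono)
      then have "near m (mat 1) ?k" using near_one_trans[OF y, of N "m - N" z m] N by simp
      then have "?k \<in> nbhd m (mat 1)" using y zS by (simp add: nbhd_def SL2_closed)
      then have "v ((x ** y) ** ?k) = v (x ** y)" using m x y by (simp add: SL2_closed)
      moreover have "(x ** y) ** ?k = x ** z" using y by (simp add: matrix_mul_assoc[symmetric])
      ultimately show ?thesis using L by (simp add: F_def indicator_def)
    qed
    then show "\<exists>m. \<forall>z\<in>nbhd m y. F z = F y" by blast
  qed
  have "opL v (x ** k) = (\<integral>y. F (k ** y) \<partial>\<mu>)"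
    unfolding opL_eq
  proof (rule Bochner_Integration.integral_cong[OF refl])
    fix y :: "'a^2^2" assume "y \<in> space \<mu>"
    then have "y \<in> carrier SL2" by (simp add: space_haar[OF \<mu>])
    then show "indicator L y * v (x ** k ** y) = F (k ** y)"
      using L_translate[OF k] by (simp add: F_def indicator_def matrix_mul_assoc)
  qed
  also have "\<dots> = (\<integral>y. F y \<partial>\<mu>)" by (rule integral_left_mult[OF \<mu> kS F])
  also have "\<dots> = opL v x" by (simp add: opL_eq F_def)
  finally show "opL v (x ** k) = opL v x" .
qed

text \<open>
  On fixed vectors the operator is a positive multiple of translation by \<open>g\<close>, which is invertible there.
\<close>

lemma opL_image: "opL ` rep_space ind = fixed_space M"
proof (intro equalityI subsetI)
  fix w :: "'a^2^2 \<Rightarrow> complex" assume "w \<in> opL ` rep_space ind"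
  then show "w \<in> fixed_space M" using opL_range by blast
next
  fix w :: "'a^2^2 \<Rightarrow> complex" assume w: "w \<in> fixed_space M"
  let ?c = "complex_of_real (measure \<mu> L)"
  define v where "v = (\<lambda>x. inverse ?c * w (x ** adj2 g))"
  have v: "v \<in> fixed_space M"
    unfolding v_def using g by (intro fixed_space_scale fixed_space_translate[OF w]) simp_all
  have "opL v = w"
    unfolding opL_fixed[OF v] using L_pos g by (simp add: v_def fun_eq_iff field_simps)
  then show "w \<in> opL ` rep_space ind" using v fixed_space_subset[OF M] by blast
qed

text \<open>
  The functions supported on single cosets \<open>H x\<close> form a frame of the space of fixed vectors, and \<open>\<pi>(g)\<close> maps the one
  at \<open>x\<close> to a function whose value at \<open>x\<close> is \<open>chi (x g x\<^sup>-\<^sup>1)\<close>. Every coset may be listed \<open>N0\<close> times, which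
  allows unit parameters that represent a coset once for each sign.
\<close>

lemma trace_formula:
  fixes pt :: "'i \<Rightarrow> 'a^2^2" and N0 :: nat
  assumes I: "finite I" and pt: "\<And>i. i \<in> I \<Longrightarrow> pt i \<in> carrier SL2 \<inter> box (- M)"
    and N0: "N0 > 0"
    and card: "\<And>y. y \<in> carrier SL2 \<Longrightarrow> y \<in> box (- M) \<Longrightarrow> card {i \<in> I. y ** adj2 (pt i) \<in> H} = N0"
  shows "distribution_character \<mu> ind (indicator L) =
    measure \<mu> L * ((\<Sum>i\<in>I. chi (pt i ** g ** adj2 (pt i))) / N0)"
proof -
  define e where "e = (\<lambda>i y. chi (y ** adj2 (pt i)) / complex_of_nat N0)"
  have ptS: "pt i \<in> carrier SL2" "pt i \<in> box (- M)" if "i \<in> I" for i using pt[OF that] by auto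
  have eW: "e i \<in> fixed_space M" if i: "i \<in> I" for i
    unfolding fixed_space_def equivariant_def
  proof (intro CollectI conjI allI impI ballI)
    fix x :: "'a^2^2" assume x: "x \<notin> carrier SL2"
    have "x ** adj2 (pt i) \<notin> H" using x ptS[OF i] H_SL2[of "x ** adj2 (pt i)"] by (auto simp: SL2_mult_iff)
    then show "e i x = 0" by (simp add: e_def chi_def)
  next
    fix h x :: "'a^2^2" assume "h \<in> H" "x \<in> carrier SL2"
    then show "e i (h ** x) = psi h * e i x"
      by (simp add: e_def chi_mult matrix_mul_assoc[symmetric])
  next
    fix x :: "'a^2^2" assume x: "x \<notin> box (- M)"
    have "x ** adj2 (pt i) \<notin> H"
    proof
      assume "x ** adj2 (pt i) \<in> H"
      then have "x ** adj2 (pt i) ** pt i \<in> box (- M)"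
        using box_mult[OF H_box ptS(2)[OF i]] by simp
      then show False using x ptS[OF i] by simp
    qed
    then show "e i x = 0" by (simp add: e_def chi_def)
  qed
  have frame: "v x = (\<Sum>i\<in>I. v (pt i) * e i x)" if v: "v \<in> fixed_space M"
    for v :: "'a^2^2 \<Rightarrow> complex" and x
  proof (cases "x \<in> carrier SL2 \<and> x \<in> box (- M)")
    case True
    have summand: "v (pt i) * e i x = (if x ** adj2 (pt i) \<in> H then v x / N0 else 0)" if i: "i \<in> I" for i
    proof (cases "x ** adj2 (pt i) \<in> H")
      case h: True
      have "v (x ** adj2 (pt i) ** pt i) = psi (x ** adj2 (pt i)) * v (pt i)"
        using v h ptS[OF i] unfolding fixed_space_def equivariant_def by blast
      then show ?thesis using h ptS[OF i] by (simp add: e_def chi_def mult.commute)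
    qed (simp add: e_def chi_def)
    have "(\<Sum>i\<in>I. v (pt i) * e i x) = (\<Sum>i\<in>I. if x ** adj2 (pt i) \<in> H then v x / N0 else 0)"
      by (intro sum.cong refl summand)
    also have "\<dots> = of_nat (card {i \<in> I. x ** adj2 (pt i) \<in> H}) * (v x / N0)"
      using I by (simp add: sum.If_cases Int_def)
    also have "\<dots> = v x" using card True N0 by simp
    finally show ?thesis by simp
  next
    case False
    have "v x = 0" using v False unfolding fixed_space_def equivariant_def by blast
    moreover have "e i x = 0" if "i \<in> I" for i
      using eW[OF that] False unfolding fixed_space_def equivariant_def by blast
    ultimately show ?thesis by simp
  qed
  have "distribution_character \<mu> ind (indicator L) = (\<Sum>i\<in>I. complex_of_real (measure \<mu> L) * e i (pt i ** g))"
    unfolding distribution_character_def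
    by (rule finite_rank_trace_frame[OF subspace_fixed_space opL_image fixed_space_subset[OF M] opL_fixed I eW frame])
  also have "\<dots> = measure \<mu> L * ((\<Sum>i\<in>I. chi (pt i ** g ** adj2 (pt i))) / N0)"
    by (simp add: e_def sum_distrib_left sum_divide_distrib)
  finally show ?thesis .
qed

end

end

section \<open>Coset representatives\<close>

context nonarch_local_field begin

definition residue_reps :: "'a set" where
  "residue_reps = (SOME S. transversal 0 1 S \<and> card S = q)"

definition unit_reps :: "'a set" where
  "unit_reps = {t \<in> residue_reps. t \<notin> P 1}"

definition reps :: "int \<Rightarrow> int \<Rightarrow> 'a set" where
  "reps A B = (SOME S. transversal A B S \<and> card S = q ^ nat (B - A))"

lemma residue_reps: "transversal 0 1 residue_reps" "card residue_reps = q"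
  unfolding residue_reps_def using someI_ex[OF transversal_residue] by blast+

lemma reps: assumes "A \<le> B" shows "transversal A B (reps A B)" "card (reps A B) = q ^ nat (B - A)"
  unfolding reps_def using someI_ex[OF transversal_exists[OF assms]] by blast+

lemma units_val: assumes "t \<in> unit_reps" shows "t \<noteq> 0" "val t = 0"
proof -
  have "t \<in> P 0" "t \<notin> P 1" using assms residue_reps(1) by (auto simp: unit_reps_def transversal_def)
  then show "t \<noteq> 0" "val t = 0" by (auto simp: prime_pow_def)
qed

lemma finite_units: "finite unit_reps"
  using residue_reps(1) by (simp add: unit_reps_def transversal_def)

lemma q_pos: "0 < q"
proof -
  have "\<exists>!s. s \<in> residue_reps \<and> 0 - s \<in> P 1" by (rule transversal_ex1[OF residue_reps(1) P_0])
  then have "residue_reps \<noteq> {}" by blast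
  then show ?thesis using residue_reps by (metis card_gt_0_iff transversal_def)
qed

lemma card_units: "card unit_reps = q - 1"
proof -
  obtain s where s: "s \<in> residue_reps" "0 - s \<in> P 1" "\<forall>t\<in>residue_reps. 0 - t \<in> P 1 \<longrightarrow> t = s"
    by (rule transversalE[OF residue_reps(1) P_0])
  have m: "0 - t \<in> P 1 \<longleftrightarrow> t \<in> P 1" for t by simp
  have "unit_reps = residue_reps - {s}" unfolding unit_reps_def using s m by blast
  then show ?thesis using residue_reps s(1) by simp
qed

text \<open>
  The order of the image of \<open>\<plusminus>1\<close> in the residue field.
\<close>

definition sign_count :: nat where
  "sign_count = (if 2 \<in> P 1 then 1 else 2)"

lemma sign_count_pos: "0 < sign_count" by (simp add: sign_count_def)

lemma units_ex1: assumes "u \<noteq> 0" "val u = 0" shows "\<exists>!t. t \<in> unit_reps \<and> u - t \<in> P 1"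
proof -
  have u: "u \<in> P 0" "u \<notin> P 1" using assms by (auto simp: prime_pow_def)
  obtain t where t: "t \<in> residue_reps" "u - t \<in> P 1" "\<forall>s\<in>residue_reps. u - s \<in> P 1 \<longrightarrow> s = t"
    by (rule transversalE[OF residue_reps(1) u(1)])
  have "t \<notin> P 1" using P_diff_absorb[of t 1 u] t(2) u(2) by blast
  then have "t \<in> unit_reps" using t(1) by (simp add: unit_reps_def)
  moreover have "s = t" if "s \<in> unit_reps" "u - s \<in> P 1" for s using that t(3) by (simp add: unit_reps_def)
  ultimately show ?thesis using t(2) by blast
qed

text \<open>
  The classes of \<open>u\<close> and \<open>- u\<close> coincide exactly if \<open>2 u\<close>, equivalently 2, lies in \<open>\<pp>\<close>.
\<close>

lemma card_units_sign:
  assumes u: "u \<noteq> 0" "val u = 0"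
  shows "card {t \<in> unit_reps. u - t \<in> P 1 \<or> u + t \<in> P 1} = sign_count"
proof -
  obtain t where t: "t \<in> unit_reps" "u - t \<in> P 1" "\<And>s. s \<in> unit_reps \<Longrightarrow> u - s \<in> P 1 \<Longrightarrow> s = t"
    using units_ex1[OF u] by blast
  have "\<exists>!t. t \<in> unit_reps \<and> - u - t \<in> P 1" by (rule units_ex1) (simp_all add: u)
  then obtain t' where t': "t' \<in> unit_reps" "- u - t' \<in> P 1" "\<And>s. s \<in> unit_reps \<Longrightarrow> - u - s \<in> P 1 \<Longrightarrow> s = t'"
    by blast
  have neg: "- u - s \<in> P 1 \<longleftrightarrow> u + s \<in> P 1" for s
  proof -
    have "- u - s = - (u + s)" by simp
    then show ?thesis by (simp only: P_minus_iff)
  qed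
  have "{t \<in> unit_reps. u - t \<in> P 1 \<or> u + t \<in> P 1} = {t, t'}"
  proof (intro equalityI subsetI)
    fix s assume "s \<in> {t \<in> unit_reps. u - t \<in> P 1 \<or> u + t \<in> P 1}"
    then show "s \<in> {t, t'}" using t(3)[of s] t'(3)[of s] neg[of s] by blast
  next
    fix s assume "s \<in> {t, t'}"
    then show "s \<in> {t \<in> unit_reps. u - t \<in> P 1 \<or> u + t \<in> P 1}" using t(1,2) t'(1,2) neg[of t'] by auto
  qed
  moreover have "t = t' \<longleftrightarrow> 2 \<in> P 1"
  proof
    assume "t = t'"
    then have "(u - t) - (- u - t) \<in> P 1" using P_diff t t' by blast
    then have "u * 2 \<in> P 1" by (simp add: algebra_simps)
    then show "2 \<in> P 1" using P_scale_iff[of u 2 1] u by simp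
  next
    assume "2 \<in> P 1"
    then have "u * 2 \<in> P 1" using P_scale_iff[of u 2 1] u by simp
    have "(u - t) - u * 2 = - u - t" by (simp add: algebra_simps)
    with P_diff[OF t(2) \<open>u * 2 \<in> P 1\<close>] have "- u - t \<in> P 1" by (simp only:)
    then show "t = t'" using t'(3) t(1) by blast
  qed
  ultimately show ?thesis by (cases "t = t'") (auto simp: sign_count_def)
qed

text \<open>
  By the pigeonhole principle, two natural numbers lie in the same residue class. Without this fact the minimum
  defining the residue characteristic could be taken over the empty set.
\<close>

lemma nat_in_P1: "\<exists>n>0. of_nat n \<in> P 1"
proof -
  have ex: "\<exists>s. s \<in> residue_reps \<and> of_nat n - s \<in> P 1" for n
  proof -
    have "of_nat n \<in> P 0"
      by (induction n) (auto intro: P_add)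
    then show ?thesis using transversal_ex1[OF residue_reps(1)] by blast
  qed
  then obtain f where f: "\<And>n. f n \<in> residue_reps" "\<And>n. of_nat n - f n \<in> P 1" by metis
  have fin: "finite residue_reps" using residue_reps(1) by (simp add: transversal_def)
  have "range f \<subseteq> residue_reps" using f(1) by blast
  then have "finite (range f)" using fin finite_subset by blast
  then have "\<not> inj f" using finite_imageD by blast
  then obtain i j where ij: "f i = f j" "i < j"
    unfolding inj_def by (metis linorder_neqE_nat)
  have "of_nat j - of_nat i \<in> P 1"
    using P_diff[OF f(2)[of j] f(2)[of i]] ij(1) by simp
  then have "of_nat (j - i) \<in> P 1" using ij(2) by (simp add: of_nat_diff)
  then show ?thesis using ij(2) by (intro exI[of _ "j - i"]) simp
qed

lemma residue_char_2: "residue_char val = 2 \<longleftrightarrow> 2 \<in> P 1"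
proof
  assume "residue_char val = 2"
  moreover have "0 < residue_char val \<and> of_nat (residue_char val) \<in> P 1"
    unfolding residue_char_def using nat_in_P1 by (rule LeastI_ex)
  ultimately show "2 \<in> P 1" by simp
next
  assume 2: "2 \<in> P 1"
  show "residue_char val = 2"
    unfolding residue_char_def
  proof (rule Least_equality)
    fix n assume n: "0 < n \<and> of_nat n \<in> P 1"
    then have "n \<noteq> 1" using one_not_in_P1 by auto
    then show "2 \<le> n" using n by simp
  qed (use 2 in simp)
qed

lemma c_const_eq: "c_const val = (real q - 1) / sign_count"
  unfolding c_const_def residue_char_2 q_def sign_count_def by simp

text \<open>
  Representatives in \<open>T(F) U(F)\<close> and in \<open>T(F) w U(F)\<close>, with \<open>U\<close> the upper unipotent matrices and \<open>w\<close> the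
  nontrivial finite Weyl element. The case distinction between the two is made on first columns, on which \<open>U(F)\<close> acts trivially
  from the right: the \<open>H\<close>-orbit of a column \<open>(a, c)\<close> meets the first family if \<open>val c\<close> exceeds \<open>val a\<close>, and the second
  otherwise.
\<close>

definition rep_A :: "'a \<Rightarrow> 'a \<Rightarrow> 'a^2^2" where
  "rep_A \<tau> z = mat2 \<tau> (\<tau> * z) 0 (inverse \<tau>)"

definition rep_B :: "'a \<Rightarrow> 'a \<Rightarrow> 'a^2^2" where
  "rep_B \<tau> z = mat2 0 \<tau> (- inverse \<tau>) (- (z / \<tau>))"

lemma div_one_iff: assumes "y \<noteq> 0" shows "x / y - 1 \<in> P 1 \<longleftrightarrow> x - y \<in> P (val y + 1)" "x / y + 1 \<in> P 1 \<longleftrightarrow> x + y \<in> P (val y + 1)"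
proof -
  have "y * (x / y - 1) = x - y" "y * (x / y + 1) = x + y" using assms by (simp_all add: algebra_simps)
  then show "x / y - 1 \<in> P 1 \<longleftrightarrow> x - y \<in> P (val y + 1)" "x / y + 1 \<in> P 1 \<longleftrightarrow> x + y \<in> P (val y + 1)"
    using P_scale_iff[OF assms, of "x / y - 1" "val y + 1"] P_scale_iff[OF assms, of "x / y + 1" "val y + 1"] by simp_all
qed

lemma in_H_rep_A:
  assumes y: "mat2 a b c d \<in> carrier SL2" and \<tau>: "\<tau> \<noteq> 0"
  shows "mat2 a b c d ** adj2 (rep_A \<tau> z) \<in> H \<longleftrightarrow>
     c \<in> P (val \<tau> + 1) \<and> b - a * z \<in> P (- val \<tau>) \<and> (a - \<tau> \<in> P (val \<tau> + 1) \<or> a + \<tau> \<in> P (val \<tau> + 1))"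
proof -
  have e: "mat2 a b c d ** adj2 (rep_A \<tau> z) = mat2 (a / \<tau>) (\<tau> * (b - a * z)) (c / \<tau>) (\<tau> * (d - c * z))"
    by (simp add: rep_A_def field_simps)
  have det: "(a / \<tau>) * (\<tau> * (d - c * z)) - (\<tau> * (b - a * z)) * (c / \<tau>) = 1"
    using y \<tau> by (simp add: field_simps)
  have c: "c / \<tau> \<in> P 1 \<longleftrightarrow> c \<in> P (val \<tau> + 1)"
    using P_scale_iff[OF \<tau>, of "c / \<tau>" "val \<tau> + 1"] \<tau> by simp
  have b: "\<tau> * (b - a * z) \<in> P 0 \<longleftrightarrow> b - a * z \<in> P (- val \<tau>)"
    using P_scale_iff[OF \<tau>, of "b - a * z" 0] by simp
  show ?thesis unfolding e mat2_in_H using det b c div_one_iff[OF \<tau>, of a] by blast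
qed

lemma in_H_rep_B:
  assumes y: "mat2 a b c d \<in> carrier SL2" and \<tau>: "\<tau> \<noteq> 0"
  shows "mat2 a b c d ** adj2 (rep_B \<tau> z) \<in> H \<longleftrightarrow>
     a \<in> P (- val \<tau>) \<and> d - c * z \<in> P (val \<tau> + 1) \<and> (- (c * \<tau>) - 1 \<in> P 1 \<or> - (c * \<tau>) + 1 \<in> P 1)"
proof -
  have e: "mat2 a b c d ** adj2 (rep_B \<tau> z) = mat2 ((b - a * z) / \<tau>) (- (\<tau> * a)) ((d - c * z) / \<tau>) (- (c * \<tau>))"
    by (simp add: rep_B_def divide_inverse algebra_simps)
  have det: "((b - a * z) / \<tau>) * (- (c * \<tau>)) - (- (\<tau> * a)) * ((d - c * z) / \<tau>) = 1"
    using y \<tau> by (simp add: field_simps)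
  have c: "(d - c * z) / \<tau> \<in> P 1 \<longleftrightarrow> d - c * z \<in> P (val \<tau> + 1)"
    using P_scale_iff[OF \<tau>, of "(d - c * z) / \<tau>" "val \<tau> + 1"] \<tau> by simp
  have b: "- (\<tau> * a) \<in> P 0 \<longleftrightarrow> a \<in> P (- val \<tau>)"
    using P_scale_iff[OF \<tau>, of a 0] by simp
  \<comment> \<open>\<open>mat2_in_H\<close> tests the upper left entry; passing to the inverse makes that the simpler one.\<close>
  let ?y = "mat2 a b c d ** adj2 (rep_B \<tau> z)"
  have "?y \<in> H \<longleftrightarrow> adj2 ?y \<in> H" using H_adj2[of ?y] H_adj2[of "adj2 ?y"] by auto
  also have "\<dots> \<longleftrightarrow> - (\<tau> * a) \<in> P 0 \<and> (d - c * z) / \<tau> \<in> P 1 \<and> (- (c * \<tau>) - 1 \<in> P 1 \<or> - (c * \<tau>) + 1 \<in> P 1)"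
    unfolding e adj2_mat2 mat2_in_H P_minus_iff using det by (auto simp: mult.commute)
  finally show ?thesis unfolding b c .
qed

text \<open>
  The ranges of \<open>m\<close> and \<open>z\<close> are those for which the representative has entries in \<open>\<pp>\<^sup>-\<^sup>M\<close>; \<open>z\<close> is taken modulo
  the translations that do not change the \<open>H\<close>-coset.
\<close>

definition index_A :: "int \<Rightarrow> (int \<times> 'a \<times> 'a) set" where
  "index_A M = (SIGMA m:{- M..M}. unit_reps \<times> reps (- M - m) (- 2 * m))"
definition index_B :: "int \<Rightarrow> (int \<times> 'a \<times> 'a) set" where
  "index_B M = (SIGMA m:{- M..M}. unit_reps \<times> reps (m - M) (2 * m + 1))"
definition "index M = index_A M <+> index_B M"

definition coset_rep :: "(int \<times> 'a \<times> 'a) + (int \<times> 'a \<times> 'a) \<Rightarrow> 'a^2^2" where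
  "coset_rep i = (case i of Inl (m, t, z) \<Rightarrow> rep_A (t * unif_pow m) z | Inr (m, t, z) \<Rightarrow> rep_B (t * unif_pow m) z)"

lemma transversal_reps_A: "m \<in> {- M..M} \<Longrightarrow> transversal (- M - m) (- 2 * m) (reps (- M - m) (- 2 * m))"
  and transversal_reps_B: "m \<in> {- M..M} \<Longrightarrow> transversal (m - M) (2 * m + 1) (reps (m - M) (2 * m + 1))"
  by (rule reps(1); simp)+

lemma finite_index_A: "finite (index_A M)" and finite_index_B: "finite (index_B M)"
  unfolding index_A_def index_B_def using finite_units transversal_reps_A transversal_reps_B
  by (auto intro!: finite_SigmaI simp: transversal_def)

lemma val_tau: "t \<in> unit_reps \<Longrightarrow> t * unif_pow m \<noteq> 0 \<and> val (t * unif_pow m) = m"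
  using units_val by (simp add: val_mult)

lemma inverse_mem: "x \<noteq> 0 \<Longrightarrow> val x \<in> {- M..M} \<Longrightarrow> x \<in> P (- M) \<and> inverse x \<in> P (- M)"
  by (simp add: prime_pow_def val_inverse)

lemma coset_rep_mem: assumes "i \<in> index M" shows "coset_rep i \<in> carrier SL2 \<inter> box (- M)"
proof (cases i)
  case (Inl x)
  then obtain m t z where i: "i = Inl (m, t, z)" by (cases x) auto
  then have h: "m \<in> {- M..M}" "t \<in> unit_reps" "z \<in> reps (- M - m) (- 2 * m)"
    using assms by (auto simp: index_def index_A_def)
  have z: "z \<in> P (- M - m)" using h transversal_reps_A by (auto simp: transversal_def)
  let ?\<tau> = "t * unif_pow m"
  have \<tau>: "?\<tau> \<noteq> 0" "val ?\<tau> = m" using val_tau[OF h(2)] by auto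
  have "?\<tau> \<in> P (- M)" "inverse ?\<tau> \<in> P (- M)" using inverse_mem[OF \<tau>(1), of M] h(1) unfolding \<tau>(2) by blast+
  moreover have "?\<tau> * z \<in> P (- M)" using P_mult[OF P_val z, of "- M" ?\<tau>] \<tau> by simp
  moreover have "coset_rep i = mat2 ?\<tau> (?\<tau> * z) 0 (inverse ?\<tau>)" by (simp only: i coset_rep_def rep_A_def sum.case prod.case)
  ultimately show ?thesis using \<tau>(1) by (simp del: mult_eq_0_iff inverse_mult_distrib)
next
  case (Inr x)
  then obtain m t z where i: "i = Inr (m, t, z)" by (cases x) auto
  then have h: "m \<in> {- M..M}" "t \<in> unit_reps" "z \<in> reps (m - M) (2 * m + 1)"
    using assms by (auto simp: index_def index_B_def)
  have z: "z \<in> P (m - M)" using h transversal_reps_B by (auto simp: transversal_def)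
  let ?\<tau> = "t * unif_pow m"
  have \<tau>: "?\<tau> \<noteq> 0" "val ?\<tau> = m" using val_tau[OF h(2)] by auto
  have "?\<tau> \<in> P (- M)" "inverse ?\<tau> \<in> P (- M)" using inverse_mem[OF \<tau>(1), of M] h(1) unfolding \<tau>(2) by blast+
  moreover have "z / ?\<tau> \<in> P (- M)" using P_div[of z ?\<tau> "- M"] z \<tau> by simp
  moreover have "coset_rep i = mat2 0 ?\<tau> (- inverse ?\<tau>) (- (z / ?\<tau>))" by (simp only: i coset_rep_def rep_B_def sum.case prod.case)
  ultimately show ?thesis using \<tau>(1) by (simp del: mult_eq_0_iff inverse_mult_distrib)
qed

lemma close_val: assumes "\<tau> \<noteq> 0" "x - \<tau> \<in> P (val \<tau> + 1) \<or> x + \<tau> \<in> P (val \<tau> + 1)" shows "x \<noteq> 0" "val x = val \<tau>"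
proof -
  have *: "x \<noteq> 0 \<and> val x = val \<tau>'" if "\<tau>' \<noteq> 0" "x - \<tau>' \<in> P (val \<tau>' + 1)" for \<tau>'
  proof -
    have "x / \<tau>' - 1 \<in> P 1" using that div_one_iff by blast
    from one_unit[OF this] have "x / \<tau>' \<noteq> 0" "val (x / \<tau>') = 0" by auto
    then show ?thesis using that(1) by (auto simp: val_divide)
  qed
  show "x \<noteq> 0" "val x = val \<tau>" using assms *[of \<tau>] *[of "- \<tau>"] by auto
qed

lemma scaled_close:
  assumes "c \<noteq> 0"
  shows "(x - t * c \<in> P (val c + 1) \<or> x + t * c \<in> P (val c + 1)) \<longleftrightarrow> (x / c - t \<in> P 1 \<or> x / c + t \<in> P 1)"
proof -
  have "c * (x / c - t) = x - t * c" "c * (x / c + t) = x + t * c" using assms by (simp_all add: algebra_simps)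
  then show ?thesis
    using P_scale_iff[OF assms, of "x / c - t" "val c + 1"] P_scale_iff[OF assms, of "x / c + t" "val c + 1"] by simp
qed

text \<open>
  For \<open>y = (a, b; c, d)\<close> the first column determines the family, the exponent \<open>m\<close> and the unit part of \<open>\<tau>\<close> up to sign; then
  \<open>z\<close> is determined as the class of \<open>b / a\<close> or \<open>d / c\<close>. Only the sign is left free, whence the multiplicity.
\<close>

lemma card_index:
  assumes y: "y \<in> carrier SL2" "y \<in> box (- M)"
  shows "card {i \<in> index M. y ** adj2 (coset_rep i) \<in> H} = sign_count"
proof (cases y)
  case (mat2 a b c d)
  have yS: "mat2 a b c d \<in> carrier SL2" using y mat2 by simp
  then have det: "a * d - b * c = 1" by simp
  have box: "a \<in> P (- M)" "b \<in> P (- M)" "c \<in> P (- M)" "d \<in> P (- M)" using y mat2 by auto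
  have det_contra: "\<not> (a * d \<in> P 1 \<and> b * c \<in> P 1)"
    using P_diff[of "a * d" 1 "b * c"] det one_not_in_P1 by auto
  let ?J = "{i \<in> index M. y ** adj2 (coset_rep i) \<in> H}"
  have A: "y ** adj2 (coset_rep (Inl (m, t, z))) \<in> H \<longleftrightarrow>
     c \<in> P (m + 1) \<and> b - a * z \<in> P (- m) \<and> (a - t * unif_pow m \<in> P (m + 1) \<or> a + t * unif_pow m \<in> P (m + 1))"
    if "t \<in> unit_reps" for m t z
    using in_H_rep_A[OF yS, of "t * unif_pow m" z] val_tau[OF that, of m] by (simp add: coset_rep_def mat2)
  have B: "y ** adj2 (coset_rep (Inr (m, t, z))) \<in> H \<longleftrightarrow>
     a \<in> P (- m) \<and> d - c * z \<in> P (m + 1) \<and> (- (c * (t * unif_pow m)) - 1 \<in> P 1 \<or> - (c * (t * unif_pow m)) + 1 \<in> P 1)"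
    if "t \<in> unit_reps" for m t z
    using in_H_rep_B[OF yS, of "t * unif_pow m" z] val_tau[OF that, of m] by (simp add: coset_rep_def mat2)
  have Bval: "c \<noteq> 0 \<and> val c = - m"
    if t: "t \<in> unit_reps" and h: "- (c * (t * unif_pow m)) - 1 \<in> P 1 \<or> - (c * (t * unif_pow m)) + 1 \<in> P 1" for m t
  proof -
    have "- (c * (t * unif_pow m)) \<noteq> 0 \<and> val (- (c * (t * unif_pow m))) = 0"
      using close_val[of 1 "- (c * (t * unif_pow m))"] h by simp
    then have "c \<noteq> 0" "val (c * (t * unif_pow m)) = 0" by auto
    then show ?thesis using val_tau[OF t, of m] by (simp add: val_mult)
  qed
  show ?thesis
  proof (cases "a \<noteq> 0 \<and> c \<in> P (val a + 1)")
    case True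
    define m where "m = val a"
    have a: "a \<noteq> 0" "c \<in> P (m + 1)" using True by (auto simp: m_def)
    have "- M \<le> m" using box(1) a(1) by (simp add: m_def P_iff)
    \<comment> \<open>Otherwise both products in the determinant would lie in \<open>\<pp>\<close>.\<close>
    moreover have "m \<le> M"
    proof (rule ccontr)
      assume "\<not> m \<le> M"
      then have "a * d \<in> P 1" "b * c \<in> P 1"
        using P_mult[OF P_val[of a] box(4), of 1] P_mult[OF box(2) a(2), of 1] by (simp_all add: m_def)
      then show False using det_contra by blast
    qed
    ultimately have m: "m \<in> {- M..M}" by simp
    have "b / a \<in> P (- M - m)" using P_div[of b a "- M - m"] box(2) a(1) by (simp add: m_def)
    then obtain z where z: "z \<in> reps (- M - m) (- 2 * m)" "b / a - z \<in> P (- 2 * m)"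
      "\<forall>s\<in>reps (- M - m) (- 2 * m). b / a - s \<in> P (- 2 * m) \<longrightarrow> s = z"
      by (rule transversalE[OF transversal_reps_A[OF m]])
    have zc: "b - a * s \<in> P (- m) \<longleftrightarrow> b / a - s \<in> P (- 2 * m)" for s
    proof -
      have "a * (b / a - s) = b - a * s" using a(1) by (simp add: algebra_simps)
      then show ?thesis using P_scale_iff[OF a(1), of "b / a - s" "- m"] by (simp add: m_def)
    qed
    let ?u = "a / unif_pow m"
    have u: "?u \<noteq> 0" "val ?u = 0" using a(1) by (simp_all add: val_divide m_def)
    have tc: "(a - t * unif_pow m \<in> P (m + 1) \<or> a + t * unif_pow m \<in> P (m + 1)) \<longleftrightarrow> (?u - t \<in> P 1 \<or> ?u + t \<in> P 1)" for t
      using scaled_close[of "unif_pow m" a t] by simp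
    have "?J = (\<lambda>t. Inl (m, t, z)) ` {t \<in> unit_reps. ?u - t \<in> P 1 \<or> ?u + t \<in> P 1}"
    proof (intro equalityI subsetI)
      fix i :: "(int \<times> 'a \<times> 'a) + (int \<times> 'a \<times> 'a)" assume i: "i \<in> ?J"
      show "i \<in> (\<lambda>t. Inl (m, t, z)) ` {t \<in> unit_reps. ?u - t \<in> P 1 \<or> ?u + t \<in> P 1}"
      proof (cases i)
        case (Inl x)
        then obtain m' t z' where ie: "i = Inl (m', t, z')" by (cases x) auto
        have h: "t \<in> unit_reps" "z' \<in> reps (- M - m') (- 2 * m')"
          using i ie by (auto simp: index_def index_A_def)
        have k: "b - a * z' \<in> P (- m')" "a - t * unif_pow m' \<in> P (m' + 1) \<or> a + t * unif_pow m' \<in> P (m' + 1)"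
          using i ie A[OF h(1)] by auto
        have m': "m' = m" using close_val(2)[of "t * unif_pow m'" a] val_tau[OF h(1), of m'] k(2) by (simp add: m_def)
        then have "z' = z" using k(1) h(2) z(3) zc by blast
        then show ?thesis using ie m' h(1) k(2) tc by blast
      next
        case (Inr x)
        then obtain m' t z' where ie: "i = Inr (m', t, z')" by (cases x) auto
        have h: "t \<in> unit_reps" using i ie by (auto simp: index_def index_B_def)
        have k: "a \<in> P (- m')" "- (c * (t * unif_pow m')) - 1 \<in> P 1 \<or> - (c * (t * unif_pow m')) + 1 \<in> P 1"
          using i ie B[OF h] by auto
        have "c \<noteq> 0" "val c = - m'" using Bval[OF h k(2)] by auto
        then have False using k(1) a by (simp add: m_def P_iff)
        then show ?thesis ..
      qed
    next
      fix i :: "(int \<times> 'a \<times> 'a) + (int \<times> 'a \<times> 'a)" assume "i \<in> (\<lambda>t. Inl (m, t, z)) ` {t \<in> unit_reps. ?u - t \<in> P 1 \<or> ?u + t \<in> P 1}"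
      then obtain t where t: "i = Inl (m, t, z)" "t \<in> unit_reps" "?u - t \<in> P 1 \<or> ?u + t \<in> P 1" by blast
      have "y ** adj2 (coset_rep i) \<in> H" unfolding t(1) A[OF t(2)] using a(2) zc z(2) tc t(3) by blast
      moreover have "i \<in> index M" using t m z(1) by (auto simp: index_def index_A_def)
      ultimately show "i \<in> ?J" by simp
    qed
    moreover have "inj (\<lambda>t. Inl (m, t, z) :: (int \<times> 'a \<times> 'a) + (int \<times> 'a \<times> 'a))" by (simp add: inj_def)
    ultimately show ?thesis using card_units_sign[OF u] by (simp add: card_image inj_on_subset)
  next
    case False
    have ac: "a \<noteq> 0 \<or> c \<noteq> 0" using det by auto
    then have c: "c \<noteq> 0" using False by auto
    then have aP: "a \<in> P (val c)" using False by (auto simp: prime_pow_def)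
    define m where "m = - val c"
    have "m \<le> M" using box(3) c by (simp add: m_def P_iff)
    moreover have "- M \<le> m"
    proof (rule ccontr)
      assume "\<not> - M \<le> m"
      then have "a * d \<in> P 1" "b * c \<in> P 1"
        using P_mult[OF aP box(4), of 1] P_mult[OF box(2) P_val[of c], of 1] by (simp_all add: m_def)
      then show False using det_contra by blast
    qed
    ultimately have m: "m \<in> {- M..M}" by simp
    have "d / c \<in> P (m - M)" using P_div[of d c "m - M"] box(4) c by (simp add: m_def)
    then obtain z where z: "z \<in> reps (m - M) (2 * m + 1)" "d / c - z \<in> P (2 * m + 1)"
      "\<forall>s\<in>reps (m - M) (2 * m + 1). d / c - s \<in> P (2 * m + 1) \<longrightarrow> s = z"
      by (rule transversalE[OF transversal_reps_B[OF m]])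
    have zc: "d - c * s \<in> P (m + 1) \<longleftrightarrow> d / c - s \<in> P (2 * m + 1)" for s
    proof -
      have "c * (d / c - s) = d - c * s" using c by (simp add: algebra_simps)
      then show ?thesis using P_scale_iff[OF c, of "d / c - s" "m + 1"] by (simp add: m_def algebra_simps)
    qed
    let ?u = "- inverse (c * unif_pow m)"
    have u: "?u \<noteq> 0" "val ?u = 0" using c by (simp_all add: val_inverse val_mult m_def)
    have tc: "(- (c * (t * unif_pow m)) - 1 \<in> P 1 \<or> - (c * (t * unif_pow m)) + 1 \<in> P 1) \<longleftrightarrow> (?u - t \<in> P 1 \<or> ?u + t \<in> P 1)" for t
    proof -
      let ?v = "- (c * unif_pow m)"
      have v: "?v \<noteq> 0" "val ?v = 0" using c by (simp_all add: val_mult m_def)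
      have "?v * (?u + t) = - (c * (t * unif_pow m)) + 1" "?v * (?u - t) = - (- (c * (t * unif_pow m)) - 1)"
        using c by (simp_all add: field_simps)
      then show ?thesis
        using P_scale_iff[OF v(1), of "?u + t" 1] P_scale_iff[OF v(1), of "?u - t" 1]
          P_minus_iff[of "- (c * (t * unif_pow m)) - 1" 1] v(2) by auto
    qed
    have "?J = (\<lambda>t. Inr (m, t, z)) ` {t \<in> unit_reps. ?u - t \<in> P 1 \<or> ?u + t \<in> P 1}"
    proof (intro equalityI subsetI)
      fix i :: "(int \<times> 'a \<times> 'a) + (int \<times> 'a \<times> 'a)" assume i: "i \<in> ?J"
      show "i \<in> (\<lambda>t. Inr (m, t, z)) ` {t \<in> unit_reps. ?u - t \<in> P 1 \<or> ?u + t \<in> P 1}"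
      proof (cases i)
        case (Inr x)
        then obtain m' t z' where ie: "i = Inr (m', t, z')" by (cases x) auto
        have h: "t \<in> unit_reps" "z' \<in> reps (m' - M) (2 * m' + 1)"
          using i ie by (auto simp: index_def index_B_def)
        have k: "d - c * z' \<in> P (m' + 1)" "- (c * (t * unif_pow m')) - 1 \<in> P 1 \<or> - (c * (t * unif_pow m')) + 1 \<in> P 1"
          using i ie B[OF h(1)] by auto
        have m': "m' = m" using Bval[OF h(1) k(2)] by (simp add: m_def)
        then have "z' = z" using k(1) h(2) z(3) zc by blast
        then show ?thesis using ie m' h(1) k(2) tc by blast
      next
        case (Inl x)
        then obtain m' t z' where ie: "i = Inl (m', t, z')" by (cases x) auto
        have h: "t \<in> unit_reps" using i ie by (auto simp: index_def index_A_def)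
        have k: "c \<in> P (m' + 1)" "a - t * unif_pow m' \<in> P (m' + 1) \<or> a + t * unif_pow m' \<in> P (m' + 1)"
          using i ie A[OF h] by auto
        have "a \<noteq> 0" "val a = m'" using close_val[of "t * unif_pow m'" a] val_tau[OF h, of m'] k(2) by auto
        then show ?thesis using k(1) False by blast
      qed
    next
      fix i :: "(int \<times> 'a \<times> 'a) + (int \<times> 'a \<times> 'a)" assume "i \<in> (\<lambda>t. Inr (m, t, z)) ` {t \<in> unit_reps. ?u - t \<in> P 1 \<or> ?u + t \<in> P 1}"
      then obtain t where t: "i = Inr (m, t, z)" "t \<in> unit_reps" "?u - t \<in> P 1 \<or> ?u + t \<in> P 1" by blast
      have "a \<in> P (- m)" using aP by (simp add: m_def)
      then have "y ** adj2 (coset_rep i) \<in> H" unfolding t(1) B[OF t(2)] using zc z(2) tc t(3) by blast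
      moreover have "i \<in> index M" using t m z(1) by (auto simp: index_def index_B_def)
      ultimately show "i \<in> ?J" by simp
    qed
    moreover have "inj (\<lambda>t. Inr (m, t, z) :: (int \<times> 'a \<times> 'a) + (int \<times> 'a \<times> 'a))" by (simp add: inj_def)
    ultimately show ?thesis using card_units_sign[OF u] by (simp add: card_image inj_on_subset)
  qed
qed

end

section \<open>Evaluation of the sum\<close>

context affine_generic_char begin

text \<open>
  The conjugate is upper triangular with diagonal \<open>(a, a\<^sup>-\<^sup>1)\<close>, and \<open>psi\<close> sees only its upper right entry.
\<close>

lemma chi_rep_A:
  assumes a: "a - 1 \<in> P 1" and \<tau>: "\<tau> \<noteq> 0"
  shows "chi (rep_A \<tau> z ** mat2 a 0 0 (inverse a) ** adj2 (rep_A \<tau> z)) =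
    (if - (\<tau> * \<tau> * (a - inverse a)) * z \<in> P 0
     then psi (upper_unip (- (\<tau> * \<tau> * (a - inverse a)) * z * inverse a)) else 0)"
proof -
  have a0: "a \<noteq> 0" using one_unit[OF a] by simp
  let ?b = "- (\<tau> * \<tau> * (a - inverse a)) * z"
  have e: "rep_A \<tau> z ** mat2 a 0 0 (inverse a) ** adj2 (rep_A \<tau> z) = mat2 a ?b 0 (inverse a)"
    using a0 \<tau> by (simp add: rep_A_def field_simps)
  show ?thesis
    unfolding e chi_def mat2_in_H using psi_upper[OF a, of "inverse a" ?b] a a0 by simp
qed

lemma chi_rep_B:
  assumes a: "a - 1 \<in> P 1" and \<tau>: "\<tau> \<noteq> 0"
  shows "chi (rep_B \<tau> z ** mat2 a 0 0 (inverse a) ** adj2 (rep_B \<tau> z)) =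
    (if (a - inverse a) / (\<tau> * \<tau>) * z \<in> P 1
     then psi (lower_unip ((a - inverse a) / (\<tau> * \<tau>) * z * inverse a)) else 0)"
proof -
  have a0: "a \<noteq> 0" using one_unit[OF a] by simp
  have a': "inverse a - 1 \<in> P 1" using unit_det[of a 0 0 "inverse a"] a a0 by simp
  let ?c = "(a - inverse a) / (\<tau> * \<tau>) * z"
  have e: "rep_B \<tau> z ** mat2 a 0 0 (inverse a) ** adj2 (rep_B \<tau> z) = mat2 (inverse a) 0 ?c a"
    using a0 \<tau> by (simp add: rep_B_def field_simps)
  show ?thesis
    unfolding e chi_def mat2_in_H using psi_lower[OF a', of a ?c] a' a0 by simp
qed

context
  fixes a :: 'a and r M :: int
  assumes a: "a - 1 \<in> P 1" "a \<noteq> inverse a" and r: "r = val (a - inverse a)" and rM: "r \<le> M"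
begin

lemma a_unit: "a \<noteq> 0" "val a = 0"
  using one_unit[OF a(1)] by auto

lemma diff_nz: "a - inverse a \<noteq> 0"
  using a(2) by simp

lemma r_pos: "1 \<le> r"
proof -
  have "inverse a - 1 \<in> P 1" using unit_det[of a 0 0 "inverse a"] a(1) a_unit by simp
  then have "a - inverse a \<in> P 1" using P_diff[OF a(1), of "inverse a - 1"] by simp
  then show ?thesis using P_iff[OF diff_nz] r by simp
qed

abbreviation "split_elt \<equiv> mat2 a 0 0 (inverse a)"

lemma inverse_a_P: "x * inverse a \<in> P n \<longleftrightarrow> x \<in> P n"
  using P_scale_iff[of "inverse a" x n] a_unit by (simp add: val_inverse mult.commute)

text \<open>
  The off-diagonal entry has the valuation of \<open>z\<close> plus \<open>2 m + r\<close>. On the whole range of \<open>z\<close> it lies in \<open>\<pp>\<close>, where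
  \<open>psi\<close> is trivial, exactly if \<open>m + r - M \<ge> 1\<close>.
\<close>

lemma sum_z_A:
  assumes m: "m \<in> {- M..M}" and t: "t \<in> unit_reps"
  shows "(\<Sum>z\<in>reps (- M - m) (- 2 * m).
      chi (rep_A (t * unif_pow m) z ** split_elt ** adj2 (rep_A (t * unif_pow m) z))) =
    (if M - r + 1 \<le> m then of_nat (q ^ nat (M - m)) else 0)"
proof -
  let ?\<tau> = "t * unif_pow m"
  have \<tau>: "?\<tau> \<noteq> 0" "val ?\<tau> = m" using val_tau[OF t, of m] by auto
  define \<kappa> where "\<kappa> = - (?\<tau> * ?\<tau> * (a - inverse a))"
  have tt: "?\<tau> * ?\<tau> \<noteq> 0" "val (?\<tau> * ?\<tau>) = 2 * m"
    using \<tau> val_mult[OF \<tau>(1) \<tau>(1)] by auto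
  have \<kappa>: "\<kappa> \<noteq> 0" "val \<kappa> = 2 * m + r"
    unfolding \<kappa>_def val_minus val_mult[OF tt(1) diff_nz] tt(2) r using diff_nz tt(1) by auto
  obtain z0 where z0: "z0 \<in> P 0" "psi (upper_unip z0) \<noteq> 1" using psi_up_nontrivial by blast
  have "(\<Sum>z\<in>reps (- M - m) (- 2 * m). chi (rep_A ?\<tau> z ** split_elt ** adj2 (rep_A ?\<tau> z))) =
      (\<Sum>z\<in>reps (- M - m) (- 2 * m). if \<kappa> * z \<in> P 0 then psi (upper_unip (\<kappa> * z * inverse a)) else 0)"
    by (simp only: chi_rep_A[OF a(1) \<tau>(1)] \<kappa>_def)
  also have "\<dots> = (if 0 + 1 \<le> (- M - m) + val \<kappa> then of_nat (card (reps (- M - m) (- 2 * m))) else 0)"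
  proof (rule character_sum[OF transversal_reps_A[OF m] \<kappa>(1)])
    show "0 + 1 \<le> - 2 * m + val \<kappa>" using \<kappa>(2) r_pos by simp
    show "psi (upper_unip ((x + y) * inverse a)) = psi (upper_unip (x * inverse a)) * psi (upper_unip (y * inverse a))"
      if "x \<in> P 0" "y \<in> P 0" for x y
      unfolding distrib_right using that by (intro psi_up_add) (simp_all only: inverse_a_P)
    show "psi (upper_unip (x * inverse a)) = 1" if "x \<in> P (0 + 1)" for x
      using that by (intro psi_up_P1) (simp only: inverse_a_P add_0)
    show "\<exists>x\<in>P 0. psi (upper_unip (x * inverse a)) \<noteq> 1"
    proof (rule bexI[of _ "z0 * a"])
      have e: "z0 * a * inverse a = z0" using a_unit(1) by (simp add: mult.assoc)
      show "psi (upper_unip (z0 * a * inverse a)) \<noteq> 1" unfolding e by (rule z0(2))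
      show "z0 * a \<in> P 0" using inverse_a_P[of "z0 * a" 0] z0(1) unfolding e by blast
    qed
  qed
  also have "card (reps (- M - m) (- 2 * m)) = q ^ nat (M - m)"
    using reps(2)[of "- M - m" "- 2 * m"] m by simp
  also have "0 + 1 \<le> (- M - m) + val \<kappa> \<longleftrightarrow> M - r + 1 \<le> m" using \<kappa>(2) by auto
  finally show ?thesis .
qed

text \<open>
  Here the entry is in the lower left corner and has the valuation of \<open>z\<close> plus \<open>r - 2 m\<close>; the kernel of \<open>psi\<close> on that corner is
  \<open>\<pp>\<^sup>2\<close>, which gives the condition \<open>r - m - M \<ge> 2\<close>.
\<close>

lemma sum_z_B:
  assumes m: "m \<in> {- M..M}" and t: "t \<in> unit_reps"
  shows "(\<Sum>z\<in>reps (m - M) (2 * m + 1).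
      chi (rep_B (t * unif_pow m) z ** split_elt ** adj2 (rep_B (t * unif_pow m) z))) =
    (if m \<le> r - M - 2 then of_nat (q ^ nat (m + M + 1)) else 0)"
proof -
  let ?\<tau> = "t * unif_pow m"
  have \<tau>: "?\<tau> \<noteq> 0" "val ?\<tau> = m" using val_tau[OF t, of m] by auto
  define \<kappa> where "\<kappa> = (a - inverse a) / (?\<tau> * ?\<tau>)"
  have tt: "?\<tau> * ?\<tau> \<noteq> 0" "val (?\<tau> * ?\<tau>) = 2 * m"
    using \<tau> val_mult[OF \<tau>(1) \<tau>(1)] by auto
  have \<kappa>: "\<kappa> \<noteq> 0" "val \<kappa> = r - 2 * m"
    unfolding \<kappa>_def val_divide[OF diff_nz tt(1)] tt(2) r using diff_nz tt(1) by auto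
  obtain z0 where z0: "z0 \<in> P 1" "psi (lower_unip z0) \<noteq> 1" using psi_lo_nontrivial by blast
  have "(\<Sum>z\<in>reps (m - M) (2 * m + 1). chi (rep_B ?\<tau> z ** split_elt ** adj2 (rep_B ?\<tau> z))) =
      (\<Sum>z\<in>reps (m - M) (2 * m + 1). if \<kappa> * z \<in> P 1 then psi (lower_unip (\<kappa> * z * inverse a)) else 0)"
    by (simp only: chi_rep_B[OF a(1) \<tau>(1)] \<kappa>_def)
  also have "\<dots> = (if 1 + 1 \<le> (m - M) + val \<kappa> then of_nat (card (reps (m - M) (2 * m + 1))) else 0)"
  proof (rule character_sum[OF transversal_reps_B[OF m] \<kappa>(1)])
    show "1 + 1 \<le> 2 * m + 1 + val \<kappa>" using \<kappa>(2) r_pos by simp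
    show "psi (lower_unip ((x + y) * inverse a)) = psi (lower_unip (x * inverse a)) * psi (lower_unip (y * inverse a))"
      if "x \<in> P 1" "y \<in> P 1" for x y
      unfolding distrib_right using that by (intro psi_lo_add) (simp_all only: inverse_a_P)
    show "psi (lower_unip (x * inverse a)) = 1" if "x \<in> P (1 + 1)" for x
      using that by (intro psi_lo_P2) (simp only: inverse_a_P one_add_one)
    show "\<exists>x\<in>P 1. psi (lower_unip (x * inverse a)) \<noteq> 1"
    proof (rule bexI[of _ "z0 * a"])
      have e: "z0 * a * inverse a = z0" using a_unit(1) by (simp add: mult.assoc)
      show "psi (lower_unip (z0 * a * inverse a)) \<noteq> 1" unfolding e by (rule z0(2))
      show "z0 * a \<in> P 1" using inverse_a_P[of "z0 * a" 1] z0(1) unfolding e by blast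
    qed
  qed
  also have "card (reps (m - M) (2 * m + 1)) = q ^ nat (m + M + 1)"
    using reps(2)[of "m - M" "2 * m + 1"] m by (simp add: algebra_simps)
  also have "1 + 1 \<le> (m - M) + val \<kappa> \<longleftrightarrow> m \<le> r - M - 2" using \<kappa>(2) by auto
  finally show ?thesis .
qed

text \<open>
  The first family contributes the positions \<open>p = M - m \<ge> 0\<close> and the second the positions \<open>p = - m - M - 1 < 0\<close>.
  The hypothesis \<open>r \<le> M\<close> ensures that no surviving \<open>m\<close> is cut off by the bound \<open>\<bar>m\<bar> \<le> M\<close>.
\<close>

lemma sum_chi:
  "(\<Sum>i\<in>index M. chi (coset_rep i ** split_elt ** adj2 (coset_rep i))) =
    complex_of_real ((real q - 1) * (\<Sum>p\<in>{- r<..<r}. real q ^ nat \<bar>p\<bar>))"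
proof -
  define X where "X = (\<lambda>x. chi (x ** split_elt ** adj2 x))"
  define fA fB :: "int \<Rightarrow> complex" where "fA = (\<lambda>m. if M - r + 1 \<le> m then of_nat (q ^ nat (M - m)) else 0)"
    and "fB = (\<lambda>m. if m \<le> r - M - 2 then of_nat (q ^ nat (m + M + 1)) else 0)"
  have fin: "finite (reps (- M - m) (- 2 * m))" "finite (reps (m - M) (2 * m + 1))" if "m \<in> {- M..M}" for m
    using transversal_reps_A[OF that] transversal_reps_B[OF that] by (simp_all add: transversal_def)
  have "(\<Sum>i\<in>index_A M. X (coset_rep (Inl i))) =
      (\<Sum>m\<in>{- M..M}. \<Sum>tz\<in>unit_reps \<times> reps (- M - m) (- 2 * m). X (coset_rep (Inl (m, tz))))"
    unfolding index_A_def using finite_units fin by (subst sum.Sigma) (auto simp: case_prod_unfold)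
  also have "\<dots> = (\<Sum>m\<in>{- M..M}. \<Sum>t\<in>unit_reps. \<Sum>z\<in>reps (- M - m) (- 2 * m). X (coset_rep (Inl (m, t, z))))"
    by (simp add: sum.cartesian_product case_prod_unfold)
  also have "\<dots> = (\<Sum>m\<in>{- M..M}. \<Sum>t\<in>unit_reps. fA m)"
    unfolding X_def coset_rep_def fA_def sum.case prod.case by (intro sum.cong refl sum_z_A)
  also have "\<dots> = of_nat (q - 1) * (\<Sum>m\<in>{- M..M}. fA m)"
    by (simp add: card_units sum_distrib_left)
  also have "(\<Sum>m\<in>{- M..M}. fA m) = (\<Sum>m\<in>{M - r + 1..M}. of_nat (q ^ nat (M - m)))"
    unfolding fA_def using rM r_pos by (intro sum.mono_neutral_cong_right) auto
  also have "\<dots> = (\<Sum>p\<in>{0..<r}. of_nat (q ^ nat \<bar>p\<bar>))"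
    by (rule sum.reindex_bij_witness[where i = "\<lambda>p. M - p" and j = "\<lambda>m. M - m"]) auto
  finally have A: "(\<Sum>i\<in>index_A M. X (coset_rep (Inl i))) = of_nat (q - 1) * (\<Sum>p\<in>{0..<r}. of_nat (q ^ nat \<bar>p\<bar>))" .
  have "(\<Sum>i\<in>index_B M. X (coset_rep (Inr i))) =
      (\<Sum>m\<in>{- M..M}. \<Sum>tz\<in>unit_reps \<times> reps (m - M) (2 * m + 1). X (coset_rep (Inr (m, tz))))"
    unfolding index_B_def using finite_units fin by (subst sum.Sigma) (auto simp: case_prod_unfold)
  also have "\<dots> = (\<Sum>m\<in>{- M..M}. \<Sum>t\<in>unit_reps. \<Sum>z\<in>reps (m - M) (2 * m + 1). X (coset_rep (Inr (m, t, z))))"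
    by (simp add: sum.cartesian_product case_prod_unfold)
  also have "\<dots> = (\<Sum>m\<in>{- M..M}. \<Sum>t\<in>unit_reps. fB m)"
    unfolding X_def coset_rep_def fB_def sum.case prod.case by (intro sum.cong refl sum_z_B)
  also have "\<dots> = of_nat (q - 1) * (\<Sum>m\<in>{- M..M}. fB m)"
    by (simp add: card_units sum_distrib_left)
  also have "(\<Sum>m\<in>{- M..M}. fB m) = (\<Sum>m\<in>{- M..r - M - 2}. of_nat (q ^ nat (m + M + 1)))"
    unfolding fB_def using rM r_pos by (intro sum.mono_neutral_cong_right) auto
  also have "\<dots> = (\<Sum>p\<in>{- r<..<0}. of_nat (q ^ nat \<bar>p\<bar>))"
    by (rule sum.reindex_bij_witness[where i = "\<lambda>p. - p - M - 1" and j = "\<lambda>m. - m - M - 1"])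
      (auto simp: algebra_simps)
  finally have B: "(\<Sum>i\<in>index_B M. X (coset_rep (Inr i))) = of_nat (q - 1) * (\<Sum>p\<in>{- r<..<0}. of_nat (q ^ nat \<bar>p\<bar>))" .
  have split: "{- r<..<r} = {0..<r} \<union> {- r<..<0}" using r_pos by auto
  have "(\<Sum>i\<in>index M. X (coset_rep i)) = (\<Sum>i\<in>index_A M. X (coset_rep (Inl i))) + (\<Sum>i\<in>index_B M. X (coset_rep (Inr i)))"
    unfolding index_def using finite_index_A finite_index_B by (simp add: sum.Plus o_def)
  also have "\<dots> = of_nat (q - 1) * (\<Sum>p\<in>{- r<..<r}. of_nat (q ^ nat \<bar>p\<bar>))"
    unfolding A B split by (subst sum.union_disjoint) (auto simp: distrib_left)
  also have "\<dots> = complex_of_real ((real q - 1) * (\<Sum>p\<in>{- r<..<r}. real q ^ nat \<bar>p\<bar>))"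
    using q_pos by (simp add: of_nat_diff)
  finally show ?thesis by (simp add: X_def)
qed

end

end

section \<open>The character at split elements\<close>

text \<open>
  The discriminant of \<open>X\<^sup>2 - t X + 1\<close> is \<open>t\<^sup>2 - 4\<close>, and \<open>4 - t\<^sup>2\<close> is an explicit combination of the
  polynomial and its derivative.
\<close>

lemma regular_semisimpleI:
  fixes x :: "'a::field_char_0^2^2"
  assumes x: "x \<in> carrier SL2" and tr: "(x $ 1 $ 1 + x $ 2 $ 2) ^ 2 \<noteq> 4"
  shows "x \<in> regular_semisimple"
proof -
  define t where "t = x $ 1 $ 1 + x $ 2 $ 2"
  have d: "x $ 1 $ 1 * x $ 2 $ 2 - x $ 1 $ 2 * x $ 2 $ 1 = 1" using x by (simp add: SL2_iff det_2)
  have cp: "char_polynomial x = [:1, - t, 1:]"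
    using d unfolding char_polynomial_def det_2 t_def
    by (simp add: mat_def algebra_simps)
  have pd: "pderiv [:1, - t, 1:] = [:- t, 2:]" by (simp add: pderiv_pCons)
  have bez: "smult 4 [:1, - t, 1:] - [:- t, 2:] * [:- t, 2:] = [:4 - t ^ 2:]"
    by (simp add: algebra_simps power2_eq_square)
  have "coprime [:1, - t, 1:] [:- t, 2:]"
  proof (rule coprimeI)
    fix c assume c: "c dvd [:1, - t, 1:]" "c dvd [:- t, 2:]"
    then have "c dvd [:4 - t ^ 2:]" unfolding bez[symmetric] by (intro dvd_diff dvd_smult dvd_mult)
    moreover have "[:4 - t ^ 2:] dvd 1" using tr by (simp add: is_unit_pCons_iff t_def)
    ultimately show "is_unit c" using dvd_trans by blast
  qed
  then show ?thesis using x by (simp add: regular_semisimple_def cp pd)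
qed

context affine_generic_char begin

text \<open>
  At the diagonal element the discriminant is \<open>(a - a\<^sup>-\<^sup>1)\<^sup>2\<close>; matrices that agree with it modulo a higher power of \<open>\<pp>\<close>
  have a nonzero discriminant too.
\<close>

lemma nbhd_regular:
  assumes a: "a - 1 \<in> P 1" "a \<noteq> inverse a" and n: "2 * val (a - inverse a) < n" "0 \<le> n"
  shows "nbhd n (mat2 a 0 0 (inverse a)) \<subseteq> regular_semisimple"
proof
  fix x assume x: "x \<in> nbhd n (mat2 a 0 0 (inverse a))"
  have a0: "a \<noteq> 0" "val a = 0" using one_unit[OF a(1)] by auto
  define t where "t = x $ 1 $ 1 + x $ 2 $ 2"
  define s where "s = a + inverse a"
  have "t - s \<in> P n"
  proof (cases x)
    case (mat2 b c d e)
    then have "b - a \<in> P n" "e - inverse a \<in> P n" using x by (auto simp: nbhd_def)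
    from P_add[OF this] show ?thesis by (simp add: t_def s_def mat2 algebra_simps)
  qed
  have "a \<in> P 0" "inverse a \<in> P 0" using a0 by (simp_all add: prime_pow_def val_inverse)
  then have "s \<in> P 0" unfolding s_def by (rule P_add)
  then have "t \<in> P 0" using P_add[OF P_mono[OF \<open>t - s \<in> P n\<close> n(2)]] by fastforce
  have ts: "(t - s) * (t + s) \<in> P n"
    by (rule P_mult[OF \<open>t - s \<in> P n\<close> P_add[OF \<open>t \<in> P 0\<close> \<open>s \<in> P 0\<close>]]) simp
  have d: "(a - inverse a) * (a - inverse a) = s ^ 2 - 4"
    using a0(1) by (simp add: s_def power2_eq_square field_simps)
  have nz: "a - inverse a \<noteq> 0" using a(2) by simp
  have "t ^ 2 \<noteq> 4"
  proof
    assume "t ^ 2 = 4"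
    then have "(a - inverse a) * (a - inverse a) = - ((t - s) * (t + s))"
      unfolding d by (simp add: power2_eq_square algebra_simps)
    then have "(a - inverse a) * (a - inverse a) \<in> P n" using ts by (simp only: P_minus_iff)
    then have "n \<le> 2 * val (a - inverse a)" using nz by (simp add: P_iff val_mult)
    then show False using n by simp
  qed
  then show "x \<in> regular_semisimple"
    using x by (intro regular_semisimpleI) (simp_all add: nbhd_def t_def)
qed

text \<open>
  The level \<open>2 M + 2\<close> has to be large for three reasons: the neighbourhood of \<open>g\<close> must consist of regular elements, \<open>\<theta>\<close>
  must be constant on it, and \<open>M \<ge> r\<close> is needed to evaluate the sum.
\<close>

theorem character_split:
  fixes a :: 'a and r :: int
  assumes a: "a - 1 \<in> P 1" "a \<noteq> inverse a" and r: "r = val (a - inverse a)"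
    and \<mu>: "haar_SL2 \<mu>" and \<theta>: "is_HC_character \<mu> ind \<theta>"
  shows "\<theta> (mat2 a 0 0 (inverse a)) = complex_of_real (c_const val * (\<Sum>p\<in>{- r<..<r}. real q ^ nat \<bar>p\<bar>))"
proof -
  let ?g = "mat2 a 0 0 (inverse a)"
  have a0: "a \<noteq> 0" "val a = 0" using one_unit[OF a(1)] by auto
  have g: "?g \<in> carrier SL2" "?g \<in> box 0" using a0 by (simp_all add: prime_pow_def val_inverse)
  have "?g \<in> nbhd (max 0 (2 * r + 1)) ?g" using g by (simp add: nbhd_def)
  have greg: "?g \<in> regular_semisimple"
  proof -
    have "2 * val (a - inverse a) < max 0 (2 * r + 1)" unfolding r by linarith
    from nbhd_regular[OF a this] show ?thesis using \<open>?g \<in> nbhd (max 0 (2 * r + 1)) ?g\<close> by auto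
  qed
  have lc: "locally_constant_on regular_semisimple \<theta>" using \<theta> by (simp add: is_HC_character_def)
  then obtain U where U: "openin (top_of_set regular_semisimple) U" "?g \<in> U" "\<theta> constant_on U"
    using greg unfolding locally_constant_on_def by blast
  then obtain T where T: "open T" "U = regular_semisimple \<inter> T" by (auto simp: openin_open)
  then obtain n where n: "\<And>y. near n ?g y \<Longrightarrow> y \<in> T" using U(2) open_mat_iff[of T] by blast
  define M where "M = max (max 0 n) r"
  have M: "0 \<le> M" "n \<le> M" "r \<le> M" by (simp_all add: M_def)
  let ?L = "nbhd (2 * M + 2) ?g"
  have Lreg: "?L \<subseteq> regular_semisimple" using M r by (intro nbhd_regular[OF a]) auto
  have \<theta>L: "\<theta> y = \<theta> ?g" if y: "y \<in> ?L" for y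
  proof -
    have "near n ?g y" using y M by (auto simp: nbhd_def intro: near_mono)
    then have "y \<in> U" using n T(2) Lreg y by blast
    then show ?thesis using U(2,3) by (auto simp: constant_on_def)
  qed
  have test: "indicator ?L \<in> test_functions"
    unfolding test_functions_def
  proof (intro CollectI conjI)
    show "locally_constant_on (carrier SL2) (indicator ?L :: _ \<Rightarrow> complex)"
      unfolding locally_constant_on_def
    proof
      fix x :: "'a^2^2" assume x: "x \<in> carrier SL2"
      let ?V = "nbhd (2 * M + 2) x"
      have "y \<in> ?L \<longleftrightarrow> x \<in> ?L" if "y \<in> ?V" for y
      proof -
        have yx: "y \<in> carrier SL2" "near (2 * M + 2) x y" "near (2 * M + 2) y x"
          using that near_sym by (auto simp: nbhd_def)
        show ?thesis
          using yx x near_trans[of _ ?g y x] near_trans[of _ ?g x y] by (auto simp: nbhd_def)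
      qed
      then have "(indicator ?L :: _ \<Rightarrow> complex) constant_on ?V"
        unfolding constant_on_def by (intro exI[of _ "indicator ?L x"]) (simp add: indicator_def)
      then show "\<exists>V. openin (top_of_set (carrier SL2)) V \<and> x \<in> V \<and> (indicator ?L :: _ \<Rightarrow> complex) constant_on V"
        using openin_nbhd x by (intro exI[of _ ?V]) (simp add: nbhd_def)
    qed
    show "\<exists>C. compact C \<and> C \<subseteq> carrier SL2 \<and> (\<forall>x. x \<notin> C \<longrightarrow> indicator ?L x = (0::complex))"
      using compact_nbhd nbhd_SL2 by (intro exI[of _ ?L]) auto
  qed
  have "distribution_character \<mu> ind (indicator ?L) = (LINT x:regular_semisimple|\<mu>. indicator ?L x * \<theta> x)"
    using \<theta> test unfolding is_HC_character_def by blast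
  also have "\<dots> = (\<integral>x. indicat_real ?L x *\<^sub>R \<theta> ?g \<partial>\<mu>)"
    unfolding set_lebesgue_integral_def
  proof (rule Bochner_Integration.integral_cong[OF refl])
    fix x
    show "indicator regular_semisimple x *\<^sub>R (indicator ?L x * \<theta> x) = indicat_real ?L x *\<^sub>R \<theta> ?g"
    proof (cases "x \<in> ?L")
      case True
      then show ?thesis using Lreg \<theta>L[OF True] by auto
    qed simp
  qed
  also have "\<dots> = measure \<mu> ?L *\<^sub>R \<theta> ?g"
    using L_sets[OF \<mu> g M(1)] L_finite[OF \<mu> g M(1)] sets.sets_into_space[OF L_sets[OF \<mu> g M(1)]]
    by (subst integral_scaleR_left) (auto simp: Int_absorb2)
  finally have 1: "distribution_character \<mu> ind (indicator ?L) = measure \<mu> ?L * \<theta> ?g"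
    by (simp add: scaleR_conv_of_real)
  have fin: "finite (index M)" unfolding index_def by (rule finite_Plus[OF finite_index_A finite_index_B])
  have 2: "distribution_character \<mu> ind (indicator ?L) =
     measure \<mu> ?L * ((\<Sum>i\<in>index M. chi (coset_rep i ** ?g ** adj2 (coset_rep i))) / sign_count)"
    by (rule trace_formula[OF \<mu> g M(1) fin coset_rep_mem sign_count_pos card_index])
  have "measure \<mu> ?L > 0" by (rule L_pos[OF \<mu> g M(1)])
  then have "complex_of_real (measure \<mu> ?L) \<noteq> 0" by simp
  moreover have "complex_of_real (measure \<mu> ?L) * \<theta> ?g =
      measure \<mu> ?L * ((\<Sum>i\<in>index M. chi (coset_rep i ** ?g ** adj2 (coset_rep i))) / sign_count)"
    using 1 2 by (rule trans[OF sym])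
  ultimately have "\<theta> ?g = (\<Sum>i\<in>index M. chi (coset_rep i ** ?g ** adj2 (coset_rep i))) / sign_count"
    by (rule mult_left_cancel[THEN iffD1])
  also have "\<dots> = complex_of_real (c_const val * (\<Sum>p\<in>{- r<..<r}. real q ^ nat \<bar>p\<bar>))"
    unfolding sum_chi[OF a r M(3)] c_const_eq by simp
  finally show ?thesis .
qed

end

theorem theorem1p1:
  fixes val :: "'a::{field_char_0, topological_space} \<Rightarrow> int"
    and unif a :: 'a
    and r :: int
    and \<mu> :: "('a^2^2) measure"
    and \<pi> :: "('a^2^2, 'a^2^2) fun_rep"
    and \<theta> :: "'a^2^2 \<Rightarrow> complex"
  assumes "nonarch_local_field val unif"
    and "a - 1 \<in> prime_pow val 1" and "a \<noteq> inverse a"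
    and "r = val (a - inverse a)"
    and "simple_supercuspidal val \<pi>"
    and "haar_SL2 \<mu>" and "is_HC_character \<mu> \<pi> \<theta>"
  shows "\<theta> (mat2 a 0 0 (inverse a)) =
           complex_of_real (c_const val *
             (\<Sum>w\<in>{w \<in> carrier (affine_weyl val). int (weyl_length val unif w) < r}.
                real (residue_order val) ^ weyl_length val unif w))"
proof -
  interpret nonarch_local_field val unif by (rule assms(1))
  obtain psi where psi: "affine_generic val psi" "\<pi> = cInd (H_sub val) psi"
    using assms(5) unfolding simple_supercuspidal_def by blast
  interpret affine_generic_char val unif psi by unfold_locales (rule psi(1))
  have "is_HC_character \<mu> ind \<theta>" using assms(7) psi(2) by simp
  from character_split[OF assms(2-4,6) this] show ?thesis
    unfolding sum_weyl_length .
qed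

end
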